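(* Let $\Phi\subset\mathbb{R}^3$ be a surface of negative Gaussian curvature. Then $\Phi$ is a ruled surface if and only if there exists a relative normalization $\bar y$ of $\Phi$ for which one of the following equivalent properties holds true (identically on $M$): (a) $3(S-H)+J=0$, (b) $3\|\bar T\|_G=2J$, (c) $\|\bar T\|_G=2(H-S)$. Here $H$, $J$, $S$, $\bar T$, $\|\bar T\|_G$ are the mean relative curvature, the Pick-invariant, the scalar curvature of the relative metric, the Tchebychev-vector and its relative norm for the normalization $\bar y$.
   Context: Let $n=2$. A surface $\Phi=(M,\bar x)$ in $\mathbb{R}^{3}$ consists of an oriented connected $2$-dimensional $C^r$-manifold $M$ ($r\ge 3$) and a $C^r$-immersion $\bar x:M\to\mathbb{R}^{3}$ whose Gaussian curvature $K_I$ never vanishes. Let $u^1,u^2$ be local coordinates and write $f_{/i}=\partial f/\partial u^i$, etc. Let $\bar\xi$ be the Euclidean unit normal field and $h_{ij}=\langle\bar\xi,\bar x_{/ij}\rangle$ the components of the second fundamental form $II$. A $C^s$-map $\bar y:M\to\mathbb{R}^{3}$ ($r>s\ge1$) is a relative normalization of $\Phi$ if at every point of $M$ the vectors $\bar x_{/1},\bar x_{/2},\bar y$ are linearly independent and every $\bar y_{/i}$ lies in the span of $\bar x_{/1},\bar x_{/2}$. Here $r,s$ are understood to be large enough for all quantities involved to be defined. The support function of $\bar y$ is $q=\langle\bar\xi,\bar y\rangle$; it never vanishes, and orientations are chosen so that $q>0$. The covector $\bar X$ is defined by $\langle\bar X,\bar x_{/i}\rangle=0$ for all $i$ and $\langle\bar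 X,\bar y\rangle=1$, so $\bar X=q^{-1}\bar\xi$. The relative metric is the metric $G_{ij}=\langle\bar X,\bar x_{/ij}\rangle=q^{-1}h_{ij}$ (indefinite when $K_I<0$); indices are raised and lowered with $G$, and $\nabla^G$ is its Levi-Civita covariant derivative. The Darboux tensor is $A_{jkl}=\langle\bar X,\nabla^G_l\nabla^G_k\bar x_{/j}\rangle$. The Tchebychev-vector is $\bar T=T^m\bar x_{/m}$ with $T^m=\frac12A_i^{im}$, and its relative norm is $\|\bar T\|_G:=G_{ij}T^iT^j$ (no square root). The Pick-invariant is $J=\frac1{2}A_{jkl}A^{jkl}$. The relative shape operator $B_i^j$ is defined by $\bar y_{/i}=-B_i^j\bar x_{/j}$, and the mean relative curvature is $H=\frac12\operatorname{tr}(B_i^j)$. $S$ is the scalar curvature of $G$, normalized so that for $n=2$ it is the Gaussian curvature of the (pseudo-)Riemannian metric $G$, i.e. $S=\frac12G^{ij}R_{ij}$ with $R_{ij}$ the Ricci tensor of $G$ (sign convention giving $+1$ for the round unit sphere). "Ruled surface" is understood in the usual local sense: through every point of the surface there passes a straight line segment contained in the surface. *)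

theory Defs
  imports "HOL-Analysis.Analysis"
begin

unbundle cross3_syntax

section \<open>Differentiability classes on open sets of the coordinate plane\<close>

definition pd :: "2 \<Rightarrow> (real^2 \<Rightarrow> 'b::real_normed_vector) \<Rightarrow> real^2 \<Rightarrow> 'b" where
  "pd i f u = frechet_derivative f (at u) (axis i 1)"

text \<open>To be used for open \<open>S\<close> only: the derivatives are the unrestricted ones, taken at
  points of \<open>S\<close>.\<close>

fun Ck_on :: "nat \<Rightarrow> (real^2 \<Rightarrow> 'b::real_normed_vector) \<Rightarrow> (real^2) set \<Rightarrow> bool" where
  "Ck_on 0 f S \<longleftrightarrow> continuous_on S f"
| "Ck_on (Suc k) f S \<longleftrightarrow> (\<forall>u\<in>S. f differentiable (at u)) \<and> (\<forall>i. Ck_on k (pd i f) S)"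


section \<open>Oriented connected two-dimensional manifolds\<close>

type_synonym 'm chart = "'m set \<times> ('m \<Rightarrow> real^2)"

definition chart_image :: "'m chart \<Rightarrow> (real^2) set" where
  "chart_image c = snd c ` fst c"

text \<open>Expression of a map on the manifold in the local coordinates given by a chart; it is
  meaningful on \<open>chart_image c\<close>.\<close>

definition in_chart :: "'m chart \<Rightarrow> ('m \<Rightarrow> 'b) \<Rightarrow> real^2 \<Rightarrow> 'b" where
  "in_chart c f = f \<circ> inv_into (fst c) (snd c)"

definition is_chart :: "'m topology \<Rightarrow> 'm chart \<Rightarrow> bool" where
  "is_chart M c \<longleftrightarrow>
     openin M (fst c) \<and> open (chart_image c) \<and>
     homeomorphic_map (subtopology M (fst c)) (top_of_set (chart_image c)) (snd c)"

text \<open>The manifold structure is given by an atlas (not necessarily maximal), the orientation by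
  the requirement that all coordinate changes have positive Jacobian determinant.\<close>

definition oriented_manifold2 :: "nat \<Rightarrow> 'm topology \<Rightarrow> 'm chart set \<Rightarrow> bool" where
  "oriented_manifold2 r M \<A> \<longleftrightarrow>
     Hausdorff_space M \<and> second_countable M \<and> connected_space M \<and>
     (\<forall>c\<in>\<A>. is_chart M c) \<and> (\<Union>c\<in>\<A>. fst c) = topspace M \<and>
     (\<forall>c\<in>\<A>. \<forall>c'\<in>\<A>.
        Ck_on r (in_chart c (snd c')) (snd c ` (fst c \<inter> fst c')) \<and>
        (\<forall>u\<in>snd c ` (fst c \<inter> fst c'). det (jacobian (in_chart c (snd c')) (at u)) > 0))"

definition Ck_map :: "nat \<Rightarrow> 'm chart set \<Rightarrow> ('m \<Rightarrow> 'b::real_normed_vector) \<Rightarrow> bool" where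
  "Ck_map k \<A> f \<longleftrightarrow> (\<forall>c\<in>\<A>. Ck_on k (in_chart c f) (chart_image c))"


section \<open>Euclidean geometry of a local parametrization\<close>

definition unit_normal :: "(real^2 \<Rightarrow> real^3) \<Rightarrow> real^2 \<Rightarrow> real^3" where
  "unit_normal x u = (let N = pd 1 x u \<times> pd 2 x u in N /\<^sub>R norm N)"

definition first_form :: "(real^2 \<Rightarrow> real^3) \<Rightarrow> real^2 \<Rightarrow> real^2^2" where
  "first_form x u = (\<chi> i j. pd i x u \<bullet> pd j x u)"

definition second_form :: "(real^2 \<Rightarrow> real^3) \<Rightarrow> real^2 \<Rightarrow> real^2^2" where
  "second_form x u = (\<chi> i j. unit_normal x u \<bullet> pd j (pd i x) u)"

definition gauss_curvature :: "(real^2 \<Rightarrow> real^3) \<Rightarrow> real^2 \<Rightarrow> real" where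
  "gauss_curvature x u = det (second_form x u) / det (first_form x u)"

definition surface :: "nat \<Rightarrow> 'm topology \<Rightarrow> 'm chart set \<Rightarrow> ('m \<Rightarrow> real^3) \<Rightarrow> bool" where
  "surface r M \<A> x \<longleftrightarrow>
     oriented_manifold2 r M \<A> \<and> Ck_map r \<A> x \<and>
     (\<forall>c\<in>\<A>. \<forall>u\<in>chart_image c.
        inj (frechet_derivative (in_chart c x) (at u)) \<and> gauss_curvature (in_chart c x) u \<noteq> 0)"

definition negatively_curved :: "'m chart set \<Rightarrow> ('m \<Rightarrow> real^3) \<Rightarrow> bool" where
  "negatively_curved \<A> x \<longleftrightarrow>
     (\<forall>c\<in>\<A>. \<forall>u\<in>chart_image c. gauss_curvature (in_chart c x) u < 0)"

text \<open>The segment is required to be the image of a path in the manifold passing through the given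
  point, since \<open>x\<close> is an immersion and need not be injective. The point may be an end point of
  the segment.\<close>

definition ruled :: "'m topology \<Rightarrow> ('m \<Rightarrow> real^3) \<Rightarrow> bool" where
  "ruled M x \<longleftrightarrow>
     (\<forall>p\<in>topspace M. \<exists>a b \<gamma>. a \<noteq> b \<and> pathin M \<gamma> \<and> p \<in> \<gamma> ` {0..1} \<and>
        (\<forall>t\<in>{0..1}. x (\<gamma> t) = linepath a b t))"


section \<open>Relative normalizations\<close>

definition relative_normalization ::
  "nat \<Rightarrow> 'm chart set \<Rightarrow> ('m \<Rightarrow> real^3) \<Rightarrow> ('m \<Rightarrow> real^3) \<Rightarrow> bool" where
  "relative_normalization s \<A> x y \<longleftrightarrow>
     Ck_map s \<A> y \<and>
     (\<forall>c\<in>\<A>. \<forall>u\<in>chart_image c.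
        let x1 = pd 1 (in_chart c x) u; x2 = pd 2 (in_chart c x) u; y0 = in_chart c y u
        in distinct [x1, x2, y0] \<and> independent {x1, x2, y0} \<and>
           (\<forall>i. pd i (in_chart c y) u \<in> span {x1, x2}))"

text \<open>Below, \<open>x\<close> and \<open>y\<close> are the coordinate expressions of the immersion and of the
  relative normalization. Replacing the unit normal by its opposite (i.e. changing the
  orientation) changes the sign of \<open>support\<close> but not \<open>conormal\<close>, on which all further
  quantities depend; so the convention that the orientation is chosen with positive support
  function needs no separate hypothesis.\<close>

definition support :: "(real^2 \<Rightarrow> real^3) \<Rightarrow> (real^2 \<Rightarrow> real^3) \<Rightarrow> real^2 \<Rightarrow> real" where
  "support x y u = unit_normal x u \<bullet> y u"

definition conormal :: "(real^2 \<Rightarrow> real^3) \<Rightarrow> (real^2 \<Rightarrow> real^3) \<Rightarrow> real^2 \<Rightarrow> real^3" where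
  "conormal x y u = unit_normal x u /\<^sub>R support x y u"

lemma conormal_characterization:
  assumes "distinct [pd 1 x u, pd 2 x u, y u]" "independent {pd 1 x u, pd 2 x u, y u}"
  shows "support x y u \<noteq> 0"
    and "X = conormal x y u \<longleftrightarrow> (\<forall>i. X \<bullet> pd i x u = 0) \<and> X \<bullet> y u = 1"
proof -
  let ?a = "pd 1 x u" and ?b = "pd 2 x u" and ?y = "y u"
  let ?N = "?a \<times> ?b"
  have card3: "card {?a, ?b, ?y} = 3"
    using assms(1) by simp
  have spn: "span {?a, ?b, ?y} = UNIV"
    using card_eq_dim[of "{?a, ?b, ?y}" UNIV] assms(2) card3 by auto
  have zero: "v = 0" if "v \<bullet> ?a = 0" "v \<bullet> ?b = 0" "v \<bullet> ?y = 0" for v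
  proof -
    have "orthogonal v v"
      by (rule orthogonal_to_span[where S = "{?a, ?b, ?y}"]) (use that spn in \<open>auto simp: orthogonal_def\<close>)
    thus ?thesis by (simp add: orthogonal_def)
  qed
  have ya: "?y \<notin> span {?b, ?a}" and ab: "?a \<notin> span {?b}" and b0: "?b \<noteq> 0"
  proof -
    have eq: "{?a, ?b, ?y} = insert ?y {?b, ?a}" by blast
    have yn: "?y \<notin> {?b, ?a}" using assms(1) by auto
    have i3: "independent (insert ?y {?b, ?a})" using assms(2) eq by simp
    show "?y \<notin> span {?b, ?a}" using i3 yn independent_insert[of ?y "{?b, ?a}"] by meson
    have i2: "independent (insert ?a {?b})"
      by (rule independent_mono[OF i3]) blast
    have "?a \<notin> {?b}" using assms(1) by auto
    then show "?a \<notin> span {?b}" using i2 independent_insert[of ?a "{?b}"] by meson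
    show "?b \<noteq> 0" using dependent_zero[of "{?a, ?b, ?y}"] assms(2) by auto
  qed
  have N0: "?N \<noteq> 0"
  proof
    assume "?N = 0"
    then have "?b \<times> ?a = 0"
      using cross_skew[of ?b ?a] by simp
    then have "collinear {0, ?b, ?a}"
      by (simp add: cross_eq_0)
    then have "?b = 0 \<or> ?a = 0 \<or> (\<exists>c. ?a = c *\<^sub>R ?b)"
      by (simp add: collinear_lemma)
    then show False
      using b0 ab span_zero[of "{?b}"] span_mul[OF span_base[of ?b "{?b}"]] by auto
  qed
  have Na: "?N \<bullet> ?a = 0" "?N \<bullet> ?b = 0"
    by (simp_all add: dot_cross_self)
  have Ny: "?N \<bullet> ?y \<noteq> 0"
    using zero[OF Na] N0 by blast
  then show q: "support x y u \<noteq> 0"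
    using N0 by (simp add: support_def unit_normal_def Let_def)
  have C: "conormal x y u \<bullet> ?a = 0" "conormal x y u \<bullet> ?b = 0"
    using Na by (simp_all add: conormal_def unit_normal_def Let_def)
  have Cy: "conormal x y u \<bullet> ?y = 1"
    using q by (simp add: conormal_def support_def)
  show "X = conormal x y u \<longleftrightarrow> (\<forall>i. X \<bullet> pd i x u = 0) \<and> X \<bullet> y u = 1"
    using C Cy zero[of "X - conormal x y u"] by (auto simp: forall_2 inner_diff_left)
qed

definition rel_metric :: "(real^2 \<Rightarrow> real^3) \<Rightarrow> (real^2 \<Rightarrow> real^3) \<Rightarrow> real^2 \<Rightarrow> real^2^2" where
  "rel_metric x y u = (\<chi> i j. conormal x y u \<bullet> pd j (pd i x) u)"


section \<open>Levi-Civita connection and curvature of a two-dimensional metric\<close>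

text \<open>\<open>christoffel G k i j u\<close> is the symbol with upper index \<open>k\<close> and lower indices
  \<open>i\<close>, \<open>j\<close>.\<close>

definition christoffel :: "(real^2 \<Rightarrow> real^2^2) \<Rightarrow> 2 \<Rightarrow> 2 \<Rightarrow> 2 \<Rightarrow> real^2 \<Rightarrow> real" where
  "christoffel G k i j u = (1/2) * (\<Sum>l\<in>UNIV. matrix_inv (G u) $ k $ l *
     (pd i (\<lambda>v. G v $ j $ l) u + pd j (\<lambda>v. G v $ i $ l) u - pd l (\<lambda>v. G v $ i $ j) u))"

definition ricci :: "(real^2 \<Rightarrow> real^2^2) \<Rightarrow> 2 \<Rightarrow> 2 \<Rightarrow> real^2 \<Rightarrow> real" where
  "ricci G i j u = (\<Sum>k\<in>UNIV. pd k (christoffel G k i j) u - pd j (christoffel G k i k) u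
     + (\<Sum>l\<in>UNIV. christoffel G k k l u * christoffel G l i j u
                   - christoffel G k j l u * christoffel G l i k u))"

definition scalar_curvature :: "(real^2 \<Rightarrow> real^2^2) \<Rightarrow> real^2 \<Rightarrow> real" where
  "scalar_curvature G u = (1/2) * (\<Sum>i\<in>UNIV. \<Sum>j\<in>UNIV. matrix_inv (G u) $ i $ j * ricci G i j u)"


section \<open>Relative invariants\<close>

text \<open>\<open>cov2 G x j k\<close> and \<open>cov3 G x j k l\<close> are the components of the iterated covariant
  derivatives of the covector \<open>(pd j x)\<^sub>j\<close> (with values in space), first in direction
  \<open>k\<close>, then in direction \<open>l\<close>.\<close>

definition cov2 :: "(real^2 \<Rightarrow> real^2^2) \<Rightarrow> (real^2 \<Rightarrow> real^3) \<Rightarrow> 2 \<Rightarrow> 2 \<Rightarrow> real^2 \<Rightarrow> real^3" where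
  "cov2 G x j k u = pd k (pd j x) u - (\<Sum>m\<in>UNIV. christoffel G m k j u *\<^sub>R pd m x u)"

definition cov3 ::
  "(real^2 \<Rightarrow> real^2^2) \<Rightarrow> (real^2 \<Rightarrow> real^3) \<Rightarrow> 2 \<Rightarrow> 2 \<Rightarrow> 2 \<Rightarrow> real^2 \<Rightarrow> real^3" where
  "cov3 G x j k l u = pd l (cov2 G x j k) u
     - (\<Sum>m\<in>UNIV. christoffel G m l j u *\<^sub>R cov2 G x m k u)
     - (\<Sum>m\<in>UNIV. christoffel G m l k u *\<^sub>R cov2 G x j m u)"

definition darboux ::
  "(real^2 \<Rightarrow> real^3) \<Rightarrow> (real^2 \<Rightarrow> real^3) \<Rightarrow> 2 \<Rightarrow> 2 \<Rightarrow> 2 \<Rightarrow> real^2 \<Rightarrow> real" where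
  "darboux x y j k l u = conormal x y u \<bullet> cov3 (rel_metric x y) x j k l u"

definition tchebychev_coeff ::
  "(real^2 \<Rightarrow> real^3) \<Rightarrow> (real^2 \<Rightarrow> real^3) \<Rightarrow> real^2 \<Rightarrow> real^2" where
  "tchebychev_coeff x y u = (let g = matrix_inv (rel_metric x y u) in
     (\<chi> m. (1/2) * (\<Sum>i\<in>UNIV. \<Sum>j\<in>UNIV. \<Sum>k\<in>UNIV. g $ i $ j * g $ m $ k * darboux x y i j k u)))"

definition tchebychev_vector ::
  "(real^2 \<Rightarrow> real^3) \<Rightarrow> (real^2 \<Rightarrow> real^3) \<Rightarrow> real^2 \<Rightarrow> real^3" where
  "tchebychev_vector x y u = (\<Sum>m\<in>UNIV. tchebychev_coeff x y u $ m *\<^sub>R pd m x u)"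

text \<open>No square root is taken; for an indefinite relative metric this may be negative.\<close>

definition tchebychev_norm ::
  "(real^2 \<Rightarrow> real^3) \<Rightarrow> (real^2 \<Rightarrow> real^3) \<Rightarrow> real^2 \<Rightarrow> real" where
  "tchebychev_norm x y u = (\<Sum>i\<in>UNIV. \<Sum>j\<in>UNIV.
     rel_metric x y u $ i $ j * tchebychev_coeff x y u $ i * tchebychev_coeff x y u $ j)"

definition pick_invariant ::
  "(real^2 \<Rightarrow> real^3) \<Rightarrow> (real^2 \<Rightarrow> real^3) \<Rightarrow> real^2 \<Rightarrow> real" where
  "pick_invariant x y u = (let g = matrix_inv (rel_metric x y u) in
     (1/2) * (\<Sum>j\<in>UNIV. \<Sum>k\<in>UNIV. \<Sum>l\<in>UNIV. \<Sum>a\<in>UNIV. \<Sum>b\<in>UNIV. \<Sum>c\<in>UNIV.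
        darboux x y j k l u * (g $ j $ a * g $ k $ b * g $ l $ c * darboux x y a b c u)))"

text \<open>The entry \<open>B $ i $ j\<close> has lower index \<open>i\<close> and upper index \<open>j\<close>.\<close>

definition rel_shape_operator ::
  "(real^2 \<Rightarrow> real^3) \<Rightarrow> (real^2 \<Rightarrow> real^3) \<Rightarrow> real^2 \<Rightarrow> real^2^2" where
  "rel_shape_operator x y u =
     (THE B. \<forall>i. pd i y u = - (\<Sum>j\<in>UNIV. B $ i $ j *\<^sub>R pd j x u))"

definition mean_curvature ::
  "(real^2 \<Rightarrow> real^3) \<Rightarrow> (real^2 \<Rightarrow> real^3) \<Rightarrow> real^2 \<Rightarrow> real" where
  "mean_curvature x y u = (1/2) * trace (rel_shape_operator x y u)"

definition rel_scalar_curvature ::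
  "(real^2 \<Rightarrow> real^3) \<Rightarrow> (real^2 \<Rightarrow> real^3) \<Rightarrow> real^2 \<Rightarrow> real" where
  "rel_scalar_curvature x y u = scalar_curvature (rel_metric x y) u"


section \<open>The three properties, required at every point and in every chart of the atlas\<close>

definition property_a :: "'m chart set \<Rightarrow> ('m \<Rightarrow> real^3) \<Rightarrow> ('m \<Rightarrow> real^3) \<Rightarrow> bool" where
  "property_a \<A> x y \<longleftrightarrow> (\<forall>c\<in>\<A>. \<forall>u\<in>chart_image c.
     let X = in_chart c x; Y = in_chart c y in
       3 * (rel_scalar_curvature X Y u - mean_curvature X Y u) + pick_invariant X Y u = 0)"

definition property_b :: "'m chart set \<Rightarrow> ('m \<Rightarrow> real^3) \<Rightarrow> ('m \<Rightarrow> real^3) \<Rightarrow> bool" where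
  "property_b \<A> x y \<longleftrightarrow> (\<forall>c\<in>\<A>. \<forall>u\<in>chart_image c.
     let X = in_chart c x; Y = in_chart c y in
       3 * tchebychev_norm X Y u = 2 * pick_invariant X Y u)"

definition property_c :: "'m chart set \<Rightarrow> ('m \<Rightarrow> real^3) \<Rightarrow> ('m \<Rightarrow> real^3) \<Rightarrow> bool" where
  "property_c \<A> x y \<longleftrightarrow> (\<forall>c\<in>\<A>. \<forall>u\<in>chart_image c.
     let X = in_chart c x; Y = in_chart c y in
       tchebychev_norm X Y u = 2 * (mean_curvature X Y u - rel_scalar_curvature X Y u))"

end

theory Submission
  imports Defs
begin

text \<open>
  For a surface in space, \<open>3 \<parallel>T\<parallel> - 2 J\<close> is up to a nonzero factor the product of the values of the
  Darboux form on two null vectors of the relative metric, so (b) says that the form vanishes on one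
  of the two null lines; (a) and (c) are the same condition because of \<open>S - H = J - 2 \<parallel>T\<parallel>\<close>. For a
  graph of \<open>f\<close> it means that \<open>D\<^sup>2f\<close> and \<open>D\<^sup>3f\<close> vanish on a common nonzero vector \<open>v\<close>, which is
  independent of the normalization and holds along every straight segment in the surface. Hence on a
  ruled surface every normalization works, in particular the Euclidean one.

  Conversely, let \<open>A\<close> and \<open>B\<close> be the values of \<open>D\<^sup>3f\<close> on the two fields of asymptotic directions,
  so that \<open>A B = 0\<close>. Lines of the second family are straight where \<open>B = 0\<close>, and likewise for \<open>A\<close>;
  the difficulty lies in the points near which neither \<open>A\<close> nor \<open>B\<close> vanishes identically. Along a ruling in
  the interior of \<open>{B = 0}\<close>, \<open>A\<close> times the fourth power of a linear function is a quadratic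
  polynomial. Where the ruling leaves this set, \<open>A\<close> and its gradient vanish, so that the polynomial
  has a double zero. A ruling through a point with \<open>A \<noteq> 0\<close> is therefore straight up to the boundary
  of the domain on at least one side, and rulings through such points accumulate at a segment of
  fixed length through the given point.
\<close>

unbundle cross3_syntax

text \<open>The linear function is the rate at which neighbouring rulings spread; every derivative
  across the rulings costs a division by it. That \<open>f\<close> is affine on each ruling is an
  identity which, differentiated three times across the rulings, yields the third derivatives, up to
  such divisions, as polynomials of degree two in the parameter. Class C^4 makes \<open>A\<close>
  continuously differentiable, so that its gradient vanishes at limits of points with
  \<open>B\<close> nonzero, near each of which \<open>A\<close> is zero on an open set. No more
  smoothness is available: some coefficients of the polynomials are merely continuous.

  The alternative "straight on one side or on the other" survives the passage to the limit because
  its failure is an open condition.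

  The relation between \<open>S\<close>, \<open>H\<close>, \<open>J\<close> and \<open>T\<close> is
  the trace of a Gauss equation: the connection induced by \<open>y\<close> is the Levi-Civita
  connection plus the Darboux tensor with one index raised; in the trace the terms linear in that
  tensor cancel and the quadratic ones remain. Since \<open>y\<close> may be only C^1, second
  derivatives of \<open>y\<close> are avoided and the conormal, which is C^2, is used
  instead.\<close>

lemma pd_eq: "(f has_derivative f') (at u) \<Longrightarrow> pd i f u = f' (axis i 1)"
  unfolding pd_def by (metis frechet_derivative_at)

lemma pd_cong:
  assumes "open S" "u \<in> S" "\<And>v. v \<in> S \<Longrightarrow> f v = g v"
  shows "pd i f u = pd i g u"
proof -
  have "(f has_derivative f') (at u) \<longleftrightarrow> (g has_derivative f') (at u)" for f'
    using has_derivative_transform_within_open[OF _ assms(1,2), of f f' UNIV g]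
      has_derivative_transform_within_open[OF _ assms(1,2), of g f' UNIV f] assms(3) by auto
  then show ?thesis
    by (simp add: pd_def frechet_derivative_def)
qed

lemma has_derivative_pd:
  fixes f :: "real^2 \<Rightarrow> 'b::real_normed_vector"
  assumes "f differentiable (at u)"
  shows "(f has_derivative (\<lambda>w. w $ 1 *\<^sub>R pd 1 f u + w $ 2 *\<^sub>R pd 2 f u)) (at u)"
proof -
  let ?D = "frechet_derivative f (at u)"
  have "linear ?D"
    by (rule linear_frechet_derivative[OF assms])
  then have "?D (a *\<^sub>R axis 1 1 + b *\<^sub>R axis 2 1) = a *\<^sub>R pd 1 f u + b *\<^sub>R pd 2 f u" for a b
    by (simp add: pd_def linear_add linear_cmul)
  moreover have "w $ 1 *\<^sub>R axis 1 1 + w $ 2 *\<^sub>R axis 2 1 = w" for w :: "real^2"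
    by (simp add: vec_eq_iff forall_2 axis_def)
  ultimately have "?D w = w $ 1 *\<^sub>R pd 1 f u + w $ 2 *\<^sub>R pd 2 f u" for w
    by metis
  then have "?D = (\<lambda>w. w $ 1 *\<^sub>R pd 1 f u + w $ 2 *\<^sub>R pd 2 f u)"
    by (rule ext)
  then show ?thesis
    using frechet_derivative_works[THEN iffD1, OF assms] by argo
qed

lemma pd_const [simp]: "pd i (\<lambda>v. c) u = 0"
  by (simp add: pd_def)

lemma pd_add:
  assumes "f differentiable (at u)" "g differentiable (at u)"
  shows "pd i (\<lambda>v. f v + g v) u = pd i f u + pd i g u"
  by (rule pd_eq[OF has_derivative_add[OF frechet_derivative_works[THEN iffD1, OF assms(1)]
      frechet_derivative_works[THEN iffD1, OF assms(2)]], folded pd_def])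

lemma pd_bounded_linear:
  assumes "bounded_linear T" "f differentiable (at u)"
  shows "pd i (\<lambda>v. T (f v)) u = T (pd i f u)"
  by (rule pd_eq[OF bounded_linear.has_derivative[OF assms(1)
      frechet_derivative_works[THEN iffD1, OF assms(2)]], folded pd_def])

lemma pd_bilinear:
  assumes "bounded_bilinear p" "f differentiable (at u)" "g differentiable (at u)"
  shows "pd i (\<lambda>v. p (f v) (g v)) u = p (f u) (pd i g u) + p (pd i f u) (g u)"
  by (rule pd_eq[OF bounded_bilinear.FDERIV[OF assms(1) frechet_derivative_works[THEN iffD1, OF assms(2)]
      frechet_derivative_works[THEN iffD1, OF assms(3)]], folded pd_def])

lemma differentiable_bilinear:
  assumes "bounded_bilinear p" "f differentiable F" "g differentiable F" "F = at u"
  shows "(\<lambda>v. p (f v) (g v)) differentiable F"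
  using assms bounded_bilinear.FDERIV[OF assms(1)] unfolding differentiable_def by blast

lemma bounded_linear_differentiable:
  "bounded_linear T \<Longrightarrow> f differentiable F \<Longrightarrow> (\<lambda>v. T (f v)) differentiable F"
  unfolding differentiable_def by (blast intro: bounded_linear.has_derivative)

section \<open>Maps of class \<open>C\<^sup>k\<close>\<close>

lemma Ck_on_cong:
  assumes "open S" "\<And>v. v \<in> S \<Longrightarrow> f v = g v" "Ck_on k f S"
  shows "Ck_on k g S"
  using assms(2,3)
proof (induction k arbitrary: f g)
  case 0
  then show ?case by (simp cong: continuous_on_cong)
next
  case (Suc k)
  have "g differentiable (at u)" if "u \<in> S" for u
    using Suc.prems that has_derivative_transform_within_open[OF _ assms(1) that]
    unfolding differentiable_def Ck_on.simps by blast
  moreover have "Ck_on k (pd i g) S" for i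
    using Suc.IH[of "pd i f" "pd i g"] Suc.prems pd_cong[OF assms(1)] by (metis Ck_on.simps(2))
  ultimately show ?case by simp
qed

lemma Ck_on_subset: "Ck_on k f S \<Longrightarrow> T \<subseteq> S \<Longrightarrow> Ck_on k f T"
  by (induction k arbitrary: f) (auto intro: continuous_on_subset)

lemma Ck_on_SucD: "Ck_on (Suc k) f S \<Longrightarrow> Ck_on k f S"
proof (induction k arbitrary: f)
  case 0
  then show ?case
    by (auto intro!: continuous_at_imp_continuous_on differentiable_imp_continuous_within)
next
  case (Suc k)
  then show ?case by (metis Ck_on.simps(2))
qed

lemma Ck_on_le: "Ck_on l f S \<Longrightarrow> k \<le> l \<Longrightarrow> Ck_on k f S"
  by (induction l) (auto simp: le_Suc_eq dest: Ck_on_SucD simp del: Ck_on.simps(2))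

lemma Ck_on_continuous: "Ck_on k f S \<Longrightarrow> continuous_on S f"
  using Ck_on_le[of k f S 0] by simp

lemma Ck_on_differentiable: "Ck_on k f S \<Longrightarrow> 0 < k \<Longrightarrow> u \<in> S \<Longrightarrow> f differentiable (at u)"
  by (cases k) auto

lemma Ck_on_pd: "Ck_on l f S \<Longrightarrow> Suc k \<le> l \<Longrightarrow> Ck_on k (pd i f) S"
  using Ck_on_le[of l f S "Suc k"] by simp

lemma Ck_on_const: "Ck_on k (\<lambda>v. c) S"
proof (induction k arbitrary: c)
  case (Suc k)
  have "pd i (\<lambda>v::real^2. c) = (\<lambda>v. 0)" for i
    by (rule ext) simp
  with Suc show ?case by simp
qed simp

lemma Ck_on_add:
  assumes "open S"
  shows "Ck_on k f S \<Longrightarrow> Ck_on k g S \<Longrightarrow> Ck_on k (\<lambda>v. f v + g v) S"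
proof (induction k arbitrary: f g)
  case 0
  then show ?case by (auto intro: continuous_intros)
next
  case (Suc k)
  have "Ck_on k (pd i (\<lambda>v. f v + g v)) S" for i
    by (rule Ck_on_cong[OF assms _ Suc.IH[of "pd i f" "pd i g"]]) (use Suc.prems in \<open>auto simp: pd_add\<close>)
  then show ?case using Suc.prems by (auto intro: derivative_intros)
qed

lemma Ck_on_bounded_linear:
  assumes "open S" "bounded_linear T"
  shows "Ck_on k f S \<Longrightarrow> Ck_on k (\<lambda>v. T (f v)) S"
proof (induction k arbitrary: f)
  case 0
  then show ?case by (auto intro: bounded_linear.continuous_on[OF assms(2)])
next
  case (Suc k)
  have "Ck_on k (pd i (\<lambda>v. T (f v))) S" for i
    by (rule Ck_on_cong[OF assms(1) _ Suc.IH[of "pd i f"]])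
       (use Suc.prems assms(2) in \<open>auto simp: pd_bounded_linear\<close>)
  then show ?case using Suc.prems assms(2) by (auto intro: bounded_linear_differentiable)
qed

lemma Ck_on_bilinear:
  assumes "open S" "bounded_bilinear p"
  shows "Ck_on k f S \<Longrightarrow> Ck_on k g S \<Longrightarrow> Ck_on k (\<lambda>v. p (f v) (g v)) S"
proof (induction k arbitrary: f g)
  case 0
  then show ?case by (auto intro: bounded_bilinear.continuous_on[OF assms(2)])
next
  case (Suc k)
  have "Ck_on k (pd i (\<lambda>v. p (f v) (g v))) S" for i
  proof (rule Ck_on_cong[OF assms(1)])
    show "Ck_on k (\<lambda>v. p (f v) (pd i g v) + p (pd i f v) (g v)) S"
      using Suc.prems Ck_on_SucD[OF Suc.prems(1)] Ck_on_SucD[OF Suc.prems(2)]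
      by (intro Ck_on_add[OF assms(1)] Suc.IH) auto
  qed (use Suc.prems assms(2) in \<open>auto simp: pd_bilinear\<close>)
  then show ?case using Suc.prems assms(2) by (auto intro: differentiable_bilinear)
qed

lemmas Ck_on_mult = Ck_on_bilinear[OF _ bounded_bilinear_mult]
lemmas Ck_on_scaleR = Ck_on_bilinear[OF _ bounded_bilinear_scaleR]
lemmas Ck_on_inner = Ck_on_bilinear[OF _ bounded_bilinear_inner]

lemma bounded_bilinear_cross3: "bounded_bilinear (\<times>)"
  using bilinear_conv_bounded_bilinear bilinear_cross by blast

lemmas Ck_on_cross3 = Ck_on_bilinear[OF _ bounded_bilinear_cross3]

lemma Ck_on_minus: "open S \<Longrightarrow> Ck_on k f S \<Longrightarrow> Ck_on k (\<lambda>v. - f v) S"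
  by (rule Ck_on_bounded_linear[OF _ bounded_linear_minus[OF bounded_linear_ident]])

lemma Ck_on_diff: "open S \<Longrightarrow> Ck_on k f S \<Longrightarrow> Ck_on k g S \<Longrightarrow> Ck_on k (\<lambda>v. f v - g v) S"
  using Ck_on_add[of S k f "\<lambda>v. - g v"] Ck_on_minus[of S k g] by simp

lemma Ck_on_nth: "open S \<Longrightarrow> Ck_on k f S \<Longrightarrow> Ck_on k (\<lambda>v. f v $ i) S"
  by (rule Ck_on_bounded_linear[OF _ bounded_linear_vec_nth])

lemma pd_inverse:
  fixes f :: "real^2 \<Rightarrow> real"
  assumes "f differentiable (at u)" "f u \<noteq> 0"
  shows "pd i (\<lambda>v. inverse (f v)) u = - (inverse (f u) * inverse (f u) * pd i f u)"
  by (rule pd_eq[OF Deriv.has_derivative_inverse[OF assms(2)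
      frechet_derivative_works[THEN iffD1, OF assms(1)]], folded pd_def, THEN trans]) simp

text \<open>The derivative of \<open>1 / f\<close> contains \<open>1 / f\<close> itself and one
  derivative of \<open>f\<close>, so the induction hypothesis for the lower order covers it.\<close>

lemma Ck_on_inverse:
  fixes f :: "real^2 \<Rightarrow> real"
  assumes "open S" "\<And>v. v \<in> S \<Longrightarrow> f v \<noteq> 0"
  shows "Ck_on k f S \<Longrightarrow> Ck_on k (\<lambda>v. inverse (f v)) S"
proof (induction k)
  case 0
  then show ?case using assms(2) by (auto intro: continuous_intros)
next
  case (Suc k)
  have f: "Ck_on k f S" and f': "Ck_on k (pd i f) S" for i
    using Suc.prems Ck_on_SucD by auto
  have "Ck_on k (pd i (\<lambda>v. inverse (f v))) S" for i
  proof (rule Ck_on_cong[OF assms(1)])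
    show "Ck_on k (\<lambda>v. - (inverse (f v) * inverse (f v) * pd i f v)) S"
      by (intro Ck_on_minus Ck_on_mult assms(1) Suc.IH f f')
  qed (use Suc.prems assms(2) in \<open>simp add: pd_inverse\<close>)
  then show ?case
    using Suc.prems assms(2) by (auto intro!: derivative_intros)
qed

lemma Ck_on_divide:
  fixes f g :: "real^2 \<Rightarrow> real"
  assumes "open S" "\<And>v. v \<in> S \<Longrightarrow> g v \<noteq> 0" "Ck_on k f S" "Ck_on k g S"
  shows "Ck_on k (\<lambda>v. f v / g v) S"
  unfolding divide_inverse by (intro Ck_on_mult Ck_on_inverse assms)

lemma Ck_on_sqrt:
  fixes f :: "real^2 \<Rightarrow> real"
  assumes "open S" "\<And>v. v \<in> S \<Longrightarrow> 0 < f v"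
  shows "Ck_on k f S \<Longrightarrow> Ck_on k (\<lambda>v. sqrt (f v)) S"
proof (induction k)
  case 0
  then show ?case by (auto intro: continuous_intros)
next
  case (Suc k)
  have f: "Ck_on k f S" and f': "Ck_on k (pd i f) S" for i
    using Suc.prems Ck_on_SucD by auto
  have D: "((\<lambda>v. sqrt (f v)) has_derivative
      (\<lambda>h. frechet_derivative f (at u) h * (inverse (sqrt (f u)) / 2))) (at u)" if "u \<in> S" for u
    by (rule has_derivative_real_sqrt) (use Suc.prems that assms(2) frechet_derivative_works in auto)
  have "Ck_on k (pd i (\<lambda>v. sqrt (f v))) S" for i
  proof (rule Ck_on_cong[OF assms(1)])
    have "sqrt (f v) \<noteq> 0" if "v \<in> S" for v using assms(2)[OF that] by simp
    then show "Ck_on k (\<lambda>v. pd i f v * inverse (2 * sqrt (f v))) S"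
      by (intro Ck_on_mult Ck_on_inverse Ck_on_const Suc.IH f f' assms(1)) simp
    show "pd i f v * inverse (2 * sqrt (f v)) = pd i (\<lambda>v. sqrt (f v)) v" if "v \<in> S" for v
      using pd_eq[OF D[OF that], of i] by (simp add: pd_def)
  qed
  then show ?case
    using Suc.prems D by (auto simp: differentiable_def)
qed

lemmas Ck_on_intros = Ck_on_const Ck_on_add Ck_on_diff Ck_on_minus Ck_on_mult Ck_on_scaleR
  Ck_on_inner Ck_on_cross3 Ck_on_nth Ck_on_inverse Ck_on_divide Ck_on_sqrt

section \<open>Derivatives along curves and the symmetry of second derivatives\<close>

lemma has_vector_derivative_along_curve:
  fixes f :: "real^2 \<Rightarrow> 'b::real_normed_vector"
  assumes "f differentiable (at (c t))" "(c has_vector_derivative c') (at t)"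
  shows "((\<lambda>t. f (c t)) has_vector_derivative (c' $ 1 *\<^sub>R pd 1 f (c t) + c' $ 2 *\<^sub>R pd 2 f (c t))) (at t)"
  using has_derivative_compose[OF assms(2)[unfolded has_vector_derivative_def] has_derivative_pd[OF assms(1)]]
  by (simp add: has_vector_derivative_def scaleR_add_right)

lemma has_real_derivative_along_curve:
  fixes f :: "real^2 \<Rightarrow> real"
  assumes "f differentiable (at (vector [a t, b t]))"
    and "(a has_real_derivative a') (at t)" "(b has_real_derivative b') (at t)"
  shows "((\<lambda>t. f (vector [a t, b t])) has_real_derivative
     (a' * pd 1 f (vector [a t, b t]) + b' * pd 2 f (vector [a t, b t]))) (at t)"
proof -
  have v: "vector [p, q] = p *\<^sub>R axis 1 1 + q *\<^sub>R (axis 2 1 :: real^2)" for p q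
    by (simp add: vec_eq_iff forall_2 axis_def)
  have "((\<lambda>t. vector [a t, b t] :: real^2) has_vector_derivative vector [a', b']) (at t)"
    unfolding v using assms(2,3)
    by (auto intro!: derivative_eq_intros simp: has_real_derivative_iff_has_vector_derivative)
  from has_vector_derivative_along_curve[OF assms(1) this] show ?thesis
    by (simp add: has_real_derivative_iff_has_vector_derivative)
qed

text \<open>Schwarz's argument: a second difference over a small square does not depend on the order
  of the two axes, and the mean value theorem turns it into either mixed derivative near
  \<open>u\<close>. Continuity of both at \<open>u\<close> then excludes a difference.\<close>

lemma pd_commute_real:
  fixes f :: "real^2 \<Rightarrow> real"
  assumes "open S" "Ck_on 2 f S" "u \<in> S"
  shows "pd i (pd j f) u = pd j (pd i f) u"
proof -
  have step: "\<exists>v\<in>ball u e. \<exists>w \<in> ball u e. pd b (pd a f) v = pd a (pd b f) w"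
    if e: "e > 0" "ball u e \<subseteq> S" for e a b
  proof -
    \<comment> \<open>Points of the square are at most \<open>2 * h\<close> away from
      \<open>u\<close>.\<close>
    define h where "h = e / 3"
    have h: "h > 0" using e by (simp add: h_def)
    let ?p = "\<lambda>a b s t. u + s *\<^sub>R axis a 1 + t *\<^sub>R (axis b 1 :: real^2)"
    have inb: "?p a b s t \<in> ball u e" if "0 \<le> s" "s \<le> h" "0 \<le> t" "t \<le> h" for s t a b
    proof -
      have "dist u (?p a b s t) = norm (s *\<^sub>R axis a 1 + t *\<^sub>R (axis b 1 :: real^2))"
        by (simp add: dist_norm algebra_simps norm_minus_commute)
      also have "\<dots> \<le> s + t"
        by (rule norm_triangle_le) (use that in simp)
      also have "\<dots> < e" using that h by (simp add: h_def)
      finally show ?thesis by simp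
    qed
    have d1: "((\<lambda>s. f (?p a b s t)) has_real_derivative pd a f (?p a b s t)) (at s)"
      if "0 \<le> s" "s \<le> h" "0 \<le> t" "t \<le> h" for s t a b
    proof -
      have "f differentiable (at (?p a b s t))"
        using Ck_on_differentiable[OF assms(2) _ subsetD[OF e(2) inb[OF that]]] by simp
      then have "((\<lambda>s. f (?p a b s t)) has_vector_derivative
        ((axis a 1 :: real^2) $ 1 *\<^sub>R pd 1 f (?p a b s t) + (axis a 1 :: real^2) $ 2 *\<^sub>R pd 2 f (?p a b s t))) (at s)"
        by (rule has_vector_derivative_along_curve) (auto intro!: derivative_eq_intros)
      then show ?thesis
        using exhaust_2[of a] by (auto simp: has_real_derivative_iff_has_vector_derivative axis_def)
    qed
    have d2: "((\<lambda>t. pd a f (?p a b s t)) has_real_derivative pd b (pd a f) (?p a b s t)) (at t)"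
      if "0 \<le> s" "s \<le> h" "0 \<le> t" "t \<le> h" for s t a b
    proof -
      have "pd a f differentiable (at (?p a b s t))"
        using Ck_on_differentiable[OF Ck_on_pd[OF assms(2), of 1] _ subsetD[OF e(2) inb[OF that]]] by simp
      then have "((\<lambda>t. pd a f (?p a b s t)) has_vector_derivative
        ((axis b 1 :: real^2) $ 1 *\<^sub>R pd 1 (pd a f) (?p a b s t) + (axis b 1 :: real^2) $ 2 *\<^sub>R pd 2 (pd a f) (?p a b s t))) (at t)"
        by (rule has_vector_derivative_along_curve) (auto intro!: derivative_eq_intros)
      then show ?thesis
        using exhaust_2[of b] by (auto simp: has_real_derivative_iff_has_vector_derivative axis_def)
    qed
    have main: "\<exists>v\<in>ball u e. f (?p a b h h) - f (?p a b h 0) - (f (?p a b 0 h) - f (?p a b 0 0)) = h * (h * pd b (pd a f) v)"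
      for a b
    proof -
      have "\<exists>s. 0 < s \<and> s < h \<and> (f (?p a b h h) - f (?p a b h 0)) - (f (?p a b 0 h) - f (?p a b 0 0))
          = (h - 0) * (pd a f (?p a b s h) - pd a f (?p a b s 0))"
        by (rule MVT2[of 0 h "\<lambda>s. f (?p a b s h) - f (?p a b s 0)"]) (rule h, (rule DERIV_diff; rule d1; use h in simp))
      then obtain s where s: "0 < s" "s < h" "(f (?p a b h h) - f (?p a b h 0)) - (f (?p a b 0 h) - f (?p a b 0 0))
          = h * (pd a f (?p a b s h) - pd a f (?p a b s 0))" by auto
      have "\<exists>t. 0 < t \<and> t < h \<and> pd a f (?p a b s h) - pd a f (?p a b s 0) = (h - 0) * pd b (pd a f) (?p a b s t)"
        by (rule MVT2[of 0 h "\<lambda>t. pd a f (?p a b s t)"]) (rule h, (rule d2; use h s in simp))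
      then show ?thesis using s inb by (metis diff_zero less_imp_le)
    qed
    have sw: "?p a b s t = ?p b a t s" for s t by (simp add: algebra_simps)
    obtain v w where "v \<in> ball u e" "w \<in> ball u e"
        "f (?p a b h h) - f (?p a b h 0) - (f (?p a b 0 h) - f (?p a b 0 0)) = h * (h * pd b (pd a f) v)"
        "f (?p b a h h) - f (?p b a h 0) - (f (?p b a 0 h) - f (?p b a 0 0)) = h * (h * pd a (pd b f) w)"
      using main by meson
    moreover from this have "h * (h * pd b (pd a f) v) = h * (h * pd a (pd b f) w)"
      unfolding sw[of h h] sw[of h 0] sw[of 0 h] sw[of 0 0] by linarith
    ultimately show ?thesis using h by (intro bexI[of _ v] bexI[of _ w]) auto
  qed
  have cont: "isCont (pd a (pd b f)) u" for a b
    using Ck_on_continuous[OF Ck_on_pd[OF Ck_on_pd[OF assms(2), of 1], of 0]] assms(1,3)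
    by (simp add: continuous_on_eq_continuous_at)
  show ?thesis
  proof (rule ccontr)
    assume ne: "pd i (pd j f) u \<noteq> pd j (pd i f) u"
    define d where "d = dist (pd i (pd j f) u) (pd j (pd i f) u) / 2"
    have d: "d > 0" using ne by (simp add: d_def)
    obtain e1 where e1: "e1 > 0" "\<And>v. dist v u < e1 \<Longrightarrow> dist (pd i (pd j f) v) (pd i (pd j f) u) < d"
      using cont[of i j] d unfolding continuous_at_eps_delta by meson
    obtain e2 where e2: "e2 > 0" "\<And>v. dist v u < e2 \<Longrightarrow> dist (pd j (pd i f) v) (pd j (pd i f) u) < d"
      using cont[of j i] d unfolding continuous_at_eps_delta by meson
    obtain e3 where e3: "e3 > 0" "ball u e3 \<subseteq> S"
      using assms(1,3) open_contains_ball by meson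
    define e where "e = min e1 (min e2 e3)"
    have "e > 0" "ball u e \<subseteq> S" using e1 e2 e3 by (auto simp: e_def)
    from step[OF this, of i j] obtain v w where vw: "v \<in> ball u e" "w \<in> ball u e" "pd i (pd j f) v = pd j (pd i f) w"
      by metis
    have "dist v u < e1" "dist w u < e2"
      using vw by (auto simp: e_def dist_commute)
    then have "dist (pd i (pd j f) v) (pd i (pd j f) u) < d" "dist (pd j (pd i f) w) (pd j (pd i f) u) < d"
      using e1(2) e2(2) by blast+
    then show False
      using vw(3) unfolding d_def dist_real_def by (auto simp: abs_if field_simps split: if_splits)
  qed
qed

lemma pd_commute:
  fixes f :: "real^2 \<Rightarrow> 'b::euclidean_space"
  assumes "open S" "Ck_on 2 f S" "u \<in> S"
  shows "pd i (pd j f) u = pd j (pd i f) u"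
proof (rule euclidean_eqI)
  fix b :: 'b assume "b \<in> Basis"
  have bl: "bounded_linear (\<lambda>v. v \<bullet> b)" by (rule bounded_linear_inner_left)
  have eq: "pd k (pd l (\<lambda>v. f v \<bullet> b)) u = pd k (pd l f) u \<bullet> b" for k l
  proof -
    have "pd k (pd l (\<lambda>v. f v \<bullet> b)) u = pd k (\<lambda>v. pd l f v \<bullet> b) u"
      by (rule pd_cong[OF assms(1,3)])
         (use assms(2) in \<open>auto intro!: pd_bounded_linear[OF bl] elim: Ck_on_differentiable\<close>)
    also have "\<dots> = pd k (pd l f) u \<bullet> b"
      using Ck_on_differentiable[OF Ck_on_pd[OF assms(2), of 1]] assms(3)
      by (intro pd_bounded_linear[OF bl]) auto
    finally show ?thesis .
  qed
  show "pd i (pd j f) u \<bullet> b = pd j (pd i f) u \<bullet> b"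
    using pd_commute_real[OF assms(1) Ck_on_bounded_linear[OF assms(1) bl assms(2)] assms(3), of i j]
    by (simp add: eq)
qed

declare Ck_on.simps [simp del]

section \<open>Asymptotic lines of a graph\<close>

text \<open>Here and in \<open>cub\<close>, mixed derivatives occur in one fixed order only;
  \<open>third_pd_commute\<close> rewrites the others to it.\<close>

definition hess :: "(real^2 \<Rightarrow> real) \<Rightarrow> real^2 \<Rightarrow> real^2 \<Rightarrow> real" where
  "hess f u w = (w$1)\<^sup>2 * pd 1 (pd 1 f) u + 2 * w$1 * w$2 * pd 2 (pd 1 f) u + (w$2)\<^sup>2 * pd 2 (pd 2 f) u"

definition cub :: "(real^2 \<Rightarrow> real) \<Rightarrow> real^2 \<Rightarrow> real^2 \<Rightarrow> real" where
  "cub f u w = (w$1)^3 * pd 1 (pd 1 (pd 1 f)) u + 3 * (w$1)\<^sup>2 * w$2 * pd 2 (pd 1 (pd 1 f)) u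
     + 3 * w$1 * (w$2)\<^sup>2 * pd 2 (pd 2 (pd 1 f)) u + (w$2)^3 * pd 2 (pd 2 (pd 2 f)) u"

lemma hess_scaleR: "hess f u (a *\<^sub>R w) = a\<^sup>2 * hess f u w"
  by (simp add: hess_def algebra_simps power2_eq_square)

lemma cub_scaleR: "cub f u (a *\<^sub>R w) = a^3 * cub f u w"
  by (simp add: cub_def algebra_simps power2_eq_square power3_eq_cube)

lemmas pd_mult = pd_bilinear[OF bounded_bilinear_mult]

lemma sum_axis_pd:
  assumes "i \<noteq> j"
  shows "(axis i 1 + c *\<^sub>R axis j 1 :: real^2) $ 1 *\<^sub>R pd 1 f u + (axis i 1 + c *\<^sub>R axis j 1 :: real^2) $ 2 *\<^sub>R pd 2 f u
    = pd i f u + c *\<^sub>R pd j f u"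
  using exhaust_2[of i] exhaust_2[of j] assms by (auto simp: axis_def)

text \<open>On the line the slope satisfies a linear homogeneous equation for its deviation from the
  initial value.\<close>

lemma slope_constant:
  fixes m :: "real^2 \<Rightarrow> real" and i j :: 2
  defines "L \<equiv> \<lambda>p t. p + t *\<^sub>R (axis i 1 + m p *\<^sub>R axis j 1)"
  assumes ij: "i \<noteq> j" and m: "Ck_on 1 m S" and ab: "0 \<in> {a..b}"
    and L: "\<And>t. t \<in> {a..b} \<Longrightarrow> L p t \<in> S \<and> pd i m (L p t) + m (L p t) * pd j m (L p t) = 0"
    and t: "t \<in> {a..b}"
  shows "m (L p t) = m p"
proof -
  define g where "g t = pd j m (L p t)" for t
  have dL: "(L p has_vector_derivative (axis i 1 + m p *\<^sub>R axis j 1)) (at t)" for t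
    unfolding L_def by (auto intro!: derivative_eq_intros)
  have contL: "continuous_on A (L p)" for A
    unfolding L_def by (intro continuous_intros)
  have cg: "continuous_on {a..b} g"
    unfolding g_def
    by (rule continuous_on_compose2[OF Ck_on_continuous[OF Ck_on_pd[OF m]] contL]) (use L in auto)
  obtain G where G: "\<And>t. t \<in> {a..b} \<Longrightarrow> (G has_vector_derivative g t) (at t within {a..b})"
    using antiderivative_continuous[OF cg] by blast
  define \<phi> where "\<phi> t = m (L p t) - m p" for t
  \<comment> \<open>The line keeps the initial slope \<open>m p\<close>, while the hypothesis
    contains the current slope; the discrepancy is \<open>g t\<close> times
    \<open>\<phi> t\<close>.\<close>
  have d\<phi>: "(\<phi> has_real_derivative - (g t * \<phi> t)) (at t within {a..b})" if "t \<in> {a..b}" for t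
  proof -
    have "m differentiable (at (L p t))"
      using Ck_on_differentiable[OF m] L[OF that] by simp
    from has_vector_derivative_along_curve[OF this dL] sum_axis_pd[OF ij, of "m p" m]
    have "((\<lambda>t. m (L p t)) has_vector_derivative pd i m (L p t) + m p * pd j m (L p t)) (at t)"
      by simp
    moreover have "pd i m (L p t) + m p * pd j m (L p t) = - (g t * \<phi> t)"
      using L[OF that] by (simp add: g_def \<phi>_def algebra_simps)
    ultimately have "((\<lambda>t. m (L p t)) has_real_derivative - (g t * \<phi> t)) (at t within {a..b})"
      by (simp add: has_real_derivative_iff_has_vector_derivative has_vector_derivative_at_within)
    from DERIV_diff[OF this DERIV_const[of "m p"]] show ?thesis
      by (simp add: \<phi>_def[abs_def])
  qed
  \<comment> \<open>\<open>exp (G t)\<close> is the integrating factor of the linear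
    equation.\<close>
  have "((\<lambda>t. \<phi> t * exp (G t)) has_real_derivative 0) (at t within {a..b})" if "t \<in> {a..b}" for t
    using d\<phi>[OF that] G[OF that]
    by (auto intro!: derivative_eq_intros simp: has_real_derivative_iff_has_vector_derivative[symmetric] algebra_simps)
  then obtain c where c: "\<And>t. t \<in> {a..b} \<Longrightarrow> \<phi> t * exp (G t) = c"
    using has_field_derivative_zero_constant[of "{a..b}" "\<lambda>t. \<phi> t * exp (G t)"] by auto
  have "\<phi> 0 = 0" by (simp add: \<phi>_def L_def)
  then have "c = 0" using c[OF ab] by simp
  then show ?thesis using c[OF t] by (simp add: \<phi>_def)
qed

lemma affine_along_line:
  fixes f :: "real^2 \<Rightarrow> real"
  assumes S: "open S" and f: "Ck_on 2 f S" and ab: "0 \<in> {a..b}"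
    and L: "\<And>t. t \<in> {a..b} \<Longrightarrow> p + t *\<^sub>R v \<in> S \<and> hess f (p + t *\<^sub>R v) v = 0"
    and t: "t \<in> {a..b}"
  shows "f (p + t *\<^sub>R v) = f p + t * (v$1 * pd 1 f p + v$2 * pd 2 f p)"
proof -
  let ?L = "\<lambda>t. p + t *\<^sub>R v"
  have dL: "(?L has_vector_derivative v) (at t)" for t
    by (auto intro!: derivative_eq_intros)
  define g where "g t = v$1 * pd 1 f (?L t) + v$2 * pd 2 f (?L t)" for t
  have df: "((\<lambda>t. f (?L t)) has_real_derivative g t) (at t within {a..b})" if "t \<in> {a..b}" for t
    using has_vector_derivative_along_curve[OF Ck_on_differentiable[OF f] dL] L[OF that]
    by (simp add: g_def has_real_derivative_iff_has_vector_derivative has_vector_derivative_at_within)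
  have "(g has_real_derivative 0) (at t within {a..b})" if "t \<in> {a..b}" for t
  proof -
    have "((\<lambda>t. pd i f (?L t)) has_real_derivative (v$1 * pd 1 (pd i f) (?L t) + v$2 * pd 2 (pd i f) (?L t))) (at t within {a..b})" for i
      using has_vector_derivative_along_curve[OF Ck_on_differentiable[OF Ck_on_pd[OF f, of 1]] dL] L[OF that]
      by (simp add: has_real_derivative_iff_has_vector_derivative has_vector_derivative_at_within)
    from DERIV_add[OF DERIV_cmult[OF this[of 1], of "v$1"] DERIV_cmult[OF this[of 2], of "v$2"]]
    show ?thesis
      using L[OF that] pd_commute[OF S f, of "?L t" 1 2]
      by (simp add: g_def[abs_def] hess_def algebra_simps power2_eq_square)
  qed
  then obtain c where c: "\<And>t. t \<in> {a..b} \<Longrightarrow> g t = c"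
    using has_field_derivative_zero_constant[of "{a..b}" g] by auto
  have "((\<lambda>t. f (?L t) - t * c) has_real_derivative 0) (at t within {a..b})" if "t \<in> {a..b}" for t
    using df[OF that] c[OF that] by (auto intro!: derivative_eq_intros)
  then obtain d where d: "\<And>t. t \<in> {a..b} \<Longrightarrow> f (?L t) - t * c = d"
    using has_field_derivative_zero_constant[of "{a..b}" "\<lambda>t. f (?L t) - t * c"] by auto
  show ?thesis using d[OF t] d[OF ab] c[OF ab] by (simp add: g_def)
qed

lemma third_pd_commute:
  fixes f :: "real^2 \<Rightarrow> real"
  assumes S: "open S" and f: "Ck_on 3 f S" and p: "p \<in> S"
  shows "pd 1 (pd 2 (pd 1 f)) p = pd 2 (pd 1 (pd 1 f)) p" "pd 1 (pd 2 (pd 2 f)) p = pd 2 (pd 2 (pd 1 f)) p"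
    "pd 2 (pd 1 (pd 2 f)) p = pd 2 (pd 2 (pd 1 f)) p" "pd 1 (pd 1 (pd 2 f)) p = pd 2 (pd 1 (pd 1 f)) p"
    "pd 1 (pd 2 f) p = pd 2 (pd 1 f) p"
proof -
  have c1: "pd a (pd b (pd c f)) p = pd b (pd a (pd c f)) p" for a b c
    by (rule pd_commute[OF S Ck_on_pd[OF f] p]) simp
  have c2: "pd a (pd b (pd c f)) p = pd a (pd c (pd b f)) p" for a b c
    by (rule pd_cong[OF S p], rule pd_commute[OF S Ck_on_le[OF f]]) auto
  show "pd 1 (pd 2 (pd 1 f)) p = pd 2 (pd 1 (pd 1 f)) p" "pd 1 (pd 2 (pd 2 f)) p = pd 2 (pd 2 (pd 1 f)) p"
    "pd 2 (pd 1 (pd 2 f)) p = pd 2 (pd 2 (pd 1 f)) p" "pd 1 (pd 1 (pd 2 f)) p = pd 2 (pd 1 (pd 1 f)) p"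
    using c1[of 1 2 1] c1[of 1 2 2] c2[of 2 1 2] c2[of 1 1 2] by auto
  show "pd 1 (pd 2 f) p = pd 2 (pd 1 f) p"
    by (rule pd_commute[OF S Ck_on_le[OF f] p]) simp
qed

text \<open>The quadratic equation for the slope is differentiated in the asymptotic direction
  itself. The last factor is half the derivative of the quadratic in the slope; where it is nonzero,
  \<open>cub\<close> vanishes exactly where the slope is stationary along its own direction. With
  \<open>i\<close> and \<open>j\<close> free the lemma serves both asymptotic families.\<close>

lemma asymptotic_slope_equation:
  fixes f m :: "real^2 \<Rightarrow> real"
  assumes S: "open S" and f: "Ck_on 3 f S" and m: "Ck_on 1 m S" and ij: "i \<noteq> j" and p: "p \<in> S"
    and quad: "\<And>p. p \<in> S \<Longrightarrow> hess f p (axis i 1 + m p *\<^sub>R axis j 1) = 0"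
  shows "cub f p (axis i 1 + m p *\<^sub>R axis j 1) +
    2 * (pd i m p + m p * pd j m p) * (pd 2 (pd 1 f) p + m p * pd j (pd j f) p) = 0"
proof -
  define q where "q p = pd i (pd i f) p + (2 * m p * pd 2 (pd 1 f) p + m p * m p * pd j (pd j f) p)" for p
  have q0: "q p = 0" if "p \<in> S" for p
    using quad[OF that] ij exhaust_2[of i] exhaust_2[of j]
    by (auto simp: q_def hess_def axis_def power2_eq_square algebra_simps)
  have dm: "m differentiable (at p)" and df: "pd a (pd b f) differentiable (at p)" for a b
    using Ck_on_differentiable[OF m _ p] Ck_on_differentiable[OF Ck_on_pd[OF Ck_on_pd[OF f, of 2], of 1] _ p] by auto
  have "pd k q p = pd k (pd i (pd i f)) p + (2 * (pd k m p * pd 2 (pd 1 f) p + m p * pd k (pd 2 (pd 1 f)) p)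
      + (2 * m p * pd k m p * pd j (pd j f) p + m p * m p * pd k (pd j (pd j f)) p))" for k
    unfolding q_def using dm df
    by (simp add: pd_add pd_mult algebra_simps)
  moreover have "pd k q p = 0" for k
    using pd_cong[OF S p, of q "\<lambda>p. 0" k] q0 by simp
  ultimately have e: "pd k (pd i (pd i f)) p + (2 * (pd k m p * pd 2 (pd 1 f) p + m p * pd k (pd 2 (pd 1 f)) p)
      + (2 * m p * pd k m p * pd j (pd j f) p + m p * m p * pd k (pd j (pd j f)) p)) = 0" for k
    by metis
  note s = third_pd_commute[OF S f p]
  \<comment> \<open>The equation \<open>e\<close> for \<open>i\<close> plus \<open>m p\<close> times
    the one for \<open>j\<close>, that is, the derivative in direction
    \<open>axis i 1 + m p *\<^sub>R axis j 1\<close>.\<close>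
  have "0 = (pd i (pd i (pd i f)) p + (2 * (pd i m p * pd 2 (pd 1 f) p + m p * pd i (pd 2 (pd 1 f)) p)
      + (2 * m p * pd i m p * pd j (pd j f) p + m p * m p * pd i (pd j (pd j f)) p)))
    + m p * (pd j (pd i (pd i f)) p + (2 * (pd j m p * pd 2 (pd 1 f) p + m p * pd j (pd 2 (pd 1 f)) p)
      + (2 * m p * pd j m p * pd j (pd j f) p + m p * m p * pd j (pd j (pd j f)) p)))"
    unfolding e by simp
  then show ?thesis
    using ij exhaust_2[of i] exhaust_2[of j]
    by (auto simp: cub_def axis_def s power2_eq_square power3_eq_cube algebra_simps)
qed

locale asymptotic_graph =
  fixes S :: "(real^2) set" and f m :: "real^2 \<Rightarrow> real"
  assumes S: "open S" and f: "Ck_on 4 f S" and m: "Ck_on 2 m S"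
    and quad: "\<And>p. p \<in> S \<Longrightarrow> hess f p (vector [1, m p]) = 0"
    and psi_pos: "\<And>p. p \<in> S \<Longrightarrow> 0 < pd 2 (pd 1 f) p + m p * pd 2 (pd 2 f) p"
begin

text \<open>Half the derivative of the quadratic equation for the slope. By \<open>quad\<close> its
  square is minus the Hessian determinant, so \<open>psi_pos\<close> says that \<open>m\<close> is a
  simple root on a fixed branch.\<close>

definition psi :: "real^2 \<Rightarrow> real" where
  "psi p = pd 2 (pd 1 f) p + m p * pd 2 (pd 2 f) p"

text \<open>\<open>vector [kappa p, 1 + kappa p * m p]\<close> is the other asymptotic direction.\<close>

definition kappa :: "real^2 \<Rightarrow> real" where
  "kappa p = - pd 2 (pd 2 f) p / (2 * psi p)"

definition cubA :: "real^2 \<Rightarrow> real" where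
  "cubA p = cub f p (vector [kappa p, 1 + kappa p * m p])"

definition cubB :: "real^2 \<Rightarrow> real" where
  "cubB p = cub f p (vector [1, m p])"

lemma axis_eq: "axis 1 1 + c *\<^sub>R axis 2 1 = (vector [1, c] :: real^2)"
  by (simp add: vec_eq_iff forall_2 axis_def)

lemma line_eq: "vector [a, b] + t *\<^sub>R vector [1, c] = (vector [a + t, b + t * c] :: real^2)"
  by (simp add: vec_eq_iff forall_2)

lemma psi_nonzero: "p \<in> S \<Longrightarrow> psi p \<noteq> 0"
  using psi_pos[of p] by (simp add: psi_def)

lemmas third_commute = third_pd_commute[OF S Ck_on_le[OF f, of 3, simplified]]

text \<open>Since \<open>psi\<close> can be cancelled, the slope satisfies the inviscid Burgers
  equation; its characteristics are straight and are the asymptotic lines themselves.\<close>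

lemma slope_equation:
  assumes "p \<in> S" "cubB p = 0"
  shows "pd 1 m p + m p * pd 2 m p = 0"
  using asymptotic_slope_equation[of S f m 1 2 p, OF S Ck_on_le[OF f] Ck_on_le[OF m] _ assms(1)]
    assms quad psi_nonzero[OF assms(1)]
  by (simp add: axis_eq cubB_def psi_def)

lemma slope_along_line:
  assumes "0 \<in> {a..b}" "T \<in> {a..b}"
    and "\<And>t. t \<in> {a..b} \<Longrightarrow> vector [x0 + t, s + t * m (vector [x0, s])] \<in> S \<and>
      cubB (vector [x0 + t, s + t * m (vector [x0, s])]) = 0"
  shows "m (vector [x0 + T, s + T * m (vector [x0, s])]) = m (vector [x0, s])"
  using slope_constant[of 1 2 m S a b "vector [x0, s]" T] Ck_on_le[OF m] assms slope_equation
  by (simp add: axis_eq line_eq)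

lemma affine_along_asymptotic_line:
  assumes "0 \<in> {a..b}" "T \<in> {a..b}"
    and "\<And>t. t \<in> {a..b} \<Longrightarrow> vector [x0 + t, s + t * m (vector [x0, s])] \<in> S \<and>
      cubB (vector [x0 + t, s + t * m (vector [x0, s])]) = 0"
  shows "f (vector [x0 + T, s + T * m (vector [x0, s])]) = f (vector [x0, s]) +
    T * (pd 1 f (vector [x0, s]) + m (vector [x0, s]) * pd 2 f (vector [x0, s]))"
proof -
  have "hess f (vector [x0 + t, s + t * m (vector [x0, s])]) (vector [1, m (vector [x0, s])]) = 0"
    if "t \<in> {a..b}" for t
    using quad[of "vector [x0 + t, s + t * m (vector [x0, s])]"] slope_along_line[OF assms(1) that assms(3)]
      assms(3)[OF that] by simp
  then show ?thesis
    using affine_along_line[of S f a b "vector [x0, s]" "vector [1, m (vector [x0, s])]" T]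
      S Ck_on_le[OF f] assms by (simp add: line_eq)
qed

end

section \<open>Third derivatives along a ruling\<close>

lemma DERIV_eventually_eq:
  fixes F G :: "real \<Rightarrow> real"
  assumes "eventually (\<lambda>s. F s = G s) (nhds x)" "(F has_real_derivative a) (at x)" "(G has_real_derivative b) (at x)"
  shows "a = b"
  using assms DERIV_cong_ev[of x x F G b b] DERIV_unique by blast

lemma DERIV_transfer:
  fixes F G :: "real \<Rightarrow> real"
  shows "eventually (\<lambda>s. F s = G s) (nhds x) \<Longrightarrow> (F has_real_derivative a) (at x) \<Longrightarrow> (G has_real_derivative a) (at x)"
  by (simp add: DERIV_cong_ev)

text \<open>At parameter \<open>t\<close> of a ruling, \<open>a\<close> is the second derivative of
  \<open>f\<close> in the second variable, \<open>b\<close> its derivative along the ruling,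
  \<open>c\<close> that of \<open>psi\<close>, and \<open>d\<close> the third derivative in the
  second variable. At the start of the ruling \<open>f0\<close>, \<open>psi0\<close>,
  \<open>psi2\<close>, \<open>mu\<close>, \<open>mu2\<close> are the second derivative of
  \<open>f\<close>, then \<open>psi\<close> and its derivative, then the first two derivatives of
  \<open>m\<close>, all in the second variable. The bracket is \<open>cubA\<close> without its term
  in \<open>kap^3\<close>.\<close>

lemma cubic_along_ruling_identity:
  fixes a b c d t :: real
  assumes nz: "tau \<noteq> 0" "psi0 \<noteq> 0"
    and tau: "tau = 1 + t * mu"
    and psi: "psi1 * tau^2 = psi0" and kap: "kap = - a / (2 * psi1)"
    and P: "a * tau^3 = P" "P = f0 * tau^2 + t * (psi2 * tau - t * psi0 * mu2)"
    and Pt: "b * tau^3 + 3 * a * tau^2 * mu = 2 * mu * tau * f0 + (psi2 * tau - t * psi0 * mu2) + t * (psi2 * mu - psi0 * mu2)"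
    and c: "c * tau^3 = - 2 * mu * psi0"
    and d: "d * tau^4 + 3 * a * tau^2 * t * mu2 = Q"
  shows "(d + 3 * kap * b + 3 * kap^2 * c) * tau^4 = Q - 3 * psi2 / (2 * psi0) * P"
proof -
  define Pt' where "Pt' = 2 * mu * tau * f0 + (psi2 * tau - t * psi0 * mu2) + t * (psi2 * mu - psi0 * mu2)"
  have psi1: "psi1 = psi0 / tau^2" using psi nz by (simp add: field_simps)
  have a: "a = P / tau^3" using P(1) nz by (simp add: field_simps)
  have kap': "kap = - P / (2 * psi0 * tau)"
    using nz unfolding kap psi1 a by (simp add: field_simps power2_eq_square power3_eq_cube)
  have b: "b = (Pt' - 3 * P * mu / tau) / tau^3"
    using Pt nz unfolding a Pt'_def[symmetric] by (simp add: field_simps power2_eq_square power3_eq_cube)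
  have c': "c = - 2 * mu * psi0 / tau^3" using c nz by (simp add: field_simps)
  have d': "d = (Q - 3 * P * t * mu2 / tau) / tau^4"
    using d nz unfolding a by (simp add: field_simps power2_eq_square power3_eq_cube power4_eq_xxxx)
  have "(d + 3 * kap * b + 3 * kap^2 * c) * tau^4
      = Q - 3 * P / (2 * psi0 * tau) * (Pt' * tau - 2 * P * mu + 2 * psi0 * t * mu2)"
    using nz unfolding kap' b c' d' by (simp add: field_simps power2_eq_square power3_eq_cube power4_eq_xxxx)
  \<comment> \<open>The point of the calculation: only \<open>psi2 * tau\<close> survives, so the
    coefficient of \<open>P\<close> does not depend on \<open>t\<close> and the degree in
    \<open>t\<close> does not grow.\<close>
  also have "Pt' * tau - 2 * P * mu + 2 * psi0 * t * mu2 = psi2 * tau"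
    unfolding Pt'_def P(2) tau by (simp add: algebra_simps power2_eq_square)
  finally show ?thesis using nz by simp
qed

context asymptotic_graph
begin

text \<open>A compact piece of the line has an \<open>e\<close>-neighbourhood in \<open>V\<close>,
  and a neighbouring line is displaced vertically by at most the shift of its start plus
  \<open>\<bar>t\<bar>\<close> times the change of slope.\<close>

lemma line_tube:
  assumes V: "open V" "V \<subseteq> S" and ab: "0 \<in> {a..b}"
    and L: "\<And>t. t \<in> {a..b} \<Longrightarrow> vector [x0 + t, s0 + t * m (vector [x0, s0])] \<in> V"
  shows "eventually (\<lambda>s. \<forall>t\<in>{a..b}. vector [x0 + t, s + t * m (vector [x0, s])] \<in> V) (nhds s0)"
proof -
  let ?L = "\<lambda>t. vector [x0 + t, s0 + t * m (vector [x0, s0])] :: real^2"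
  have "continuous_on {a..b} (\<lambda>t. vector [x0, s0] + t *\<^sub>R vector [1, m (vector [x0, s0])] :: real^2)"
    by (intro continuous_intros)
  then have "compact (?L ` {a..b})"
    unfolding line_eq by (intro compact_continuous_image) auto
  moreover have "?L ` {a..b} \<subseteq> V" using L by blast
  ultimately obtain e where e: "e > 0" "(\<Union>p\<in>?L ` {a..b}. ball p e) \<subseteq> V"
    by (rule compact_subset_open_imp_ball_epsilon_subset[OF _ V(1)])
  define c where "c = \<bar>a\<bar> + \<bar>b\<bar>"
  have "vector [x0, s0] \<in> S" using L[OF ab] V by auto
  then have "m differentiable (at (vector [x0, s0]))" using Ck_on_differentiable[OF m] by simp
  from has_real_derivative_along_curve[OF this DERIV_const DERIV_ident]
  have "isCont (\<lambda>s. m (vector [x0, s])) s0" using DERIV_isCont by blast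
  then have "isCont (\<lambda>s. \<bar>s - s0\<bar> + c * \<bar>m (vector [x0, s]) - m (vector [x0, s0])\<bar>) s0"
    by (intro continuous_intros)
  then have "((\<lambda>s. \<bar>s - s0\<bar> + c * \<bar>m (vector [x0, s]) - m (vector [x0, s0])\<bar>) \<longlongrightarrow> 0) (nhds s0)"
    by (simp add: continuous_at tendsto_nhds_iff)
  from order_tendstoD(2)[OF this e(1)] show ?thesis
  proof (rule eventually_mono, intro ballI)
    fix s t assume s: "\<bar>s - s0\<bar> + c * \<bar>m (vector [x0, s]) - m (vector [x0, s0])\<bar> < e" and t: "t \<in> {a..b}"
    define d where "d = s0 + t * m (vector [x0, s0]) - (s + t * m (vector [x0, s]))"
    have "\<bar>t\<bar> \<le> c" using t ab by (auto simp: c_def)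
    have "\<bar>d\<bar> \<le> \<bar>s - s0\<bar> + \<bar>t * (m (vector [x0, s]) - m (vector [x0, s0]))\<bar>"
      unfolding d_def by (simp add: algebra_simps)
    also have "\<dots> \<le> \<bar>s - s0\<bar> + c * \<bar>m (vector [x0, s]) - m (vector [x0, s0])\<bar>"
      unfolding abs_mult using \<open>\<bar>t\<bar> \<le> c\<close> by (simp add: mult_right_mono)
    also note s
    finally have "\<bar>d\<bar> < e" .
    have "?L t - vector [x0 + t, s + t * m (vector [x0, s])] = d *\<^sub>R axis 2 1"
      by (simp add: vec_eq_iff forall_2 axis_def d_def)
    then have "dist (?L t) (vector [x0 + t, s + t * m (vector [x0, s])]) = \<bar>d\<bar>"
      by (simp add: dist_norm)
    with \<open>\<bar>d\<bar> < e\<close> have "vector [x0 + t, s + t * m (vector [x0, s])] \<in> ball (?L t) e" by simp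
    then show "vector [x0 + t, s + t * m (vector [x0, s])] \<in> V"
      using e(2) t by blast
  qed
qed

lemma Ck_on_psi: "Ck_on 2 psi S"
  unfolding psi_def
  by (intro Ck_on_add Ck_on_mult S m Ck_on_pd[OF Ck_on_pd[OF f, of 3]]) auto

text \<open>Neighbouring asymptotic lines are straight as well, so the surface is ruled near the line
  and all derivatives in the transversal direction can be read off from the rulings. Since \<open>f\<close>
  is only of class \<open>C\<^sup>4\<close>, the coefficients of the polynomial are obtained by differentiating an
  identity between polynomials in \<open>t\<close> whose coefficients depend on the ruling.\<close>

lemma cubA_polynomial:
  assumes V: "open V" "V \<subseteq> S" "\<And>p. p \<in> V \<Longrightarrow> cubB p = 0" and \<alpha>\<beta>: "\<alpha> < 0" "0 < \<beta>"
    and L: "\<And>t. t \<in> {\<alpha><..<\<beta>} \<Longrightarrow> vector [x0 + t, s0 + t * m (vector [x0, s0])] \<in> V"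
  shows "\<exists>r0 r1 r2 k. \<forall>t\<in>{\<alpha><..<\<beta>}.
    cubA (vector [x0 + t, s0 + t * m (vector [x0, s0])]) * (1 + k * t)^4 = r0 + r1 * t + r2 * t\<^sup>2"
proof -
  \<comment> \<open>Nearby rulings are indexed by the height \<open>s\<close> of their starting
    point on a vertical line; \<open>\<tau> t s\<close> is the derivative of the second coordinate
    of \<open>Y t s\<close> with respect to \<open>s\<close>.\<close>
  define B where "B s = (vector [x0, s] :: real^2)" for s
  define Y where "Y t s = (vector [x0 + t, s + t * m (B s)] :: real^2)" for t s
  define \<mu> where "\<mu> s = pd 2 m (B s)" for s
  define \<mu>2 where "\<mu>2 s = pd 2 (pd 2 m) (B s)" for s
  define \<tau> where "\<tau> t s = 1 + t * \<mu> s" for t s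
  \<comment> \<open>\<open>good\<close> keeps the whole piece of the ruling from 0 to
    \<open>t\<close> in \<open>V\<close>, where the ruling is straight. \<open>eg\<close> asks this
    for all nearby \<open>s\<close>, so that identities valid under it can be differentiated in
    \<open>s\<close>, and repeatedly, because \<open>eg\<close> is inherited by nearby
    \<open>s\<close>.\<close>
  define good where "good t s \<longleftrightarrow> (\<forall>t'\<in>{min 0 t..max 0 t}. Y t' s \<in> V)" for t s
  define eg where "eg t s \<longleftrightarrow> eventually (good t) (nhds s)" for t s
  define P where "P t s = pd 2 (pd 2 f) (B s) * (\<tau> t s)\<^sup>2 + t * (pd 2 psi (B s) * \<tau> t s - t * psi (B s) * \<mu>2 s)" for t s
  have Y0: "Y 0 s = B s" for s by (simp add: Y_def B_def)
  have goodS: "B s \<in> S" "Y t s \<in> S" if "good t s" for t s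
    using that V(2) Y0[of s] unfolding good_def by (metis atLeastAtMost_iff max.cobounded1 min.cobounded1 subsetD, metis atLeastAtMost_iff max.cobounded2 min.cobounded2 subsetD)
  have egD: "good t s" "eventually (eg t) (nhds s)" if "eg t s" for t s
    using that unfolding eg_def by (auto dest: eventually_nhds_x_imp_x simp: eventually_eventually)
  have eg: "eg t s0" if "t \<in> {\<alpha><..<\<beta>}" for t
  proof -
    have "\<And>t'. t' \<in> {min 0 t..max 0 t} \<Longrightarrow> t' \<in> {\<alpha><..<\<beta>}" using that \<alpha>\<beta> by auto
    then show ?thesis
      unfolding eg_def good_def Y_def B_def using L
      by (intro line_tube V) auto
  qed
  have slope: "m (Y t s) = m (B s)" and
    aff: "f (Y t s) = f (B s) + t * (pd 1 f (B s) + m (B s) * pd 2 f (B s))" if "good t s" for t s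
    unfolding Y_def B_def
    by (rule slope_along_line[of "min 0 t" "max 0 t"] affine_along_asymptotic_line[of "min 0 t" "max 0 t"];
        use that V in \<open>auto simp: good_def Y_def B_def\<close>)+
  have diff: "f differentiable (at p)" "pd i f differentiable (at p)" "pd j (pd i f) differentiable (at p)"
    "m differentiable (at p)" "pd i m differentiable (at p)" "psi differentiable (at p)" if "p \<in> S" for p i j
    using Ck_on_differentiable[OF f _ that] Ck_on_differentiable[OF m _ that] Ck_on_differentiable[OF Ck_on_psi _ that]
      Ck_on_differentiable[OF Ck_on_pd[OF f, of 3] _ that] Ck_on_differentiable[OF Ck_on_pd[OF m, of 1] _ that]
      Ck_on_differentiable[OF Ck_on_pd[OF Ck_on_pd[OF f, of 3], of 2] _ that] by auto
  have DB: "((\<lambda>s. F (B s)) has_real_derivative pd 2 F (B s)) (at s)" if "F differentiable (at (B s))" for F :: "real^2 \<Rightarrow> real" and s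
    using has_real_derivative_along_curve[OF that[unfolded B_def] DERIV_const DERIV_ident] by (simp add: B_def)
  have D\<tau>: "((\<lambda>s. \<tau> t s) has_real_derivative t * \<mu>2 s) (at s)" if "B s \<in> S" for t s
    unfolding \<tau>_def \<mu>_def \<mu>2_def using DB[OF diff(5)[OF that]] by (auto intro!: derivative_eq_intros)
  have DY: "((\<lambda>s. F (Y t s)) has_real_derivative \<tau> t s * pd 2 F (Y t s)) (at s)"
    if "F differentiable (at (Y t s))" "B s \<in> S" for F :: "real^2 \<Rightarrow> real" and t s
  proof -
    have "((\<lambda>s. s + t * m (B s)) has_real_derivative \<tau> t s) (at s)"
      unfolding \<tau>_def \<mu>_def using DB[OF diff(4)[OF that(2)]] by (auto intro!: derivative_eq_intros)
    from has_real_derivative_along_curve[OF that(1)[unfolded Y_def] DERIV_const this]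
    show ?thesis by (simp add: Y_def)
  qed
  \<comment> \<open>Rulings do not meet inside \<open>V\<close>: were \<open>\<tau>\<close> zero,
    differentiating the constancy of the slope in \<open>s\<close> would give
    \<open>\<mu> s = 0\<close>, hence \<open>\<tau> t s = 1\<close>.\<close>
  have \<tau>0: "\<tau> t s \<noteq> 0" if "eg t s" for t s
  proof
    assume 0: "\<tau> t s = 0"
    have "\<tau> t s * pd 2 m (Y t s) = \<mu> s"
    proof (rule DERIV_eventually_eq)
      show "\<forall>\<^sub>F s in nhds s. m (Y t s) = m (B s)"
        using that unfolding eg_def by (rule eventually_mono) (rule slope)
      show "((\<lambda>s. m (Y t s)) has_real_derivative \<tau> t s * pd 2 m (Y t s)) (at s)"
        "((\<lambda>s. m (B s)) has_real_derivative \<mu> s) (at s)"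
        using DY DB diff goodS[OF egD(1)[OF that]] by (auto simp: \<mu>_def)
    qed
    with 0 show False by (auto simp: \<tau>_def)
  qed
  \<comment> \<open>The derivative of \<open>aff\<close> in \<open>s\<close>; \<open>f22\<close> and
    \<open>DP\<close> repeat the step. Each time the chain rule puts one more factor
    \<open>\<tau>\<close> on the left.\<close>
  have f2: "pd 2 f (Y t s) = pd 2 f (B s) + t * psi (B s) / \<tau> t s" if "eg t s" for t s
  proof -
    have "\<tau> t s * pd 2 f (Y t s) = pd 2 f (B s) + t * (pd 2 (pd 1 f) (B s) + (\<mu> s * pd 2 f (B s) + pd 2 (pd 2 f) (B s) * m (B s)))"
    proof (rule DERIV_eventually_eq)
      show "\<forall>\<^sub>F s in nhds s. f (Y t s) = f (B s) + t * (pd 1 f (B s) + m (B s) * pd 2 f (B s))"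
        using that unfolding eg_def by (rule eventually_mono) (rule aff)
    qed (use DY DB[OF diff(1)] DB[OF diff(2)] DB[OF diff(4)] diff goodS[OF egD(1)[OF that]] in \<open>auto intro!: derivative_eq_intros simp: \<mu>_def\<close>)
    also have "\<dots> = pd 2 f (B s) * \<tau> t s + t * psi (B s)"
      by (simp add: psi_def \<tau>_def algebra_simps)
    finally show ?thesis using \<tau>0[OF that] by (simp add: field_simps)
  qed
  have f22: "pd 2 (pd 2 f) (Y t s) * (\<tau> t s)^3 = P t s" if "eg t s" for t s
  proof -
    have "\<tau> t s * pd 2 (pd 2 f) (Y t s) = pd 2 (pd 2 f) (B s) +
        (pd 2 psi (B s) * t * \<tau> t s - t * psi (B s) * (t * \<mu>2 s)) / (\<tau> t s * \<tau> t s)"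
    proof (rule DERIV_eventually_eq)
      show "\<forall>\<^sub>F s in nhds s. pd 2 f (Y t s) = pd 2 f (B s) + t * psi (B s) / \<tau> t s"
        using egD(2)[OF that] by (rule eventually_mono) (rule f2)
    qed (use DY DB[OF diff(2)] DB[OF diff(6)] D\<tau> diff goodS[OF egD(1)[OF that]] \<tau>0[OF that] in \<open>auto intro!: derivative_eq_intros\<close>)
    then show ?thesis using \<tau>0[OF that]
      by (simp add: P_def field_simps power2_eq_square power3_eq_cube)
  qed
  define m0 where "m0 = m (B s0)"
  define Q where "Q t = pd 2 (pd 2 (pd 2 f)) (Y t s0) * (\<tau> t s0)^4 + 3 * pd 2 (pd 2 f) (Y t s0) * (\<tau> t s0)^2 * t * \<mu>2 s0" for t
  have DP: "((\<lambda>s. P t s) has_real_derivative Q t) (at s0)" if "t \<in> {\<alpha><..<\<beta>}" for t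
  proof -
    note e = eg[OF that]
    have "((\<lambda>s. pd 2 (pd 2 f) (Y t s) * (\<tau> t s)^3) has_real_derivative Q t) (at s0)"
      using DY[of "pd 2 (pd 2 f)" t s0] D\<tau>[of s0 t] diff goodS[OF egD(1)[OF e]]
      by (auto intro!: derivative_eq_intros simp: Q_def power2_eq_square power3_eq_cube power4_eq_xxxx)
    moreover have "\<forall>\<^sub>F s in nhds s0. pd 2 (pd 2 f) (Y t s) * (\<tau> t s)^3 = P t s"
      using egD(2)[OF e] by (rule eventually_mono) (rule f22)
    ultimately show ?thesis by (rule DERIV_transfer[rotated])
  qed
  \<comment> \<open>One coefficient of \<open>P\<close> contains \<open>\<mu>2\<close>, which is
    merely continuous and cannot be differentiated in \<open>s\<close>. But a quadratic polynomial
    in \<open>t\<close> is determined by its values at \<open>- h\<close>, \<open>0\<close> and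
    \<open>h\<close>, and these are differentiable by \<open>DP\<close>.\<close>
  define h where "h = min (- \<alpha>) \<beta> / 2"
  have h: "h > 0" "h \<in> {\<alpha><..<\<beta>}" "- h \<in> {\<alpha><..<\<beta>}" "0 \<in> {\<alpha><..<\<beta>}" using \<alpha>\<beta> by (auto simp: h_def)
  have Pt: "P t s = P 0 s + (P h s - P (- h) s) / (2 * h) * t + (P h s + P (- h) s - 2 * P 0 s) / (2 * h\<^sup>2) * t\<^sup>2" for t s
    using h(1) unfolding P_def \<tau>_def by (simp add: field_simps power2_eq_square)
  define q1 where "q1 = (Q h - Q (- h)) / (2 * h)"
  define q2 where "q2 = (Q h + Q (- h) - 2 * Q 0) / (2 * h\<^sup>2)"
  have Q: "Q t = Q 0 + q1 * t + q2 * t\<^sup>2" if "t \<in> {\<alpha><..<\<beta>}" for t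
  proof -
    have "((\<lambda>s. P 0 s + (P h s - P (- h) s) / (2 * h) * t + (P h s + P (- h) s - 2 * P 0 s) / (2 * h\<^sup>2) * t\<^sup>2)
        has_real_derivative Q 0 + q1 * t + q2 * t\<^sup>2) (at s0)"
      unfolding q1_def q2_def
      by (intro DERIV_add DERIV_cmult_right DERIV_cdivide DERIV_diff DERIV_cmult DP h)
    then show ?thesis using DP[OF that] unfolding Pt[symmetric] by (metis DERIV_unique)
  qed
  have DL: "((\<lambda>t. F (Y t s0)) has_real_derivative pd 1 F (Y t s0) + m0 * pd 2 F (Y t s0)) (at t)"
    if "F differentiable (at (Y t s0))" for F :: "real^2 \<Rightarrow> real" and t
  proof -
    have "((\<lambda>t. x0 + t) has_real_derivative 1) (at t)" "((\<lambda>t. s0 + t * m0) has_real_derivative m0) (at t)"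
      by (auto intro!: derivative_eq_intros)
    from has_real_derivative_along_curve[OF that[unfolded Y_def m0_def[symmetric]] this]
    show ?thesis by (simp add: Y_def m0_def)
  qed
  have nbh: "\<forall>\<^sub>F t in nhds t. t \<in> {\<alpha><..<\<beta>}" if "t \<in> {\<alpha><..<\<beta>}" for t
    using that by (rule eventually_nhds_in_open[rotated]) auto
  have D\<tau>t: "((\<lambda>t. \<tau> t s0) has_real_derivative \<mu> s0) (at t)" for t
    unfolding \<tau>_def by (auto intro!: derivative_eq_intros)
  \<comment> \<open>Now \<open>f2\<close> is differentiated along the ruling instead of across it.
    As \<open>m\<close> is constant there, the left-hand side is the value of
    \<open>psi\<close>.\<close>
  have p: "pd 2 (pd 1 f) (Y t s0) + m0 * pd 2 (pd 2 f) (Y t s0) = psi (B s0) / (\<tau> t s0)^2" if "t \<in> {\<alpha><..<\<beta>}" for t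
  proof -
    have "pd 1 (pd 2 f) (Y t s0) + m0 * pd 2 (pd 2 f) (Y t s0) =
        (psi (B s0) * \<tau> t s0 - t * psi (B s0) * \<mu> s0) / (\<tau> t s0 * \<tau> t s0)"
    proof (rule DERIV_eventually_eq)
      show "\<forall>\<^sub>F t in nhds t. pd 2 f (Y t s0) = pd 2 f (B s0) + t * psi (B s0) / \<tau> t s0"
        using nbh[OF that] by (rule eventually_mono) (rule f2, rule eg)
    qed (use DL D\<tau>t diff goodS[OF egD(1)[OF eg[OF that]]] \<tau>0[OF eg[OF that]] in \<open>auto intro!: derivative_eq_intros\<close>)
    then show ?thesis
      using third_commute(5)[OF goodS(2)[OF egD(1)[OF eg[OF that]]]]
      by (simp add: \<tau>_def algebra_simps power2_eq_square)
  qed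
  have p': "(pd 2 (pd 1 (pd 1 f)) (Y t s0) + 2 * m0 * pd 2 (pd 2 (pd 1 f)) (Y t s0) + m0\<^sup>2 * pd 2 (pd 2 (pd 2 f)) (Y t s0)) * (\<tau> t s0)^3
      = - 2 * \<mu> s0 * psi (B s0)" if "t \<in> {\<alpha><..<\<beta>}" for t
  proof -
    note S' = goodS(2)[OF egD(1)[OF eg[OF that]]]
    have "(pd 1 (pd 2 (pd 1 f)) (Y t s0) + m0 * pd 2 (pd 2 (pd 1 f)) (Y t s0)) + m0 * (pd 1 (pd 2 (pd 2 f)) (Y t s0) + m0 * pd 2 (pd 2 (pd 2 f)) (Y t s0))
      = - (psi (B s0) * (2 * \<tau> t s0 * \<mu> s0)) / ((\<tau> t s0)^2 * (\<tau> t s0)^2)"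
    proof (rule DERIV_eventually_eq)
      show "\<forall>\<^sub>F t in nhds t. pd 2 (pd 1 f) (Y t s0) + m0 * pd 2 (pd 2 f) (Y t s0) = psi (B s0) / (\<tau> t s0)^2"
        using nbh[OF that] by (rule eventually_mono) (rule p)
      show "((\<lambda>t. pd 2 (pd 1 f) (Y t s0) + m0 * pd 2 (pd 2 f) (Y t s0)) has_real_derivative
        (pd 1 (pd 2 (pd 1 f)) (Y t s0) + m0 * pd 2 (pd 2 (pd 1 f)) (Y t s0)) + m0 * (pd 1 (pd 2 (pd 2 f)) (Y t s0) + m0 * pd 2 (pd 2 (pd 2 f)) (Y t s0))) (at t)"
        by (intro DERIV_add DERIV_cmult DL diff S')
    qed (use DL D\<tau>t diff S' \<tau>0[OF eg[OF that]] in \<open>auto intro!: derivative_eq_intros\<close>)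
    then show ?thesis
      using third_commute[OF S'] \<tau>0[OF eg[OF that]]
      by (simp add: field_simps power2_eq_square power3_eq_cube)
  qed
  have Pd: "(pd 2 (pd 2 (pd 1 f)) (Y t s0) + m0 * pd 2 (pd 2 (pd 2 f)) (Y t s0)) * (\<tau> t s0)^3 + 3 * pd 2 (pd 2 f) (Y t s0) * (\<tau> t s0)^2 * \<mu> s0
    = 2 * \<mu> s0 * \<tau> t s0 * pd 2 (pd 2 f) (B s0) + (pd 2 psi (B s0) * \<tau> t s0 - t * psi (B s0) * \<mu>2 s0) + t * (pd 2 psi (B s0) * \<mu> s0 - psi (B s0) * \<mu>2 s0)"
    if "t \<in> {\<alpha><..<\<beta>}" for t
  proof -
    note S' = goodS(2)[OF egD(1)[OF eg[OF that]]]
    have "(pd 1 (pd 2 (pd 2 f)) (Y t s0) + m0 * pd 2 (pd 2 (pd 2 f)) (Y t s0)) * (\<tau> t s0)^3 + 3 * pd 2 (pd 2 f) (Y t s0) * (\<tau> t s0)^2 * \<mu> s0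
    = 2 * \<mu> s0 * \<tau> t s0 * pd 2 (pd 2 f) (B s0) + (pd 2 psi (B s0) * \<tau> t s0 - t * psi (B s0) * \<mu>2 s0) + t * (pd 2 psi (B s0) * \<mu> s0 - psi (B s0) * \<mu>2 s0)"
    proof (rule DERIV_eventually_eq)
      show "\<forall>\<^sub>F t in nhds t. pd 2 (pd 2 f) (Y t s0) * (\<tau> t s0)^3 = P t s0"
        using nbh[OF that] by (rule eventually_mono) (rule f22, rule eg)
    qed (use DL[of "pd 2 (pd 2 f)" t] D\<tau>t diff(3)[OF S'] in \<open>auto intro!: derivative_eq_intros simp: P_def algebra_simps\<close>)
    then show ?thesis using third_commute(2)[OF S'] by simp
  qed
  define k where "k = \<mu> s0"
  define e where "e = 3 * pd 2 psi (B s0) / (2 * psi (B s0))"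
  have "cubA (Y t s0) * (1 + k * t)^4 = Q t - e * P t s0" if "t \<in> {\<alpha><..<\<beta>}" for t
  proof -
    note g = egD(1)[OF eg[OF that]]
    note S' = goodS(2)[OF g]
    let ?K = "kappa (Y t s0)"
    have psiY: "psi (Y t s0) * (\<tau> t s0)\<^sup>2 = psi (B s0)"
      using p[OF that] slope[OF g] \<tau>0[OF eg[OF that]] by (simp add: psi_def m0_def field_simps)
    have "cubB (Y t s0) = 0" using g V(3) unfolding good_def by simp
    then have B0: "cub f (Y t s0) (vector [1, m0]) = 0" using slope[OF g] by (simp add: cubB_def m0_def)
    \<comment> \<open>Expansion of the cubic form at the second axis vector plus
      \<open>kappa\<close> times the ruling direction; the term with the cube of
      \<open>kappa\<close> is \<open>cubB\<close>, which is zero here.\<close>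
    have "cubA (Y t s0) = pd 2 (pd 2 (pd 2 f)) (Y t s0)
      + 3 * ?K * (pd 2 (pd 2 (pd 1 f)) (Y t s0) + m0 * pd 2 (pd 2 (pd 2 f)) (Y t s0))
      + 3 * ?K\<^sup>2 * (pd 2 (pd 1 (pd 1 f)) (Y t s0) + 2 * m0 * pd 2 (pd 2 (pd 1 f)) (Y t s0) + m0\<^sup>2 * pd 2 (pd 2 (pd 2 f)) (Y t s0))
      + ?K^3 * cub f (Y t s0) (vector [1, m0])"
      unfolding cubA_def slope[OF g] m0_def[symmetric]
      by (simp add: cub_def power2_eq_square power3_eq_cube algebra_simps)
    then have "cubA (Y t s0) * (\<tau> t s0)^4 = Q t - e * P t s0"
      using cubic_along_ruling_identity[OF \<tau>0[OF eg[OF that]] psi_nonzero[OF goodS(1)[OF g]] \<tau>_def psiY kappa_def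
        f22[OF eg[OF that]] P_def Pd[OF that] p'[OF that] Q_def[symmetric]] B0
      by (simp add: e_def)
    then show ?thesis by (simp add: \<tau>_def k_def mult.commute)
  qed
  note AP = this
  obtain p1 p2 where p12: "\<And>t. P t s0 = P 0 s0 + p1 * t + p2 * t\<^sup>2"
    using Pt[of _ s0] by blast
  have "cubA (Y t s0) * (1 + k * t)^4 = (Q 0 - e * P 0 s0) + (q1 - e * p1) * t + (q2 - e * p2) * t\<^sup>2"
    if "t \<in> {\<alpha><..<\<beta>}" for t
    unfolding AP[OF that] Q[OF that] by (subst p12[of t]) (simp add: algebra_simps)
  then show ?thesis unfolding Y_def B_def by blast
qed

end

section \<open>Asymptotic lines that are straight on one side\<close>

text \<open>Value and derivative at the end point exist by assumption, so both are limits from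
  inside the interval.\<close>

lemma vanishing_at_interval_end:
  fixes g :: "real \<Rightarrow> real"
  assumes "\<alpha> < \<beta>" "\<And>t. t \<in> {\<alpha><..<\<beta>} \<Longrightarrow> g t = 0" "e = \<alpha> \<or> e = \<beta>" "(g has_real_derivative d) (at e)"
  shows "g e = 0" "d = 0"
proof -
  let ?F = "at e within {\<alpha><..<\<beta>}"
  have nt: "?F \<noteq> bot"
    using assms(1,3) by (auto simp: at_within_eq_bot_iff islimpt_greaterThanLessThan1 islimpt_greaterThanLessThan2 trivial_limit_within)
  have ev: "eventually (\<lambda>t. g t = 0) ?F"
    using assms(2) by (simp add: eventually_at_topological) blast
  have "(g \<longlongrightarrow> g e) ?F"
    using tendsto_within_subset[OF DERIV_isCont[OF assms(4), unfolded isCont_def] subset_UNIV] .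
  moreover have "(g \<longlongrightarrow> 0) ?F"
    using ev by (simp add: tendsto_eventually)
  ultimately show ge: "g e = 0"
    using tendsto_unique[OF nt] by blast
  have "((\<lambda>y. (g y - g e) / (y - e)) \<longlongrightarrow> d) ?F"
    using has_field_derivative_at_within[OF assms(4)] by (simp add: has_field_derivative_iff)
  moreover have "((\<lambda>y. (g y - g e) / (y - e)) \<longlongrightarrow> 0) ?F"
    by (rule tendsto_eventually, rule eventually_mono[OF ev]) (simp add: ge)
  ultimately show "d = 0"
    using tendsto_unique[OF nt] by blast
qed

context asymptotic_graph
begin

lemma Ck_on_kappa: "Ck_on 2 kappa S"
  unfolding kappa_def
  by (intro Ck_on_divide Ck_on_minus Ck_on_mult Ck_on_const S Ck_on_psi Ck_on_pd[OF Ck_on_pd[OF f, of 3]])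
     (auto simp: psi_nonzero)

lemma Ck_on_third: "Ck_on 1 (pd i (pd j (pd k f))) S"
  by (rule Ck_on_pd[OF Ck_on_pd[OF Ck_on_pd[OF f, of 3], of 2]]) auto

lemma Ck_on_cubA: "Ck_on 1 cubA S"
  unfolding cubA_def cub_def power2_eq_square power3_eq_cube vector_2
  by (intro Ck_on_add Ck_on_mult Ck_on_const S Ck_on_third Ck_on_le[OF m] Ck_on_le[OF Ck_on_kappa]) auto

lemma Ck_on_cubB: "Ck_on 1 cubB S"
  unfolding cubB_def cub_def power2_eq_square power3_eq_cube vector_2
  by (intro Ck_on_add Ck_on_mult Ck_on_const S Ck_on_third Ck_on_le[OF m]) auto

text \<open>Where the line leaves the interior of the zero set of \<open>cubB\<close>, both \<open>cubA\<close> and its gradient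
  vanish, so that the polynomial of the preceding lemma has a double zero there. A nonzero
  quadratic polynomial has at most one double zero.\<close>

lemma asymptotic_line_one_sided:
  fixes x0 s0 :: real
  defines "L \<equiv> \<lambda>t. vector [x0 + t, s0 + t * m (vector [x0, s0])] :: real^2"
  assumes AB: "\<And>p. p \<in> S \<Longrightarrow> cubA p * cubB p = 0" and ab: "a \<le> 0" "0 \<le> b"
    and A0: "cubA (vector [x0, s0]) \<noteq> 0" and LS: "\<And>t. t \<in> {a..b} \<Longrightarrow> L t \<in> S"
  shows "(\<forall>t\<in>{0..b}. cubB (L t) = 0) \<or> (\<forall>t\<in>{a..0}. cubB (L t) = 0)"
proof (rule ccontr)
  assume "\<not> ?thesis"
  then obtain t1 t2 where t1: "t1 \<in> {0..b}" "cubB (L t1) \<noteq> 0" and t2: "t2 \<in> {a..0}" "cubB (L t2) \<noteq> 0"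
    by blast
  define V where "V = interior {p \<in> S. cubB p = 0}"
  have V: "open V" "V \<subseteq> S" "\<And>p. p \<in> V \<Longrightarrow> cubB p = 0"
    using interior_subset[of "{p \<in> S. cubB p = 0}"] by (auto simp: V_def)
  \<comment> \<open>Outside \<open>V\<close> every point is a limit of points with
    \<open>cubB\<close> nonzero: if \<open>G e\<close> were nonzero, \<open>cubB\<close> would
    vanish on a neighbourhood of \<open>e\<close>. Applied to \<open>cubA\<close> and to its partial
    derivatives.\<close>
  have van: "G e = 0" if "continuous_on S G" "\<And>p. p \<in> S \<Longrightarrow> cubB p \<noteq> 0 \<Longrightarrow> G p = 0" "e \<in> S" "e \<notin> V"
    for G :: "real^2 \<Rightarrow> real" and e
  proof (rule ccontr)
    assume "G e \<noteq> 0"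
    have "open (S \<inter> G -` (- {0}))"
      using continuous_open_preimage[OF that(1) S, of "- {0}"] by auto
    moreover have "S \<inter> G -` (- {0}) \<subseteq> {p \<in> S. cubB p = 0}"
      using that(2) by auto
    ultimately have "e \<in> V"
      unfolding V_def using \<open>G e \<noteq> 0\<close> that(3) by (intro interiorI) auto
    with that(4) show False by simp
  qed
  have "L 0 = vector [x0, s0]" by (simp add: L_def)
  have "L 0 \<in> S" using LS ab by simp
  have "L 0 \<in> V"
    using van[of cubA "L 0"] Ck_on_continuous[OF Ck_on_cubA] AB A0 \<open>L 0 \<in> S\<close> \<open>L 0 = _\<close> by auto
  have cL: "continuous (at t) L" for t
  proof -
    have "L = (\<lambda>t. vector [x0, s0] + t *\<^sub>R vector [1, m (vector [x0, s0])])"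
      by (simp add: L_def line_eq)
    then show ?thesis by (simp add: continuous_intros)
  qed
  have cl: "closed (L -` (- V))"
    using V(1) cL by (intro continuous_closed_vimage) auto
  have c1: "compact ({0..b} \<inter> L -` (- V))" and c2: "compact ({a..0} \<inter> L -` (- V))"
    using cl by (auto intro: compact_Int_closed)
  have "t1 \<in> {0..b} \<inter> L -` (- V)" "t2 \<in> {a..0} \<inter> L -` (- V)"
    using t1 t2 V(3) by auto
  then have "{0..b} \<inter> L -` (- V) \<noteq> {}" "{a..0} \<inter> L -` (- V) \<noteq> {}"
    by blast+
  \<comment> \<open>The first exits from \<open>V\<close> on the two sides; they exist because
    \<open>cubB\<close> is supposed to be nonzero somewhere on each side.\<close>
  from compact_attains_inf[OF c1 this(1)] compact_attains_sup[OF c2 this(2)]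
  obtain \<beta> \<alpha> where \<beta>: "\<beta> \<in> {0..b} \<inter> L -` (- V)" "\<And>t. t \<in> {0..b} \<inter> L -` (- V) \<Longrightarrow> \<beta> \<le> t"
    and \<alpha>: "\<alpha> \<in> {a..0} \<inter> L -` (- V)" "\<And>t. t \<in> {a..0} \<inter> L -` (- V) \<Longrightarrow> t \<le> \<alpha>"
    by blast
  have \<beta>0: "0 < \<beta>" and \<alpha>0: "\<alpha> < 0"
    using \<beta>(1) \<alpha>(1) \<open>L 0 \<in> V\<close> by (cases "\<beta> = 0"; cases "\<alpha> = 0"; auto)+
  have "L t \<in> V" if "t \<in> {\<alpha><..<\<beta>}" for t
  proof (cases "0 \<le> t")
    case True
    then show ?thesis using \<beta>(1) \<beta>(2)[of t] that by auto
  next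
    case False
    then show ?thesis using \<alpha>(1) \<alpha>(2)[of t] that by auto
  qed
  from cubA_polynomial[OF V \<alpha>0 \<beta>0 this[unfolded L_def]]
  obtain r0 r1 r2 k where r: "\<And>t. t \<in> {\<alpha><..<\<beta>} \<Longrightarrow> cubA (L t) * (1 + k * t)^4 = r0 + r1 * t + r2 * t\<^sup>2"
    unfolding L_def by blast
  define g where "g t = cubA (L t) * (1 + k * t)^4 - (r0 + r1 * t + r2 * t\<^sup>2)" for t
  have end_pt: "r0 + r1 * e + r2 * e\<^sup>2 = 0 \<and> r1 + 2 * r2 * e = 0" if e: "e = \<alpha> \<or> e = \<beta>" for e
  proof -
    have eS: "L e \<in> S" "L e \<notin> V" using e \<alpha>(1) \<beta>(1) ab LS by auto
    have A: "cubA (L e) = 0"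
      by (rule van[OF Ck_on_continuous[OF Ck_on_cubA] _ eS]) (use AB in auto)
    have W: "open (S \<inter> cubB -` (- {0}))"
      by (rule continuous_open_preimage[OF Ck_on_continuous[OF Ck_on_cubB] S]) auto
    \<comment> \<open>Near a point with \<open>cubB\<close> nonzero, \<open>cubA\<close> vanishes
      identically, hence so do its partial derivatives.\<close>
    have gr: "pd i cubA (L e) = 0" for i
    proof (rule van[OF _ _ eS])
      show "continuous_on S (pd i cubA)"
        by (rule Ck_on_continuous[OF Ck_on_pd[OF Ck_on_cubA, of 0]]) simp
      show "pd i cubA p = 0" if "p \<in> S" "cubB p \<noteq> 0" for p
        using pd_cong[OF W, of p cubA "\<lambda>p. 0" i] that AB by auto
    qed
    have "((\<lambda>t. x0 + t) has_real_derivative 1) (at e)"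
      "((\<lambda>t. s0 + t * m (vector [x0, s0])) has_real_derivative m (vector [x0, s0])) (at e)"
      by (auto intro!: derivative_eq_intros)
    from has_real_derivative_along_curve[OF _ this, of cubA] Ck_on_differentiable[OF Ck_on_cubA _ eS(1)] gr
    have "((\<lambda>t. cubA (L t)) has_real_derivative 0) (at e)"
      by (simp add: L_def)
    then have "(g has_real_derivative - (r1 + 2 * r2 * e)) (at e)"
      unfolding g_def using A by (auto intro!: derivative_eq_intros)
    from vanishing_at_interval_end[OF _ _ e this] \<alpha>0 \<beta>0 r A
    show ?thesis by (simp add: g_def)
  qed
  have r1: "r1 = - 2 * r2 * \<beta>"
    using end_pt[of \<beta>] by simp
  moreover have "r0 = r2 * \<beta>\<^sup>2"
    using end_pt[of \<beta>] unfolding r1 by (simp add: power2_eq_square algebra_simps)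
  ultimately have "r2 * (\<beta> - \<alpha>)\<^sup>2 = 0"
    using end_pt[of \<alpha>] by (simp add: power2_eq_square algebra_simps)
  then have "r0 = 0" using \<alpha>0 \<beta>0 \<open>r0 = _\<close> by simp
  then show False using r[of 0] A0 \<alpha>0 \<beta>0 by (simp add: L_def)
qed

lemma hess_kappa: "p \<in> S \<Longrightarrow> hess f p (vector [kappa p, 1 + kappa p * m p]) = 0"
proof -
  assume p: "p \<in> S"
  have "hess f p (vector [kappa p, 1 + kappa p * m p]) =
      pd 2 (pd 2 f) p + 2 * kappa p * psi p + (kappa p)\<^sup>2 * hess f p (vector [1, m p])"
    by (simp add: hess_def psi_def power2_eq_square algebra_simps)
  also have "\<dots> = 0"
    using quad[OF p] psi_nonzero[OF p] by (simp add: kappa_def)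
  finally show ?thesis .
qed

text \<open>With coefficients \<open>a\<close>, \<open>b\<close> in the basis of the two asymptotic
  directions, \<open>hess f p v\<close> is \<open>2 * a * b * psi p\<close>. A null vector is
  therefore a multiple of one of the two directions.\<close>

lemma cubA_cubB_zero:
  assumes p: "p \<in> S" and v: "v \<noteq> 0" "hess f p v = 0" "cub f p v = 0"
  shows "cubA p * cubB p = 0"
proof -
  define b where "b = v $ 2 - m p * v $ 1"
  define a where "a = v $ 1 - kappa p * b"
  have v1: "v $ 1 = a + b * kappa p" by (simp add: a_def)
  have v2: "v $ 2 = a * m p + b * (1 + kappa p * m p)" by (simp add: a_def b_def algebra_simps)
  have "hess f p v = a\<^sup>2 * hess f p (vector [1, m p]) + b\<^sup>2 * hess f p (vector [kappa p, 1 + kappa p * m p])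
      + 2 * a * b * (psi p + kappa p * hess f p (vector [1, m p]))"
    unfolding hess_def v1 v2 vector_2 psi_def by (simp add: power2_eq_square algebra_simps)
  then have "a = 0 \<or> b = 0"
    using v(2) quad[OF p] hess_kappa[OF p] psi_nonzero[OF p] by simp
  then show ?thesis
  proof
    assume "a = 0"
    then have "cub f p v = b^3 * cubA p"
      unfolding cubA_def cub_def v1 v2 vector_2 by (simp add: power2_eq_square power3_eq_cube algebra_simps)
    moreover have "b \<noteq> 0"
      using v(1) v1 v2 \<open>a = 0\<close> by (auto simp: vec_eq_iff forall_2)
    ultimately show ?thesis using v(3) by simp
  next
    assume "b = 0"
    then have "cub f p v = a^3 * cubB p"
      unfolding cubB_def cub_def v1 v2 vector_2 by (simp add: power2_eq_square power3_eq_cube algebra_simps)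
    moreover have "a \<noteq> 0"
      using v(1) v1 v2 \<open>b = 0\<close> by (auto simp: vec_eq_iff forall_2)
    ultimately show ?thesis using v(3) by simp
  qed
qed

end

section \<open>A segment through a given point of a graph\<close>

text \<open>The normalization at \<open>p\<close> makes the first axis asymptotic there and the
  Hessian determinant negative, so that near \<open>p\<close> one family has a smooth slope over the
  first axis and the other one over the second axis.\<close>

theorem graph_contains_segment:
  fixes f :: "real^2 \<Rightarrow> real"
  assumes S: "open S" "p \<in> S" and f: "Ck_on 4 f S"
    and p: "pd 1 (pd 1 f) p = 0" "0 < pd 2 (pd 1 f) p"
    and null: "\<And>q. q \<in> S \<Longrightarrow> \<exists>v. v \<noteq> 0 \<and> hess f q v = 0 \<and> cub f q v = 0"
  shows "\<exists>v \<delta> k. v \<noteq> 0 \<and> 0 < \<delta> \<and> (\<forall>t\<in>{0..\<delta>}. p + t *\<^sub>R v \<in> S \<and> f (p + t *\<^sub>R v) = f p + t * k)"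
proof -
  define D where "D q = pd 2 (pd 1 f) q * pd 2 (pd 1 f) q - pd 1 (pd 1 f) q * pd 2 (pd 2 f) q" for q
  have C2: "Ck_on 2 (pd i (pd j f)) S" for i j
    by (rule Ck_on_pd[OF Ck_on_pd[OF f, of 3]]) auto
  have CD: "Ck_on 2 D S" unfolding D_def by (intro Ck_on_intros C2 S)
  \<comment> \<open>The root of the quadratic for the slope with rationalized numerator; it remains
    defined where the coefficient of the square vanishes.\<close>
  define m where "m q = - pd 1 (pd 1 f) q / (pd 2 (pd 1 f) q + sqrt (D q))" for q
  have open_pos: "open {q \<in> T. 0 < G q}" if "open T" "continuous_on T G" for G :: "real^2 \<Rightarrow> real" and T
  proof -
    have "{q \<in> T. 0 < G q} = T \<inter> G -` {0<..}" by auto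
    then show ?thesis using continuous_open_preimage[OF that(2,1), of "{0<..}"] by simp
  qed
  define S1 where "S1 = {q \<in> {q \<in> S. 0 < pd 2 (pd 1 f) q}. 0 < D q}"
  have S1: "open S1" "S1 \<subseteq> S" "p \<in> S1"
  proof -
    show "open S1" unfolding S1_def
      by (rule open_pos[OF open_pos[OF S(1) Ck_on_continuous[OF C2]]
            continuous_on_subset[OF Ck_on_continuous[OF CD]]]) auto
  qed (use p S(2) in \<open>auto simp: S1_def D_def\<close>)
  have den: "0 < pd 2 (pd 1 f) q + sqrt (D q)" "0 < D q" if "q \<in> S1" for q
    using that by (auto simp: S1_def add_pos_pos)
  have Cm: "Ck_on 2 m S1"
    unfolding m_def
    by (rule Ck_on_divide[OF S1(1)])
       (use den in \<open>auto intro!: Ck_on_minus Ck_on_add Ck_on_sqrt S1(1) Ck_on_subset[OF C2 S1(2)] Ck_on_subset[OF CD S1(2)] simp: less_imp_neq[THEN not_sym]\<close>)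
  have psi: "pd 2 (pd 1 f) q + m q * pd 2 (pd 2 f) q = sqrt (D q)" if "q \<in> S1" for q
  proof -
    have "sqrt (D q) * sqrt (D q) = pd 2 (pd 1 f) q * pd 2 (pd 1 f) q - pd 1 (pd 1 f) q * pd 2 (pd 2 f) q"
      using den(2)[OF that] by (simp add: D_def)
    then show ?thesis
      using den(1)[OF that] unfolding m_def by (simp add: field_simps)
  qed
  have quad: "hess f q (vector [1, m q]) = 0" if "q \<in> S1" for q
  proof -
    have "hess f q (vector [1, m q]) = pd 1 (pd 1 f) q + m q * (pd 2 (pd 1 f) q + (pd 2 (pd 1 f) q + m q * pd 2 (pd 2 f) q))"
      by (simp add: hess_def power2_eq_square algebra_simps)
    also have "\<dots> = 0"
      unfolding psi[OF that] using den[OF that] by (simp add: m_def)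
    finally show ?thesis .
  qed
  interpret G1: asymptotic_graph S1 f m
    by standard (use S1 Cm quad psi den Ck_on_subset[OF f S1(2)] in auto)
  \<comment> \<open>The slope of the other family, taken over the second axis.\<close>
  define k where "k q = G1.kappa q / (1 + G1.kappa q * m q)" for q
  have mp: "m p = 0" using p by (simp add: m_def)
  \<comment> \<open>The first condition makes \<open>k\<close> well defined and smooth; the second
    bounds \<open>m\<close>, so that a line moves in the second coordinate by no more than in the
    first.\<close>
  define S2 where "S2 = {q \<in> {q \<in> S1. 0 < 1 + G1.kappa q * m q}. 0 < 1 / 4 - m q * m q}"
  have CkS1: "Ck_on 2 (\<lambda>q. 1 + G1.kappa q * m q) S1"
    by (intro Ck_on_intros S1 Cm G1.Ck_on_kappa)
  have S2: "open S2" "S2 \<subseteq> S1" "p \<in> S2"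
  proof -
    show "open S2" unfolding S2_def
      by (rule open_pos[OF open_pos[OF S1(1) Ck_on_continuous[OF CkS1]]])
         (auto intro!: continuous_intros continuous_on_subset[OF Ck_on_continuous[OF Cm]])
  qed (use S1 mp in \<open>auto simp: S2_def\<close>)
  have Ck2: "Ck_on 2 k S2"
    unfolding k_def
    by (rule Ck_on_divide[OF S2(1) _ Ck_on_subset[OF G1.Ck_on_kappa S2(2)] Ck_on_subset[OF CkS1 S2(2)]])
       (auto simp: S2_def)
  \<comment> \<open>The factor to be cancelled in the slope equation for \<open>k\<close>; at
    \<open>p\<close> it is the mixed derivative, which is positive.\<close>
  define S3 where "S3 = {q \<in> S2. 0 < pd 2 (pd 1 f) q + k q * pd 1 (pd 1 f) q}"
  have sub: "S2 \<subseteq> S" using S1 S2 by blast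
  have S3: "open S3" "S3 \<subseteq> S2" "p \<in> S3"
  proof -
    show "open S3" unfolding S3_def
      by (rule open_pos[OF S2(1)])
         (intro continuous_intros Ck_on_continuous[OF Ck2] continuous_on_subset[OF Ck_on_continuous[OF C2] sub])
  qed (use S2 p in \<open>auto simp: S3_def\<close>)
  have sub3: "S3 \<subseteq> S" "S3 \<subseteq> S1" using S1 S2 S3 by blast+
  interpret asymptotic_graph S3 f m
    by standard (use S3 sub3 quad psi den Ck_on_subset[OF f] Ck_on_subset[OF Cm] in auto)
  have AB: "cubA q * cubB q = 0" if "q \<in> S3" for q
    using null[of q] cubA_cubB_zero[OF that] that sub3 by blast
  have kpos: "0 < 1 + kappa q * m q" "\<bar>m q\<bar> < 1 / 2" if "q \<in> S3" for q
  proof -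
    have *: "q \<in> S2" using S3 that by blast
    then show "0 < 1 + kappa q * m q" by (simp add: S2_def)
    have "(m q)\<^sup>2 < (1/2)\<^sup>2" using * by (simp add: S2_def power2_eq_square)
    then show "\<bar>m q\<bar> < 1 / 2" using power2_less_imp_less[of "\<bar>m q\<bar>" "1/2"] by simp
  qed
  obtain e where e: "0 < e" "ball p e \<subseteq> S3" using S3 open_contains_ball by blast
  have pv: "vector [p $ 1, p $ 2] = p" by (simp add: vec_eq_iff forall_2)
  have goal: ?thesis
    if v: "v \<noteq> 0" "0 < \<delta>" "\<And>t. t \<in> {0..\<delta>} \<Longrightarrow> p + t *\<^sub>R v \<in> S3 \<and> hess f (p + t *\<^sub>R v) v = 0" for v \<delta>
  proof (intro exI conjI ballI)
    fix t assume t: "t \<in> {0..\<delta>}"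
    show "f (p + t *\<^sub>R v) = f p + t * (v $ 1 * pd 1 f p + v $ 2 * pd 2 f p)"
      by (rule affine_along_line[OF S3(1) _ _ v(3) t]) (use v(2) Ck_on_le[OF f] in auto)
  qed (use v sub3 in auto)
  show ?thesis
  proof (cases "\<exists>d>0. \<forall>q\<in>ball p d. cubA q = 0")
    case True
    then obtain d where d: "0 < d" "\<forall>q\<in>ball p d. cubA q = 0" by blast
    define d' where "d' = min d e"
    have d': "0 < d'" "ball p d' \<subseteq> S3" "\<And>q. q \<in> ball p d' \<Longrightarrow> cubA q = 0"
      using d e by (auto simp: d'_def)
    \<comment> \<open>The direction defining \<open>cubA\<close>, rescaled to second component 1.
      With the axes exchanged, the argument for the first family applies to it wherever
      \<open>cubA\<close> is zero.\<close>
    let ?w = "\<lambda>q. axis 2 1 + k q *\<^sub>R axis 1 1 :: real^2"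
    have w: "(?w q) $ 1 = k q" "(?w q) $ 2 = 1" for q
      by (simp_all add: axis_def)
    have scale: "vector [kappa q, 1 + kappa q * m q] = (1 + kappa q * m q) *\<^sub>R ?w q" if "q \<in> S3" for q
      using kpos(1)[OF that] unfolding vec_eq_iff forall_2 vector_scaleR_component w vector_2 by (simp add: k_def)
    have hw: "hess f q (?w q) = 0" if "q \<in> S3" for q
      using hess_kappa[OF that] kpos(1)[OF that] unfolding scale[OF that] hess_scaleR by simp
    have cw: "cub f q (?w q) = 0" if "q \<in> ball p d'" for q
    proof -
      have q: "q \<in> S3" using d' that by blast
      show ?thesis
        using d'(3)[OF that] kpos(1)[OF q] unfolding cubA_def scale[OF q] cub_scaleR by simp
    qed
    have slope: "pd 2 k q + k q * pd 1 k q = 0" if "q \<in> ball p d'" for q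
    proof -
      have q: "q \<in> S3" using d' that by blast
      have "0 < pd 2 (pd 1 f) q + k q * pd 1 (pd 1 f) q" using q by (simp add: S3_def)
      moreover have "cub f q (?w q) + 2 * (pd 2 k q + k q * pd 1 k q) * (pd 2 (pd 1 f) q + k q * pd 1 (pd 1 f) q) = 0"
        by (rule asymptotic_slope_equation[OF S3(1) _ _ _ q hw])
           (auto intro: Ck_on_le[OF f] Ck_on_le[OF Ck_on_subset[OF Ck2 S3(2)]])
      ultimately show ?thesis using cw[OF that] by auto
    qed
    define v where "v = ?w p"
    have v1: "v $ 2 = 1" unfolding v_def by (rule w(2))
    then have v0: "v \<noteq> 0" by auto
    define \<delta> where "\<delta> = d' / (2 * norm v)"
    have \<delta>: "0 < \<delta>" using d' v0 by (simp add: \<delta>_def)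
    have inb: "p + t *\<^sub>R v \<in> ball p d'" if "t \<in> {0..\<delta>}" for t
    proof -
      have "t * norm v \<le> \<delta> * norm v" using that by (intro mult_right_mono) auto
      also have "\<dots> < d'" using d' v0 by (simp add: \<delta>_def)
      finally show ?thesis using that by (simp add: dist_norm)
    qed
    have "k (p + t *\<^sub>R v) = k p" if "t \<in> {0..\<delta>}" for t
      unfolding v_def
      by (rule slope_constant[where a = 0 and b = \<delta>, OF _ Ck_on_le[OF Ck2]])
         (use that \<delta> slope[OF inb] subsetD[OF S3(2) subsetD[OF d'(2) inb]] in \<open>auto simp: v_def[symmetric]\<close>)
    then have "hess f (p + t *\<^sub>R v) v = 0" if "t \<in> {0..\<delta>}" for t
      using hw[of "p + t *\<^sub>R v"] inb[OF that] d'(2) that by (auto simp: v_def)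
    with goal[OF v0 \<delta>] inb d'(2) show ?thesis by blast
  next
    case False
    \<comment> \<open>A starting point within \<open>\<delta>\<close> of \<open>p\<close> and a
      displacement of at most \<open>2 * \<delta>\<close> stay inside the ball of radius
      \<open>e\<close>.\<close>
    define \<delta> where "\<delta> = e / 4"
    have \<delta>: "0 < \<delta>" using e by (simp add: \<delta>_def)
    let ?L = "\<lambda>q t. vector [q $ 1 + t, q $ 2 + t * m q] :: real^2"
    have inS: "?L q t \<in> S3" if "q \<in> ball p \<delta>" "\<bar>t\<bar> \<le> \<delta>" for q t
    proof -
      have "ball p \<delta> \<subseteq> S3" using e by (auto simp: \<delta>_def)
      then have "\<bar>m q\<bar> < 1 / 2" using kpos that(1) by blast
      then have "\<bar>t * m q\<bar> \<le> \<delta> * 1"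
        unfolding abs_mult using that(2) \<delta> by (intro mult_mono) auto
      have "?L q t = q + (t *\<^sub>R axis 1 1 + (t * m q) *\<^sub>R axis 2 1)"
        by (simp add: vec_eq_iff forall_2 axis_def)
      then have "dist (?L q t) q = norm (t *\<^sub>R axis 1 1 + (t * m q) *\<^sub>R (axis 2 1 :: real^2))"
        by (simp add: dist_norm)
      also have "\<dots> \<le> \<bar>t\<bar> + \<bar>t * m q\<bar>"
        by (rule norm_triangle_le) simp
      also have "\<dots> \<le> 2 * \<delta>" using that \<open>\<bar>t * m q\<bar> \<le> \<delta> * 1\<close> by simp
      finally have "dist p (?L q t) < e"
        using that(1) e(1) dist_triangle[of p "?L q t" q] by (simp add: \<delta>_def dist_commute)
      then show ?thesis using e by auto
    qed
    have one: "(\<forall>t\<in>{0..\<delta>}. cubB (?L q t) = 0) \<or> (\<forall>t\<in>{-\<delta>..0}. cubB (?L q t) = 0)"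
      if "q \<in> ball p \<delta>" "cubA q \<noteq> 0" for q
    proof -
      have "vector [q $ 1, q $ 2] = q" by (simp add: vec_eq_iff forall_2)
      then show ?thesis
        using asymptotic_line_one_sided[OF AB, of "-\<delta>" \<delta> "q $ 1" "q $ 2"] that(2) inS[OF that(1)] \<delta>
        by (simp add: abs_le_iff)
    qed
    have cont: "isCont (\<lambda>q. cubB (?L q t)) p" if "\<bar>t\<bar> \<le> \<delta>" for t
    proof -
      have "?L q t = q + t *\<^sub>R (axis 1 1 + m q *\<^sub>R axis 2 1)" for q
        by (simp add: vec_eq_iff forall_2 axis_def)
      moreover have "isCont m p"
        using Ck_on_continuous[OF Cm] S1 by (simp add: continuous_on_eq_continuous_at)
      ultimately have "isCont (\<lambda>q. ?L q t) p" by (simp add: continuous_intros)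
      moreover have "isCont cubB (?L p t)"
        using Ck_on_continuous[OF Ck_on_cubB] inS[of p t] that \<delta> S3 by (simp add: continuous_on_eq_continuous_at)
      ultimately show ?thesis using isCont_o2 by blast
    qed
    have pv': "p \<in> ball p \<delta>" using \<delta> by simp
    \<comment> \<open>If both halves failed at \<open>p\<close>, they would fail at the same
      parameters for all nearby starting points, among them one with \<open>cubA\<close>
      nonzero.\<close>
    have "(\<forall>t\<in>{0..\<delta>}. cubB (?L p t) = 0) \<or> (\<forall>t\<in>{-\<delta>..0}. cubB (?L p t) = 0)"
    proof (rule ccontr)
      assume "\<not> ?thesis"
      then obtain t1 t2 where t: "t1 \<in> {0..\<delta>}" "cubB (?L p t1) \<noteq> 0" "t2 \<in> {-\<delta>..0}" "cubB (?L p t2) \<noteq> 0"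
        by blast
      obtain e1 where e1: "0 < e1" "\<And>q. dist p q < e1 \<Longrightarrow> cubB (?L q t1) \<noteq> 0"
        using continuous_at_avoid[OF cont[of t1] t(2)] t \<delta> by auto
      obtain e2 where e2: "0 < e2" "\<And>q. dist p q < e2 \<Longrightarrow> cubB (?L q t2) \<noteq> 0"
        using continuous_at_avoid[OF cont[of t2] t(4)] t \<delta> by auto
      have "0 < min \<delta> (min e1 e2)" using \<delta> e1 e2 by simp
      then obtain q where "q \<in> ball p (min \<delta> (min e1 e2))" "cubA q \<noteq> 0" using False by blast
      then show False using one[of q] e1(2)[of q] e2(2)[of q] t by auto
    qed
    then show ?thesis
    proof
      assume B: "\<forall>t\<in>{0..\<delta>}. cubB (?L p t) = 0"
      let ?v = "vector [1, m p] :: real^2"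
      have Lp: "p + t *\<^sub>R ?v = ?L p t" for t by (simp add: vec_eq_iff forall_2)
      have "m (?L p t) = m p" if "t \<in> {0..\<delta>}" for t
        using slope_along_line[of 0 \<delta> t "p $ 1" "p $ 2", unfolded pv] that B inS[OF pv'] \<delta> by auto
      then have "hess f (p + t *\<^sub>R ?v) ?v = 0" if "t \<in> {0..\<delta>}" for t
        using G1.quad[of "?L p t"] inS[OF pv', of t] that sub3 unfolding Lp by auto
      moreover have "?v \<noteq> 0" by (simp add: vec_eq_iff forall_2)
      ultimately show ?thesis using goal[of ?v \<delta>] \<delta> inS[OF pv'] unfolding Lp by auto
    next
      assume B: "\<forall>t\<in>{-\<delta>..0}. cubB (?L p t) = 0"
      let ?v = "vector [-1, - m p] :: real^2"
      have Lp: "p + t *\<^sub>R ?v = ?L p (- t)" for t by (simp add: vec_eq_iff forall_2)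
      have sl: "m (?L p t) = m p" if "t \<in> {-\<delta>..0}" for t
        using slope_along_line[of "-\<delta>" 0 t "p $ 1" "p $ 2", unfolded pv] that B inS[OF pv'] \<delta> by auto
      have ev: "hess f q ?v = hess f q (vector [1, m p])" for q by (simp add: hess_def)
      have "hess f (p + t *\<^sub>R ?v) ?v = 0" if "t \<in> {0..\<delta>}" for t
        using G1.quad[of "?L p (-t)"] inS[OF pv', of "-t"] that sub3 sl[of "-t"] unfolding Lp ev by auto
      moreover have "?v \<noteq> 0" by (simp add: vec_eq_iff forall_2)
      moreover have "?L p (- t) \<in> S3" if "t \<in> {0..\<delta>}" for t
        using inS[OF pv', of "-t"] that by simp
      ultimately show ?thesis using goal[of ?v \<delta>] \<delta> unfolding Lp by blast
    qed
  qed
qed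

section \<open>Segments contained in a graph\<close>

lemma hess_along_line:
  fixes f :: "real^2 \<Rightarrow> real"
  assumes S: "open S" and f: "Ck_on 4 f S" and p: "p + t *\<^sub>R v \<in> S"
  shows "((\<lambda>t. f (p + t *\<^sub>R v)) has_real_derivative (v$1 * pd 1 f (p + t *\<^sub>R v) + v$2 * pd 2 f (p + t *\<^sub>R v))) (at t)"
    "((\<lambda>t. v$1 * pd 1 f (p + t *\<^sub>R v) + v$2 * pd 2 f (p + t *\<^sub>R v)) has_real_derivative hess f (p + t *\<^sub>R v) v) (at t)"
    "((\<lambda>t. hess f (p + t *\<^sub>R v) v) has_real_derivative cub f (p + t *\<^sub>R v) v) (at t)"
proof -
  let ?L = "\<lambda>t. p + t *\<^sub>R v"
  have dL: "(?L has_vector_derivative v) (at t)"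
    by (auto intro!: derivative_eq_intros)
  have d: "((\<lambda>t. F (?L t)) has_real_derivative v$1 * pd 1 F (?L t) + v$2 * pd 2 F (?L t)) (at t)"
    if "F differentiable (at (?L t))" for F :: "real^2 \<Rightarrow> real"
    using has_vector_derivative_along_curve[OF that dL] by (simp add: has_real_derivative_iff_has_vector_derivative)
  note df = Ck_on_differentiable[OF f _ p] Ck_on_differentiable[OF Ck_on_pd[OF f, of 3] _ p]
    Ck_on_differentiable[OF Ck_on_pd[OF Ck_on_pd[OF f, of 3], of 2] _ p]
  note c = third_pd_commute[OF S Ck_on_le[OF f, of 3, simplified] p]
  show "((\<lambda>t. f (?L t)) has_real_derivative (v$1 * pd 1 f (?L t) + v$2 * pd 2 f (?L t))) (at t)"
    by (rule d) (use df in simp)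
  have d1: "((\<lambda>t. pd i f (?L t)) has_real_derivative v$1 * pd 1 (pd i f) (?L t) + v$2 * pd 2 (pd i f) (?L t)) (at t)" for i
    by (rule d) (use df in simp)
  have d2: "((\<lambda>t. pd j (pd i f) (?L t)) has_real_derivative v$1 * pd 1 (pd j (pd i f)) (?L t) + v$2 * pd 2 (pd j (pd i f)) (?L t)) (at t)" for i j
    by (rule d) (use df in simp)
  from DERIV_add[OF DERIV_cmult[OF d1[of 1], of "v$1"] DERIV_cmult[OF d1[of 2], of "v$2"]]
  show "((\<lambda>t. v$1 * pd 1 f (?L t) + v$2 * pd 2 f (?L t)) has_real_derivative hess f (?L t) v) (at t)"
    by (rule DERIV_cong) (simp add: hess_def c power2_eq_square algebra_simps)
  from DERIV_add[OF DERIV_add[OF DERIV_cmult[OF d2[of 1 1], of "(v$1)\<^sup>2"] DERIV_cmult[OF d2[of 2 1], of "2 * v$1 * v$2"]]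
      DERIV_cmult[OF d2[of 2 2], of "(v$2)\<^sup>2"]]
  show "((\<lambda>t. hess f (?L t) v) has_real_derivative cub f (?L t) v) (at t)"
    unfolding hess_def by (rule DERIV_cong) (simp add: cub_def c power2_eq_square power3_eq_cube algebra_simps)
qed

text \<open>The given point may be an end point of its segment, so the derivative at 0 has to be
  obtained from the right.\<close>

lemma derivative_zero_half_open:
  fixes F F' :: "real \<Rightarrow> real"
  assumes "\<And>t. t \<in> {0<..<e} \<Longrightarrow> F t = 0" "\<And>t. t \<in> {0..<e} \<Longrightarrow> (F has_real_derivative F' t) (at t)" "t \<in> {0..<e}"
  shows "F' t = 0"
  by (rule vanishing_at_interval_end(2)[of t e F t]) (use assms in auto)

text \<open>\<open>hess\<close> and \<open>cub\<close> are the second and third derivatives of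
  \<open>f\<close> along the segment, on which \<open>f\<close> is affine.\<close>

lemma straight_segment_asymptotic:
  fixes f :: "real^2 \<Rightarrow> real"
  assumes S: "open S" and f: "Ck_on 4 f S" and e: "0 < e"
    and L: "\<And>t. t \<in> {0..<e} \<Longrightarrow> p + t *\<^sub>R v \<in> S \<and> f (p + t *\<^sub>R v) = f p + t * k"
  shows "hess f p v = 0" "cub f p v = 0"
proof -
  let ?L = "\<lambda>t. p + t *\<^sub>R v"
  have 1: "v$1 * pd 1 f (?L t) + v$2 * pd 2 f (?L t) - k = 0" if "t \<in> {0..<e}" for t
    by (rule derivative_zero_half_open[where F = "\<lambda>t. f (?L t) - (f p + t * k)", OF _ _ that])
       (use L in \<open>auto intro!: derivative_eq_intros hess_along_line(1)[OF S f]\<close>)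
  have 2: "hess f (?L t) v = 0" if "t \<in> {0..<e}" for t
    by (rule derivative_zero_half_open[where F = "\<lambda>t. v$1 * pd 1 f (?L t) + v$2 * pd 2 f (?L t) - k", OF _ _ that])
       (use 1 L DERIV_diff[OF hess_along_line(2)[OF S f] DERIV_const[of k]] in auto)
  have 3: "cub f (?L t) v = 0" if "t \<in> {0..<e}" for t
    by (rule derivative_zero_half_open[where F = "\<lambda>t. hess f (?L t) v", OF _ _ that])
       (use 2 L in \<open>auto intro!: hess_along_line(3)[OF S f]\<close>)
  show "hess f p v = 0" "cub f p v = 0"
    using 2[of 0] 3[of 0] e by auto
qed

section \<open>Cubic forms in the plane\<close>

text \<open>Total symmetry, written as rewrite rules towards ascending indices.\<close>

definition symmetric3 :: "(2 \<Rightarrow> 2 \<Rightarrow> 2 \<Rightarrow> real) \<Rightarrow> bool" where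
  "symmetric3 A \<longleftrightarrow> A 1 2 1 = A 1 1 2 \<and> A 2 1 1 = A 1 1 2 \<and> A 2 1 2 = A 1 2 2 \<and> A 2 2 1 = A 1 2 2"

text \<open>With \<open>c\<close> the Levi-Civita symbols, the inner sum is the covariant divergence
  of \<open>a\<close> minus the covariant derivative of its trace. Contracted with the parallel
  inverse metric \<open>g\<close>, both become the divergence of the trace of \<open>A\<close>,
  because \<open>A\<close> is totally symmetric. All derivatives are free numbers here, so this is
  pure algebra.\<close>

lemma trace_connection_terms_cancel:
  fixes g :: "2 \<Rightarrow> 2 \<Rightarrow> real" and A :: "2 \<Rightarrow> 2 \<Rightarrow> 2 \<Rightarrow> real" and dA :: "2 \<Rightarrow> 2 \<Rightarrow> 2 \<Rightarrow> 2 \<Rightarrow> real"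
    and c a :: "2 \<Rightarrow> 2 \<Rightarrow> 2 \<Rightarrow> real" and dg :: "2 \<Rightarrow> 2 \<Rightarrow> 2 \<Rightarrow> real" and da :: "2 \<Rightarrow> 2 \<Rightarrow> 2 \<Rightarrow> 2 \<Rightarrow> real"
  assumes g: "g 2 1 = g 1 2" and c: "\<And>k. c k 2 1 = c k 1 2"
    and A: "symmetric3 A" "\<And>l. symmetric3 (dA l)"
    and dg: "\<And>l k p. dg l k p = - (\<Sum>m\<in>UNIV. c k l m * g m p + c p l m * g k m)"
    and a: "\<And>k i j. a k i j = (\<Sum>p\<in>UNIV. g k p * A p i j)"
    and da: "\<And>l k i j. da l k i j = (\<Sum>p\<in>UNIV. dg l k p * A p i j + g k p * dA l p i j)"
  shows "(\<Sum>i\<in>UNIV. \<Sum>j\<in>UNIV. g i j * (\<Sum>k\<in>UNIV. da k k i j - da j k i k +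
     (\<Sum>l\<in>UNIV. c k k l * a l i j + a k k l * c l i j - c k j l * a l i k - a k j l * c l i k))) = 0"
proof -
  have s: "A 1 2 1 = A 1 1 2" "A 2 1 1 = A 1 1 2" "A 2 1 2 = A 1 2 2" "A 2 2 1 = A 1 2 2"
    "\<And>l. dA l 1 2 1 = dA l 1 1 2" "\<And>l. dA l 2 1 1 = dA l 1 1 2" "\<And>l. dA l 2 1 2 = dA l 1 2 2" "\<And>l. dA l 2 2 1 = dA l 1 2 2"
    using A by (auto simp: symmetric3_def)
  show ?thesis
    unfolding da a dg sum_2 g c s by (simp add: algebra_simps)
qed

definition trace3 :: "(2 \<Rightarrow> 2 \<Rightarrow> real) \<Rightarrow> (2 \<Rightarrow> 2 \<Rightarrow> 2 \<Rightarrow> real) \<Rightarrow> 2 \<Rightarrow> real" where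
  "trace3 g A l = (\<Sum>k\<in>UNIV. \<Sum>p\<in>UNIV. g k p * A p k l)"

text \<open>\<open>tchebychev_eq\<close> and \<open>pick_eq\<close> identify this and
  \<open>cubic_norm\<close> with the two relative invariants; the factor is the square of the 1/2 in
  the Tchebychev vector.\<close>

definition trace_norm :: "(2 \<Rightarrow> 2 \<Rightarrow> real) \<Rightarrow> (2 \<Rightarrow> 2 \<Rightarrow> 2 \<Rightarrow> real) \<Rightarrow> real" where
  "trace_norm g A = (1/4) * (\<Sum>k\<in>UNIV. \<Sum>q\<in>UNIV. g k q * (trace3 g A k * trace3 g A q))"

definition cubic_norm :: "(2 \<Rightarrow> 2 \<Rightarrow> real) \<Rightarrow> (2 \<Rightarrow> 2 \<Rightarrow> 2 \<Rightarrow> real) \<Rightarrow> real" where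
  "cubic_norm g A = (1/2) * (\<Sum>j\<in>UNIV. \<Sum>k\<in>UNIV. \<Sum>l\<in>UNIV. \<Sum>a\<in>UNIV. \<Sum>b\<in>UNIV. \<Sum>c\<in>UNIV.
        A j k l * (g j a * g k b * g l c * A a b c))"

text \<open>The first product contracts to the square of the trace of \<open>A\<close>, the second
  one to the square of \<open>A\<close>.\<close>

lemma quadratic_terms:
  assumes g: "g 2 1 = g 1 2" and A: "symmetric3 A"
    and a: "\<And>k i j. a k i j = (\<Sum>p\<in>UNIV. g k p * A p i j)"
  shows "(\<Sum>i\<in>UNIV. \<Sum>j\<in>UNIV. g i j * (\<Sum>k\<in>UNIV. \<Sum>l\<in>UNIV. a k k l * a l i j - a k j l * a l i k))
    = 4 * trace_norm g A - 2 * cubic_norm g A"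
proof -
  have s: "A 1 2 1 = A 1 1 2" "A 2 1 1 = A 1 1 2" "A 2 1 2 = A 1 2 2" "A 2 2 1 = A 1 2 2"
    using A by (auto simp: symmetric3_def)
  show ?thesis
    unfolding trace_norm_def cubic_norm_def trace3_def a sum_2 g s by (simp add: algebra_simps)
qed

definition form2 :: "(2 \<Rightarrow> 2 \<Rightarrow> real) \<Rightarrow> real^2 \<Rightarrow> real^2 \<Rightarrow> real" where
  "form2 G v w = (\<Sum>i\<in>UNIV. \<Sum>j\<in>UNIV. G i j * v $ i * w $ j)"

definition form3 :: "(2 \<Rightarrow> 2 \<Rightarrow> 2 \<Rightarrow> real) \<Rightarrow> real^2 \<Rightarrow> real" where
  "form3 A w = (\<Sum>i\<in>UNIV. \<Sum>j\<in>UNIV. \<Sum>k\<in>UNIV. A i j k * w $ i * w $ j * w $ k)"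

text \<open>In a basis of null vectors the trace part of a cubic form has the mixed coefficients, and the
  two pure coefficients measure the trace-free part.\<close>

lemma trace_norm_cubic_norm_null_basis:
  fixes F :: real and w v :: "real^2"
  assumes A: "symmetric3 A" and F: "F \<noteq> 0"
    and g: "\<And>i j. g i j = (w $ i * v $ j + v $ i * w $ j) / F"
  shows "3 * trace_norm g A - 2 * cubic_norm g A = - 2 * form3 A w * form3 A v / F^3"
proof -
  have s: "A 1 2 1 = A 1 1 2" "A 2 1 1 = A 1 1 2" "A 2 1 2 = A 1 2 2" "A 2 2 1 = A 1 2 2"
    using A by (auto simp: symmetric3_def)
  define w1 w2 v1 v2 where "w1 = w $ 1" "w2 = w $ 2" "v1 = v $ 1" "v2 = v $ 2"
  define f where "f = 1 / F"
  have g': "g 1 1 = 2 * w1 * v1 * f" "g 1 2 = (w1 * v2 + v1 * w2) * f" "g 2 1 = (w1 * v2 + v1 * w2) * f" "g 2 2 = 2 * w2 * v2 * f"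
    unfolding g by (simp_all add: f_def w1_w2_v1_v2_def)
  have "3 * trace_norm g A - 2 * cubic_norm g A = - 2 * form3 A w * form3 A v * f^3"
    unfolding trace_norm_def cubic_norm_def trace3_def form3_def sum_2 g' s w1_w2_v1_v2_def[symmetric]
    by (simp add: algebra_simps power3_eq_cube)
  then show ?thesis by (simp add: f_def power_one_over divide_simps)
qed

lemma null_vector_exists:
  assumes "G 1 1 * G 2 2 - G 1 2 * G 1 2 < 0" "G 2 1 = G 1 2"
  shows "\<exists>w. w \<noteq> 0 \<and> form2 G w w = 0"
proof (cases "G 1 1 = 0")
  case True
  then have "form2 G (axis 1 1) (axis 1 1) = 0" by (simp add: form2_def sum_2 axis_def)
  then show ?thesis by (metis axis_eq_0_iff zero_neq_one)
next
  case False
  define r where "r = sqrt (G 1 2 * G 1 2 - G 1 1 * G 2 2)"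
  have r: "r * r = G 1 2 * G 1 2 - G 1 1 * G 2 2" using assms(1) by (simp add: r_def)
  have "form2 G (vector [- G 1 2 + r, G 1 1]) (vector [- G 1 2 + r, G 1 1]) = G 1 1 * (r * r - (G 1 2 * G 1 2 - G 1 1 * G 2 2))"
    by (simp add: form2_def sum_2 assms(2) algebra_simps)
  then show ?thesis
    using False r by (intro exI[of _ "vector [- G 1 2 + r, G 1 1]"]) (simp add: vec_eq_iff forall_2)
qed

lemma null_vector_completion:
  assumes det: "G 1 1 * G 2 2 - G 1 2 * G 1 2 \<noteq> 0" and s: "G 2 1 = G 1 2" and w: "w \<noteq> 0" "form2 G w w = 0"
  shows "\<exists>v. form2 G v v = 0 \<and> form2 G w v \<noteq> 0"
proof -
  have "\<exists>u. form2 G w u \<noteq> 0"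
  proof (rule ccontr)
    assume "\<not> ?thesis"
    then have "form2 G w (axis 1 1) = 0" "form2 G w (axis 2 1) = 0" by auto
    then have e: "G 1 1 * w $ 1 + G 1 2 * w $ 2 = 0" "G 1 2 * w $ 1 + G 2 2 * w $ 2 = 0"
      by (simp_all add: form2_def sum_2 axis_def s)
    have "(G 1 1 * G 2 2 - G 1 2 * G 1 2) * w $ 1 = G 2 2 * (G 1 1 * w $ 1 + G 1 2 * w $ 2) - G 1 2 * (G 1 2 * w $ 1 + G 2 2 * w $ 2)"
      "(G 1 1 * G 2 2 - G 1 2 * G 1 2) * w $ 2 = G 1 1 * (G 1 2 * w $ 1 + G 2 2 * w $ 2) - G 1 2 * (G 1 1 * w $ 1 + G 1 2 * w $ 2)"
      by (simp_all add: algebra_simps)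
    then show False using e det w(1) by (simp add: vec_eq_iff forall_2)
  qed
  then obtain u where u: "form2 G w u \<noteq> 0" by blast
  \<comment> \<open>Adding a multiple of the null vector \<open>w\<close> to \<open>u\<close>
    changes \<open>form2 G u u\<close> linearly and leaves \<open>form2 G w u\<close> alone; this
    multiple makes the sum null.\<close>
  define t where "t = - form2 G u u / (2 * form2 G w u)"
  have "form2 G (u + t *\<^sub>R w) (u + t *\<^sub>R w) = form2 G u u + 2 * t * form2 G w u + t * t * form2 G w w"
    "form2 G w (u + t *\<^sub>R w) = form2 G w u + t * form2 G w w"
    by (simp_all add: form2_def sum_2 s algebra_simps)
  then have "form2 G (u + t *\<^sub>R w) (u + t *\<^sub>R w) = 0" "form2 G w (u + t *\<^sub>R w) \<noteq> 0"
    using u w(2) by (simp_all add: t_def)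
  then show ?thesis by blast
qed

text \<open>In a null basis the form has only the off-diagonal entry \<open>form2 G w v\<close>, so
  its inverse has only the reciprocal there. In the proof \<open>p1\<close>, \<open>p2\<close> and
  \<open>q1\<close>, \<open>q2\<close> are the covectors dual to \<open>w\<close> and
  \<open>v\<close> under \<open>G\<close>, which \<open>g\<close> maps back.\<close>

lemma inverse_form_null_basis:
  fixes w v :: "real^2"
  assumes s: "G 2 1 = G 1 2" "g 2 1 = g 1 2" and w: "form2 G w w = 0" "form2 G v v = 0" "form2 G w v \<noteq> 0"
    and inv: "\<And>i j. (\<Sum>k\<in>UNIV. g i k * G k j) = (if i = j then 1 else 0)"
  shows "g i j = (w $ i * v $ j + v $ i * w $ j) / form2 G w v"
proof -
  define F where "F = form2 G w v"
  define w1 w2 v1 v2 where "w1 = w $ 1" "w2 = w $ 2" "v1 = v $ 1" "v2 = v $ 2"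
  note W = w1_w2_v1_v2_def
  define p1 p2 q1 q2 where "p1 = G 1 1 * w1 + G 1 2 * w2" "p2 = G 1 2 * w1 + G 2 2 * w2"
    "q1 = G 1 1 * v1 + G 1 2 * v2" "q2 = G 1 2 * v1 + G 2 2 * v2"
  note P = p1_p2_q1_q2_def
  have e: "p1 * w1 + p2 * w2 = 0" "q1 * v1 + q2 * v2 = 0" "p1 * v1 + p2 * v2 = F" "q1 * w1 + q2 * w2 = F"
    using w unfolding F_def form2_def sum_2 s P W by (simp_all add: algebra_simps)
  have d: "g 1 1 * G 1 1 + g 1 2 * G 1 2 = 1" "g 1 1 * G 1 2 + g 1 2 * G 2 2 = 0"
    "g 1 2 * G 1 1 + g 2 2 * G 1 2 = 0" "g 1 2 * G 1 2 + g 2 2 * G 2 2 = 1"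
    using inv[of 1 1] inv[of 1 2] inv[of 2 1] inv[of 2 2] s by (simp_all add: sum_2)
  have gp: "g 1 1 * p1 + g 1 2 * p2 = w1" "g 1 2 * p1 + g 2 2 * p2 = w2" "g 1 1 * q1 + g 1 2 * q2 = v1" "g 1 2 * q1 + g 2 2 * q2 = v2"
  proof -
    have "g 1 1 * p1 + g 1 2 * p2 = (g 1 1 * G 1 1 + g 1 2 * G 1 2) * w1 + (g 1 1 * G 1 2 + g 1 2 * G 2 2) * w2"
      "g 1 2 * p1 + g 2 2 * p2 = (g 1 2 * G 1 1 + g 2 2 * G 1 2) * w1 + (g 1 2 * G 1 2 + g 2 2 * G 2 2) * w2"
      "g 1 1 * q1 + g 1 2 * q2 = (g 1 1 * G 1 1 + g 1 2 * G 1 2) * v1 + (g 1 1 * G 1 2 + g 1 2 * G 2 2) * v2"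
      "g 1 2 * q1 + g 2 2 * q2 = (g 1 2 * G 1 1 + g 2 2 * G 1 2) * v1 + (g 1 2 * G 1 2 + g 2 2 * G 2 2) * v2"
      unfolding P by (simp_all add: algebra_simps)
    then show "g 1 1 * p1 + g 1 2 * p2 = w1" "g 1 2 * p1 + g 2 2 * p2 = w2" "g 1 1 * q1 + g 1 2 * q2 = v1" "g 1 2 * q1 + g 2 2 * q2 = v2"
      using d by simp_all
  qed
  have F0: "F \<noteq> 0" using w(3) by (simp add: F_def)
  define D where "D = p1 * q2 - p2 * q1"
  have D: "D * w1 = - p2 * F" "D * w2 = p1 * F" "D * v1 = q2 * F" "D * v2 = - q1 * F"
    using e unfolding D_def by algebra+
  have D0: "D \<noteq> 0"
    using D F0 e by (metis mult_eq_0_iff neg_equal_0_iff_equal add_0)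
  have "F * g 1 1 = 2 * w1 * v1" "F * g 1 2 = w1 * v2 + v1 * w2" "F * g 2 2 = 2 * w2 * v2"
  proof -
    have "D * (F * g 1 1) = D * (2 * w1 * v1)" "D * (F * g 1 2) = D * (w1 * v2 + v1 * w2)" "D * (F * g 2 2) = D * (2 * w2 * v2)"
      using D gp e unfolding D_def by algebra+
    then show "F * g 1 1 = 2 * w1 * v1" "F * g 1 2 = w1 * v2 + v1 * w2" "F * g 2 2 = 2 * w2 * v2"
      using D0 by simp_all
  qed
  then show ?thesis
    using exhaust_2[of i] exhaust_2[of j] s(2) F0
    unfolding F_def[symmetric] by (auto simp: W field_simps)
qed

lemma norms_proportional_iff:
  assumes s: "G 2 1 = G 1 2" "g 2 1 = g 1 2" and det: "G 1 1 * G 2 2 - G 1 2 * G 1 2 < 0"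
    and inv: "\<And>i j. (\<Sum>k\<in>UNIV. g i k * G k j) = (if i = j then 1 else 0)"
    and A: "symmetric3 A"
  shows "3 * trace_norm g A = 2 * cubic_norm g A \<longleftrightarrow> (\<exists>w. w \<noteq> 0 \<and> form2 G w w = 0 \<and> form3 A w = 0)"
proof
  assume eq: "3 * trace_norm g A = 2 * cubic_norm g A"
  obtain w where w: "w \<noteq> 0" "form2 G w w = 0" using null_vector_exists[OF det s(1)] by blast
  obtain v where v: "form2 G v v = 0" "form2 G w v \<noteq> 0"
    using null_vector_completion[OF _ s(1) w] det by auto
  have "v \<noteq> 0" using v(2) by (auto simp: form2_def)
  have "form3 A w * form3 A v = 0"
    using trace_norm_cubic_norm_null_basis[OF A v(2) inverse_form_null_basis[OF s w(2) v inv]] eq v(2) by simp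
  with w v(1) \<open>v \<noteq> 0\<close> show "\<exists>w. w \<noteq> 0 \<and> form2 G w w = 0 \<and> form3 A w = 0"
    by auto
next
  assume "\<exists>w. w \<noteq> 0 \<and> form2 G w w = 0 \<and> form3 A w = 0"
  then obtain w where w: "w \<noteq> 0" "form2 G w w = 0" "form3 A w = 0" by blast
  obtain v where v: "form2 G v v = 0" "form2 G w v \<noteq> 0"
    using null_vector_completion[OF _ s(1) w(1,2)] det by auto
  show "3 * trace_norm g A = 2 * cubic_norm g A"
    using trace_norm_cubic_norm_null_basis[OF A v(2) inverse_form_null_basis[OF s w(2) v inv]] w(3) by simp
qed

section \<open>The relative theorema egregium\<close>

lemma pd_diff:
  assumes "f differentiable (at u)" "g differentiable (at u)"
  shows "pd i (\<lambda>v. f v - g v) u = pd i f u - pd i g u"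
  by (rule pd_eq[OF has_derivative_diff[OF frechet_derivative_works[THEN iffD1, OF assms(1)]
      frechet_derivative_works[THEN iffD1, OF assms(2)]], folded pd_def])

lemmas pd_inner = pd_bilinear[OF bounded_bilinear_inner]
lemmas pd_scaleR = pd_bilinear[OF bounded_bilinear_scaleR]
lemmas differentiable_inner' = differentiable_bilinear[OF bounded_bilinear_inner _ _ refl]

lemma matrix_inv_inverse:
  fixes A :: "real^'n^'n"
  assumes "det A \<noteq> 0"
  shows "A ** matrix_inv A = mat 1" "matrix_inv A ** A = mat 1"
proof -
  have "\<exists>B. A ** B = mat 1 \<and> B ** A = mat 1"
    using assms unfolding invertible_det_nz[symmetric] invertible_def .
  from someI_ex[OF this] show "A ** matrix_inv A = mat 1" "matrix_inv A ** A = mat 1"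
    by (simp_all add: matrix_inv_def)
qed

lemma det_first_form: "det (first_form x u) = (norm (pd 1 x u \<times> pd 2 x u))\<^sup>2"
  unfolding norm_cross
  by (simp add: det_2 first_form_def power2_norm_eq_inner inner_commute) (simp add: power2_eq_square)

locale rel_chart =
  fixes U :: "(real^2) set" and x y :: "real^2 \<Rightarrow> real^3"
  assumes U: "open U" and x4: "Ck_on 4 x U" and y1: "Ck_on 1 y U"
    and curv: "\<And>u. u \<in> U \<Longrightarrow> gauss_curvature x u < 0"
    and distinct: "\<And>u. u \<in> U \<Longrightarrow> distinct [pd 1 x u, pd 2 x u, y u]"
    and independent: "\<And>u. u \<in> U \<Longrightarrow> independent {pd 1 x u, pd 2 x u, y u}"
    and tangential: "\<And>u i. u \<in> U \<Longrightarrow> pd i y u \<in> span {pd 1 x u, pd 2 x u}"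
begin

abbreviation X where "X \<equiv> conormal x y"
abbreviation gm where "gm i j u \<equiv> rel_metric x y u $ i $ j"
abbreviation gi where "gi i j u \<equiv> matrix_inv (rel_metric x y u) $ i $ j"
abbreviation Gam where "Gam \<equiv> christoffel (rel_metric x y)"

definition N where "N u = pd 1 x u \<times> pd 2 x u"

lemma support_nonzero: "u \<in> U \<Longrightarrow> support x y u \<noteq> 0"
  using conormal_characterization(1)[of x u y] distinct independent by blast

lemma X_tangent [simp]: "X u \<bullet> pd i x u = 0" and X_y [simp]: "X u \<bullet> y u = 1" if "u \<in> U"
  using conormal_characterization(2)[of x u y "X u"] distinct[OF that] independent[OF that] by auto

lemma N_y_nonzero: "u \<in> U \<Longrightarrow> N u \<bullet> y u \<noteq> 0"
  using support_nonzero[of u] by (auto simp: support_def unit_normal_def N_def Let_def)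

lemma X_eq: "u \<in> U \<Longrightarrow> X u = inverse (N u \<bullet> y u) *\<^sub>R N u"
  using N_y_nonzero[of u] by (auto simp: conormal_def support_def unit_normal_def N_def Let_def)

lemma Cx: "Ck_on 3 (pd i x) U" "Ck_on 2 (pd j (pd i x)) U" "Ck_on 1 (pd k (pd j (pd i x))) U"
proof -
  show *: "Ck_on 3 (pd i x) U" for i by (rule Ck_on_pd[OF x4]) simp
  show **: "Ck_on 2 (pd j (pd i x)) U" for i j by (rule Ck_on_pd[OF *]) simp
  show "Ck_on 1 (pd k (pd j (pd i x))) U" by (rule Ck_on_pd[OF **]) simp
qed

lemma CN: "Ck_on 3 N U"
  unfolding N_def by (intro Ck_on_cross3 U Cx)

text \<open>The support function is one degree smoother than \<open>y\<close>, because its derivatives do not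
  involve those of \<open>y\<close>.\<close>

lemma CX: "Ck_on 2 X U"
proof -
  let ?Q = "\<lambda>u. N u \<bullet> y u"
  have d: "N differentiable (at u)" "y differentiable (at u)" if "u \<in> U" for u
    using Ck_on_differentiable[OF CN _ that] Ck_on_differentiable[OF y1 _ that] by auto
  have dQ: "pd i ?Q u = pd i N u \<bullet> y u" if "u \<in> U" for u i
  proof -
    have "orthogonal (N u) (pd i y u)"
      by (rule orthogonal_to_span[OF tangential[OF that]]) (auto simp: N_def orthogonal_def dot_cross_self)
    then show ?thesis using pd_inner[OF d[OF that]] by (simp add: orthogonal_def)
  qed
  have "Ck_on 1 (\<lambda>u. pd i N u \<bullet> y u) U" for i
    by (intro Ck_on_inner U y1 Ck_on_pd[OF CN]) simp
  then have "Ck_on 1 (pd i ?Q) U" for i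
    by (rule Ck_on_cong[OF U, rotated]) (simp add: dQ)
  moreover have "?Q differentiable (at u)" if "u \<in> U" for u
    using differentiable_inner' d[OF that] by blast
  ultimately have "Ck_on (Suc 1) ?Q U"
    using Ck_on.simps(2) by blast
  then have "Ck_on 2 ?Q U" by (simp add: numeral_2_eq_2)
  then have "Ck_on 2 (\<lambda>u. inverse (?Q u) *\<^sub>R N u) U"
    by (intro Ck_on_scaleR Ck_on_inverse U Ck_on_le[OF CN]) (auto simp: N_y_nonzero)
  then show ?thesis
    by (rule Ck_on_cong[OF U, rotated]) (simp add: X_eq)
qed

lemma gm_eq: "gm i j u = X u \<bullet> pd j (pd i x) u"
  by (simp add: rel_metric_def)

lemma Cgm: "Ck_on 2 (gm i j) U"
  unfolding gm_eq by (intro Ck_on_inner U CX Cx)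

lemma diffs:
  assumes "u \<in> U"
  shows "x differentiable (at u)" "pd i x differentiable (at u)" "pd j (pd i x) differentiable (at u)"
    "pd k (pd j (pd i x)) differentiable (at u)"
    "X differentiable (at u)" "pd i X differentiable (at u)" "gm i j differentiable (at u)"
    "pd k (gm i j) differentiable (at u)" "y differentiable (at u)"
  using Ck_on_differentiable[OF x4 _ assms] Ck_on_differentiable[OF Cx(1) _ assms]
    Ck_on_differentiable[OF Cx(2) _ assms] Ck_on_differentiable[OF Cx(3) _ assms]
    Ck_on_differentiable[OF CX _ assms] Ck_on_differentiable[OF Cgm _ assms]
    Ck_on_differentiable[OF Ck_on_pd[OF CX, of 1] _ assms] Ck_on_differentiable[OF Ck_on_pd[OF Cgm, of 1] _ assms]
    Ck_on_differentiable[OF y1 _ assms]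
  by auto

lemma x_commute:
  assumes "u \<in> U"
  shows "pd j (pd i x) u = pd i (pd j x) u" "pd k (pd j (pd i x)) u = pd k (pd i (pd j x)) u"
    "pd k (pd j (pd i x)) u = pd j (pd k (pd i x)) u"
proof -
  have *: "pd j (pd i x) u = pd i (pd j x) u" if "u \<in> U" for u i j
    by (rule pd_commute[OF U Ck_on_le[OF x4] that]) simp
  show "pd j (pd i x) u = pd i (pd j x) u" using *[OF assms] .
  show "pd k (pd j (pd i x)) u = pd k (pd i (pd j x)) u"
    by (rule pd_cong[OF U assms]) (rule *)
  show "pd k (pd j (pd i x)) u = pd j (pd k (pd i x)) u"
    by (rule pd_commute[OF U Ck_on_le[OF Cx(1)] assms]) simp
qed

lemma gm_sym: "u \<in> U \<Longrightarrow> gm i j u = gm j i u"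
  using x_commute(1)[of u i j] by (simp add: gm_eq)

lemma dgm_sym: "u \<in> U \<Longrightarrow> pd l (gm i j) u = pd l (gm j i) u"
  by (rule pd_cong[OF U]) (auto intro: gm_sym)

lemma det_gm:
  assumes u: "u \<in> U"
  shows "gm 1 1 u * gm 2 2 u - gm 1 2 u * gm 1 2 u < 0" "det (rel_metric x y u) \<noteq> 0"
proof -
  have N0: "N u \<noteq> 0" using N_y_nonzero[OF u] by auto
  have "0 < det (first_form x u)"
    using N0 by (simp add: det_first_form N_def[symmetric])
  then have neg: "det (second_form x u) < 0"
    using curv[OF u] by (simp add: gauss_curvature_def divide_less_0_iff)
  have *: "gm i j u = second_form x u $ i $ j / support x y u" for i j
    by (simp add: gm_eq second_form_def conormal_def divide_inverse mult.commute)
  have "det (rel_metric x y u) = det (second_form x u) / (support x y u)\<^sup>2"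
    unfolding det_2 * using support_nonzero[OF u] by (simp add: field_simps power2_eq_square)
  then have "det (rel_metric x y u) < 0"
    using neg support_nonzero[OF u] by (simp add: divide_less_0_iff)
  then show "det (rel_metric x y u) \<noteq> 0" "gm 1 1 u * gm 2 2 u - gm 1 2 u * gm 1 2 u < 0"
    using gm_sym[OF u, of 2 1] by (auto simp: det_2)
qed

lemma gi_gm: "u \<in> U \<Longrightarrow> (\<Sum>k\<in>UNIV. gi i k u * gm k j u) = (if i = j then 1 else 0)"
  using arg_cong[OF matrix_inv_inverse(2)[OF det_gm(2)], of u "\<lambda>M. M $ i $ j"]
  by (simp add: matrix_matrix_mult_def mat_def)

lemma gm_gi: "u \<in> U \<Longrightarrow> (\<Sum>k\<in>UNIV. gm i k u * gi k j u) = (if i = j then 1 else 0)"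
  using arg_cong[OF matrix_inv_inverse(1)[OF det_gm(2)], of u "\<lambda>M. M $ i $ j"]
  by (simp add: matrix_matrix_mult_def mat_def)

text \<open>Cramer's rule; \<open>matrix_inv\<close> is defined by choice, and its smoothness and
  symmetry are read off from these quotients.\<close>

lemma gi_explicit:
  assumes u: "u \<in> U"
  shows "gi 1 1 u = gm 2 2 u / (gm 1 1 u * gm 2 2 u - gm 1 2 u * gm 1 2 u)"
    "gi 1 2 u = - gm 1 2 u / (gm 1 1 u * gm 2 2 u - gm 1 2 u * gm 1 2 u)"
    "gi 2 1 u = - gm 1 2 u / (gm 1 1 u * gm 2 2 u - gm 1 2 u * gm 1 2 u)"
    "gi 2 2 u = gm 1 1 u / (gm 1 1 u * gm 2 2 u - gm 1 2 u * gm 1 2 u)"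
proof -
  let ?d = "gm 1 1 u * gm 2 2 u - gm 1 2 u * gm 1 2 u"
  have e: "gi 1 1 u * gm 1 1 u + gi 1 2 u * gm 1 2 u = 1" "gi 1 1 u * gm 1 2 u + gi 1 2 u * gm 2 2 u = 0"
    "gi 2 1 u * gm 1 1 u + gi 2 2 u * gm 1 2 u = 0" "gi 2 1 u * gm 1 2 u + gi 2 2 u * gm 2 2 u = 1"
    using gi_gm[OF u, of 1 1] gi_gm[OF u, of 1 2] gi_gm[OF u, of 2 1] gi_gm[OF u, of 2 2] gm_sym[OF u, of 2 1]
    by (simp_all add: sum_2)
  have "gi 1 1 u * ?d = gm 2 2 u" "gi 1 2 u * ?d = - gm 1 2 u" "gi 2 1 u * ?d = - gm 1 2 u" "gi 2 2 u * ?d = gm 1 1 u"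
    using e by algebra+
  then show "gi 1 1 u = gm 2 2 u / ?d" "gi 1 2 u = - gm 1 2 u / ?d" "gi 2 1 u = - gm 1 2 u / ?d" "gi 2 2 u = gm 1 1 u / ?d"
    using det_gm(1)[OF u] by (metis nonzero_eq_divide_eq less_irrefl)+
qed

lemma gi_sym: "u \<in> U \<Longrightarrow> gi i j u = gi j i u"
  using exhaust_2[of i] exhaust_2[of j] gi_explicit[of u] by auto

lemma Cgi: "Ck_on 2 (gi i j) U"
proof -
  let ?d = "\<lambda>u. gm 1 1 u * gm 2 2 u - gm 1 2 u * gm 1 2 u"
  have Cd: "Ck_on 2 ?d U" by (intro Ck_on_diff Ck_on_mult U Cgm)
  have C: "Ck_on 2 (\<lambda>u. gm i j u / ?d u) U" "Ck_on 2 (\<lambda>u. - gm i j u / ?d u) U" for i j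
    by (intro Ck_on_divide Ck_on_minus U Cgm Cd; use det_gm(1) in fastforce)+
  have "Ck_on 2 (gi 1 1) U" "Ck_on 2 (gi 1 2) U" "Ck_on 2 (gi 2 1) U" "Ck_on 2 (gi 2 2) U"
    by (rule Ck_on_cong[OF U _ C(1)[of 2 2]] Ck_on_cong[OF U _ C(2)[of 1 2]] Ck_on_cong[OF U _ C(1)[of 1 1]];
        simp add: gi_explicit)+
  then show ?thesis using exhaust_2[of i] exhaust_2[of j] by auto
qed

lemma dX_tangent:
  assumes "u \<in> U"
  shows "pd l X u \<bullet> pd i x u = - gm i l u"
proof -
  have "pd l (\<lambda>v. X v \<bullet> pd i x v) u = pd l (\<lambda>v. 0) u"
    by (rule pd_cong[OF U assms]) simp
  then show ?thesis
    using pd_inner[OF diffs(5)[OF assms] diffs(2)[OF assms], of l i] by (simp add: gm_eq)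
qed

lemma X_dy: "u \<in> U \<Longrightarrow> X u \<bullet> pd l y u = 0"
proof -
  assume u: "u \<in> U"
  have "orthogonal (X u) (pd l y u)"
    by (rule orthogonal_to_span[OF tangential[OF u]]) (use u in \<open>auto simp: orthogonal_def\<close>)
  then show ?thesis by (simp add: orthogonal_def)
qed

lemma dX_y:
  assumes "u \<in> U"
  shows "pd l X u \<bullet> y u = 0"
proof -
  have "pd l (\<lambda>v. X v \<bullet> y v) u = pd l (\<lambda>v. 1) u"
    by (rule pd_cong[OF U assms]) simp
  then show ?thesis
    using pd_inner[OF diffs(5)[OF assms] diffs(9)[OF assms], of l] X_dy[OF assms] by simp
qed

lemma dgm:
  assumes "u \<in> U"
  shows "pd l (gm i j) u = pd l X u \<bullet> pd j (pd i x) u + X u \<bullet> pd l (pd j (pd i x)) u"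
  unfolding gm_eq using pd_inner[OF diffs(5)[OF assms] diffs(3)[OF assms]] by (simp add: add.commute)

lemma Gam_eq: "Gam k i j u = (1/2) * (\<Sum>l\<in>UNIV. gi k l u * (pd i (gm j l) u + pd j (gm i l) u - pd l (gm i j) u))"
  by (simp add: christoffel_def)

lemma Gam_sym: "u \<in> U \<Longrightarrow> Gam k i j u = Gam k j i u"
  unfolding Gam_eq using dgm_sym[of u _ i j] by (simp add: add.commute)

lemma Gam_lower:
  assumes u: "u \<in> U"
  shows "(\<Sum>m\<in>UNIV. gm p m u * Gam m i j u) = (1/2) * (pd i (gm j p) u + pd j (gm i p) u - pd p (gm i j) u)"
proof -
  let ?r = "\<lambda>l. pd i (gm j l) u + pd j (gm i l) u - pd l (gm i j) u"
  have "(\<Sum>m\<in>UNIV. gm p m u * Gam m i j u)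
      = (1/2) * ((\<Sum>m\<in>UNIV. gm p m u * gi m 1 u) * ?r 1 + (\<Sum>m\<in>UNIV. gm p m u * gi m 2 u) * ?r 2)"
    unfolding Gam_eq sum_2 by (simp add: algebra_simps)
  also have "\<dots> = (1/2) * ?r p"
    unfolding gm_gi[OF u] using exhaust_2[of p] by auto
  finally show ?thesis .
qed

lemma metric_compatible:
  assumes u: "u \<in> U"
  shows "pd l (gm j k) u = (\<Sum>m\<in>UNIV. Gam m l j u * gm m k u + Gam m l k u * gm m j u)"
proof -
  have "(\<Sum>m\<in>UNIV. Gam m l j u * gm m k u + Gam m l k u * gm m j u)
     = (\<Sum>m\<in>UNIV. gm k m u * Gam m l j u) + (\<Sum>m\<in>UNIV. gm j m u * Gam m l k u)"
    by (simp add: sum.distrib gm_sym[OF u, of _ j] gm_sym[OF u, of _ k] mult.commute)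
  also have "\<dots> = pd l (gm j k) u"
    unfolding Gam_lower[OF u] using dgm_sym[OF u] by (simp add: field_simps)
  finally show ?thesis by simp
qed

text \<open>The inverse metric is parallel: differentiating \<open>gi\<close> times
  \<open>gm\<close> equal to the identity gives minus the derivative of the metric with both indices
  raised, into which \<open>metric_compatible\<close> is inserted.\<close>

lemma dgi:
  assumes u: "u \<in> U"
  shows "pd l (gi k p) u = - (\<Sum>m\<in>UNIV. Gam k l m u * gi m p u + Gam p l m u * gi k m u)"
proof -
  have dd: "gi i j differentiable (at u)" for i j
    using Ck_on_differentiable[OF Cgi _ u] by simp
  have e: "(pd l (gi i 1) u * gm 1 j u + gi i 1 u * pd l (gm 1 j) u) + (pd l (gi i 2) u * gm 2 j u + gi i 2 u * pd l (gm 2 j) u) = 0" for i j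
  proof -
    have "pd l (\<lambda>v. gi i 1 v * gm 1 j v + gi i 2 v * gm 2 j v) u = pd l (\<lambda>v. if i = j then 1 else 0) u"
      by (rule pd_cong[OF U u]) (use gi_gm in \<open>simp add: sum_2\<close>)
    then show ?thesis
      using dd diffs(7)[OF u] by (simp add: pd_add pd_mult differentiable_mult add_ac)
  qed
  have r: "pd l (gi k p) u = - (\<Sum>i\<in>UNIV. \<Sum>j\<in>UNIV. gi k i u * pd l (gm i j) u * gi j p u)"
  proof -
    have "pd l (gi k p) u = pd l (gi k 1) u * (\<Sum>j\<in>UNIV. gm 1 j u * gi j p u) + pd l (gi k 2) u * (\<Sum>j\<in>UNIV. gm 2 j u * gi j p u)"
      unfolding gm_gi[OF u] using exhaust_2[of p] by auto
    also have "\<dots> = (pd l (gi k 1) u * gm 1 1 u + pd l (gi k 2) u * gm 2 1 u) * gi 1 p u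
        + (pd l (gi k 1) u * gm 1 2 u + pd l (gi k 2) u * gm 2 2 u) * gi 2 p u"
      by (simp add: sum_2 algebra_simps)
    also have "\<dots> = - (gi k 1 u * pd l (gm 1 1) u + gi k 2 u * pd l (gm 2 1) u) * gi 1 p u
       + - (gi k 1 u * pd l (gm 1 2) u + gi k 2 u * pd l (gm 2 2) u) * gi 2 p u"
    proof -
      have "pd l (gi k 1) u * gm 1 j u + pd l (gi k 2) u * gm 2 j u = - (gi k 1 u * pd l (gm 1 j) u + gi k 2 u * pd l (gm 2 j) u)" for j
        using e[of k j] by linarith
      then show ?thesis by (simp only:)
    qed
    finally show ?thesis by (simp add: sum_2 algebra_simps)
  qed
  have "(\<Sum>i\<in>UNIV. \<Sum>j\<in>UNIV. gi k i u * pd l (gm i j) u * gi j p u)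
      = (\<Sum>i\<in>UNIV. \<Sum>m\<in>UNIV. gi k i u * Gam m l i u * (\<Sum>j\<in>UNIV. gm m j u * gi j p u))
      + (\<Sum>j\<in>UNIV. \<Sum>m\<in>UNIV. gi j p u * Gam m l j u * (\<Sum>i\<in>UNIV. gi k i u * gm i m u))"
    unfolding metric_compatible[OF u] sum_2 gm_sym[OF u, of 2 1] by (simp add: algebra_simps)
  also have "\<dots> = (\<Sum>i\<in>UNIV. gi k i u * Gam p l i u) + (\<Sum>j\<in>UNIV. gi j p u * Gam k l j u)"
    unfolding gm_gi[OF u] gi_gm[OF u] by (simp add: if_distrib[of "\<lambda>z. _ * z"] cong: if_cong)
  finally show ?thesis
    unfolding r by (simp add: sum.distrib mult.commute add.commute)
qed

section \<open>The Darboux tensor and the Gauss equation\<close>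

text \<open>The Darboux tensor with its three Christoffel terms replaced by derivatives of the
  metric (\<open>darboux_eq\<close>); in this form the total symmetry and the class C^1 are
  visible.\<close>

definition A where
  "A q j k u = X u \<bullet> pd k (pd j (pd q x)) u - (1/2) * (pd q (gm j k) u + pd j (gm k q) u + pd k (gm q j) u)"

lemma symmetric_A: "u \<in> U \<Longrightarrow> symmetric3 (\<lambda>i j k. A i j k u)"
  unfolding symmetric3_def A_def
  using x_commute(2)[of u 1 1 2] x_commute(3)[of u 1 2 2] x_commute(3)[of u 1 2 1] x_commute(2)[of u 2 1 2]
     dgm_sym[of u _ 2 1] by (simp add: algebra_simps)

lemma CA: "Ck_on 1 (A i j k) U"
  unfolding A_def
  by (intro Ck_on_diff Ck_on_mult Ck_on_add Ck_on_const Ck_on_inner U Ck_on_le[OF CX] Cx Ck_on_pd[OF Cgm]) simp_all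

lemma C_Gam: "Ck_on 1 (Gam k i j) U"
  unfolding Gam_eq sum_2
  by (intro Ck_on_diff Ck_on_mult Ck_on_add Ck_on_const U Ck_on_le[OF Cgi] Ck_on_pd[OF Cgm]) simp_all

lemma darboux_eq:
  assumes u: "u \<in> U"
  shows "darboux x y j k l u = A j k l u"
proof -
  note d = diffs[OF u] Ck_on_differentiable[OF C_Gam _ u, simplified]
  have ds: "(\<lambda>v. Gam m k j v *\<^sub>R pd m x v) differentiable (at u)" for m
    using d by (intro differentiable_scaleR)
  have "pd l (cov2 (rel_metric x y) x j k) u = pd l (pd k (pd j x)) u
      - ((Gam 1 k j u *\<^sub>R pd l (pd 1 x) u + pd l (Gam 1 k j) u *\<^sub>R pd 1 x u)
       + (Gam 2 k j u *\<^sub>R pd l (pd 2 x) u + pd l (Gam 2 k j) u *\<^sub>R pd 2 x u))"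
    unfolding cov2_def[abs_def] sum_2 using d ds
    by (simp add: pd_diff pd_add pd_scaleR differentiable_add)
  then have 1: "X u \<bullet> pd l (cov2 (rel_metric x y) x j k) u = X u \<bullet> pd l (pd k (pd j x)) u - (\<Sum>m\<in>UNIV. gm m l u * Gam m k j u)"
    using u by (simp add: sum_2 inner_diff_right inner_add_right gm_eq mult.commute)
  have 2: "X u \<bullet> cov2 (rel_metric x y) x j k u = gm j k u" for j k
    using u by (simp add: sum_2 cov2_def inner_diff_right inner_add_right gm_eq)
  have "darboux x y j k l u = X u \<bullet> pd l (pd k (pd j x)) u
      - (\<Sum>m\<in>UNIV. gm m l u * Gam m k j u) - (\<Sum>m\<in>UNIV. gm m k u * Gam m l j u) - (\<Sum>m\<in>UNIV. gm j m u * Gam m l k u)"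
    unfolding darboux_def cov3_def inner_diff_right 1 inner_sum_right inner_scaleR_right 2 by (simp add: mult.commute)
  then have "darboux x y j k l u = X u \<bullet> pd l (pd k (pd j x)) u
      - (\<Sum>m\<in>UNIV. gm l m u * Gam m k j u) - (\<Sum>m\<in>UNIV. gm k m u * Gam m l j u) - (\<Sum>m\<in>UNIV. gm j m u * Gam m l k u)"
    using gm_sym[OF u, of _ l] gm_sym[OF u, of _ k] by simp
  then show ?thesis
    unfolding Gam_lower[OF u] A_def using dgm_sym[OF u, of _ j k] dgm_sym[OF u, of _ j l] dgm_sym[OF u, of _ k l]
    by (simp add: field_simps)
qed

text \<open>\<open>E 1\<close>, \<open>E 2\<close>, \<open>X\<close> is the basis dual to \<open>pd 1 x\<close>, \<open>pd 2 x\<close>, \<open>y\<close>; using it, the connection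
  induced by \<open>y\<close> is expressed through quantities of class \<open>C\<^sup>1\<close> although \<open>y\<close> itself is only \<open>C\<^sup>1\<close>.\<close>

definition E where "E p u = - (gi p 1 u *\<^sub>R pd 1 X u + gi p 2 u *\<^sub>R pd 2 X u)"

definition Gh where "Gh p j k u = E p u \<bullet> pd k (pd j x) u"

text \<open>By \<open>Gam_Gh\<close> this is the difference between the induced connection and the
  Levi-Civita connection.\<close>

definition af where "af p j k u = (\<Sum>q\<in>UNIV. gi p q u * A q j k u)"

definition B where "B i j u = - (E j u \<bullet> pd i y u)"

lemma CE: "Ck_on 1 (E p) U"
  unfolding E_def
  by (intro Ck_on_minus Ck_on_add Ck_on_scaleR U Ck_on_le[OF Cgi] Ck_on_pd[OF CX]) simp_all

lemma E_tangent: "u \<in> U \<Longrightarrow> E p u \<bullet> pd j x u = (if p = j then 1 else 0)"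
  using gi_gm[of u p j] gm_sym[of u 1 j] gm_sym[of u 2 j]
  by (simp add: E_def inner_diff_left inner_add_left dX_tangent sum_2)

lemma E_y: "u \<in> U \<Longrightarrow> E p u \<bullet> y u = 0"
  by (simp add: E_def inner_diff_left inner_add_left dX_y)

lemma expansion:
  assumes u: "u \<in> U"
  shows "v = (E 1 u \<bullet> v) *\<^sub>R pd 1 x u + (E 2 u \<bullet> v) *\<^sub>R pd 2 x u + (X u \<bullet> v) *\<^sub>R y u"
proof -
  have "card {pd 1 x u, pd 2 x u, y u} = 3" using distinct[OF u] by simp
  then have "span {pd 1 x u, pd 2 x u, y u} = UNIV"
    using card_eq_dim[of "{pd 1 x u, pd 2 x u, y u}" UNIV] independent[OF u] by auto
  then have "v \<in> span {pd 1 x u, pd 2 x u, y u}" by simp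
  then obtain a b c where "v - a *\<^sub>R pd 1 x u - b *\<^sub>R pd 2 x u = c *\<^sub>R y u"
    unfolding span_insert[of "pd 1 x u"] span_insert[of "pd 2 x u"] span_singleton by auto
  then have v: "v = a *\<^sub>R pd 1 x u + b *\<^sub>R pd 2 x u + c *\<^sub>R y u" by (simp add: algebra_simps)
  show ?thesis
    using u by (subst (2 3 4) v) (simp add: inner_add_right E_tangent E_y v)
qed

lemma tangential_expansion:
  assumes u: "u \<in> U"
  shows "pd i y u = - (\<Sum>j\<in>UNIV. B i j u *\<^sub>R pd j x u)"
proof -
  have "- (\<Sum>j\<in>UNIV. B i j u *\<^sub>R pd j x u) = (E 1 u \<bullet> pd i y u) *\<^sub>R pd 1 x u + (E 2 u \<bullet> pd i y u) *\<^sub>R pd 2 x u"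
    by (simp add: B_def sum_2)
  also have "\<dots> = pd i y u"
    using expansion[OF u, of "pd i y u"] X_dy[OF u] by simp
  finally show ?thesis ..
qed

lemma rel_shape_operator_eq:
  assumes u: "u \<in> U"
  shows "rel_shape_operator x y u = (\<chi> i j. B i j u)"
  unfolding rel_shape_operator_def
proof (rule the_equality)
  show "\<forall>i. pd i y u = - (\<Sum>j\<in>UNIV. (\<chi> i j. B i j u) $ i $ j *\<^sub>R pd j x u)"
    using tangential_expansion[OF u] by simp
next
  fix C :: "real^2^2" assume C: "\<forall>i. pd i y u = - (\<Sum>j\<in>UNIV. C $ i $ j *\<^sub>R pd j x u)"
  have "B i j u = C $ i $ j" for i j
    unfolding B_def C[rule_format, of i] using exhaust_2[of j]
    by (auto simp: sum_2 inner_diff_right inner_add_right E_tangent[OF u])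
  then show "C = (\<chi> i j. B i j u)" by (simp add: vec_eq_iff)
qed

text \<open>Adding the lowered Christoffel symbol to \<open>A\<close> leaves the third derivative of
  \<open>x\<close> paired with \<open>X\<close>, minus one derivative of the metric. By
  \<open>dgm\<close> this is minus the second derivative of \<open>x\<close> paired with the
  derivative of \<open>X\<close>, which is \<open>Gh\<close> after raising the index.\<close>

lemma Gam_Gh:
  assumes u: "u \<in> U"
  shows "Gam p i j u = Gh p i j u - af p i j u"
proof -
  have "af p i j u + Gam p i j u = (\<Sum>q\<in>UNIV. gi p q u * (X u \<bullet> pd j (pd i (pd q x)) u - pd q (gm i j) u))"
    unfolding af_def Gam_eq A_def sum_2 using dgm_sym[OF u, of _ j 1] dgm_sym[OF u, of _ j 2] dgm_sym[OF u, of _ i 1] dgm_sym[OF u, of _ i 2]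
    by (simp add: field_simps)
  also have "\<dots> = Gh p i j u"
  proof -
    have "pd j (pd i (pd q x)) u = pd q (pd j (pd i x)) u" for q
      using x_commute(2)[OF u, of j i q] x_commute(3)[OF u, of j q i] by simp
    then show ?thesis
      by (simp add: Gh_def E_def sum_2 dgm[OF u] inner_add_left inner_diff_left)
  qed
  finally show ?thesis by simp
qed

lemma Gh_sym: "u \<in> U \<Longrightarrow> Gh p i j u = Gh p j i u"
  using x_commute(1)[of u j i] by (simp add: Gh_def)

text \<open>The third derivatives of \<open>x\<close> commute and drop out, so the curvature of the
  induced connection needs only first derivatives of the dual basis.\<close>

lemma d_Gh:
  assumes u: "u \<in> U"
  shows "pd l (Gh p j k) u - pd k (Gh p j l) u = pd l (E p) u \<bullet> pd k (pd j x) u - pd k (E p) u \<bullet> pd l (pd j x) u"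
proof -
  have d: "E p differentiable (at u)" using Ck_on_differentiable[OF CE _ u] by simp
  have "pd l (Gh p j k) u = E p u \<bullet> pd l (pd k (pd j x)) u + pd l (E p) u \<bullet> pd k (pd j x) u" for l k
    unfolding Gh_def[abs_def] by (rule pd_inner[OF d diffs(3)[OF u]])
  then show ?thesis using x_commute(3)[OF u, of l k j] by simp
qed

lemma d_E_tangent:
  assumes u: "u \<in> U"
  shows "pd l (E p) u \<bullet> pd m x u = - Gh p m l u"
proof -
  have d: "E p differentiable (at u)" using Ck_on_differentiable[OF CE _ u] by simp
  have "pd l (\<lambda>v. E p v \<bullet> pd m x v) u = pd l (\<lambda>v. if p = m then 1 else 0) u"
    by (rule pd_cong[OF U u]) (rule E_tangent)
  then show ?thesis using pd_inner[OF d diffs(2)[OF u], of l m] by (simp add: Gh_def)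
qed

lemma d_E_y:
  assumes u: "u \<in> U"
  shows "pd l (E p) u \<bullet> y u = B l p u"
proof -
  have d: "E p differentiable (at u)" using Ck_on_differentiable[OF CE _ u] by simp
  have "pd l (\<lambda>v. E p v \<bullet> y v) u = pd l (\<lambda>v. 0) u"
    by (rule pd_cong[OF U u]) (rule E_y)
  then show ?thesis using pd_inner[OF d diffs(9)[OF u], of l] by (simp add: B_def)
qed

lemma d_E_second:
  assumes u: "u \<in> U"
  shows "pd l (E p) u \<bullet> pd k (pd j x) u = gm j k u * B l p u - (\<Sum>m\<in>UNIV. Gh m j k u * Gh p m l u)"
  by (subst expansion[OF u, of "pd k (pd j x) u"])
     (simp add: inner_add_right d_E_tangent[OF u] d_E_y[OF u] sum_2 Gh_def[symmetric] gm_eq[symmetric])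

text \<open>The left-hand side is the Ricci tensor of the induced connection. The products of
  \<open>Gh\<close> coming from \<open>d_E_second\<close> cancel those already present, and the
  shape operator is left.\<close>

lemma gauss_traced:
  assumes u: "u \<in> U"
  shows "(\<Sum>k\<in>UNIV. pd k (Gh k i j) u - pd j (Gh k i k) u
      + (\<Sum>l\<in>UNIV. Gh k k l u * Gh l i j u - Gh k j l u * Gh l i k u))
    = gm i j u * (B 1 1 u + B 2 2 u) - (\<Sum>k\<in>UNIV. gm i k u * B j k u)"
  unfolding d_Gh[OF u] d_E_second[OF u] sum_2 Gh_sym[OF u, of _ 2 1] Gh_sym[OF u, of _ j]
  by (simp add: algebra_simps)

text \<open>The Levi-Civita symbols are replaced by \<open>Gh\<close> minus \<open>af\<close> and
  the result is sorted by degree in \<open>af\<close>.\<close>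

lemma ricci_eq:
  assumes u: "u \<in> U"
  shows "ricci (rel_metric x y) i j u = gm i j u * (B 1 1 u + B 2 2 u) - (\<Sum>k\<in>UNIV. gm i k u * B j k u)
    - (\<Sum>k\<in>UNIV. pd k (af k i j) u - pd j (af k i k) u
      + (\<Sum>l\<in>UNIV. Gam k k l u * af l i j u + af k k l u * Gam l i j u - Gam k j l u * af l i k u - af k j l u * Gam l i k u))
    - (\<Sum>k\<in>UNIV. \<Sum>l\<in>UNIV. af k k l u * af l i j u - af k j l u * af l i k u)"
proof -
  have Caf: "Ck_on 1 (af p j k) U" for p j k
    unfolding af_def sum_2 by (intro Ck_on_add Ck_on_mult U CA Ck_on_le[OF Cgi]) simp_all
  have CGh: "Ck_on 1 (Gh p j k) U" for p j k
    unfolding Gh_def by (intro Ck_on_inner U CE Ck_on_le[OF Cx(2)]) simp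
  have dG: "pd l (Gam p j k) u = pd l (Gh p j k) u - pd l (af p j k) u" for l p j k
  proof -
    have "pd l (Gam p j k) u = pd l (\<lambda>v. Gh p j k v - af p j k v) u"
      by (rule pd_cong[OF U u]) (rule Gam_Gh)
    then show ?thesis
      using Ck_on_differentiable[OF Caf _ u] Ck_on_differentiable[OF CGh _ u] by (simp add: pd_diff)
  qed
  have GG: "Gh p j k u = Gam p j k u + af p j k u" for p j k
    using Gam_Gh[OF u] by simp
  show ?thesis
    unfolding gauss_traced[OF u, symmetric]
    unfolding ricci_def dG GG sum_2 by (simp add: algebra_simps)
qed

lemma mean_curvature_eq: "u \<in> U \<Longrightarrow> 2 * mean_curvature x y u = B 1 1 u + B 2 2 u"
  by (simp add: mean_curvature_def rel_shape_operator_eq trace_def sum_2)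

lemma pick_eq: "u \<in> U \<Longrightarrow> pick_invariant x y u = cubic_norm (\<lambda>i j. gi i j u) (\<lambda>i j k. A i j k u)"
  by (simp add: pick_invariant_def cubic_norm_def darboux_eq Let_def)

lemma tchebychev_eq:
  assumes u: "u \<in> U"
  shows "tchebychev_norm x y u = trace_norm (\<lambda>i j. gi i j u) (\<lambda>i j k. A i j k u)"
proof -
  define t where "t k = trace3 (\<lambda>i j. gi i j u) (\<lambda>i j k. A i j k u) k" for k
  define T where "T m = (1/2) * (\<Sum>k\<in>UNIV. gi m k u * t k)" for m
  have tk: "(\<Sum>i\<in>UNIV. \<Sum>j\<in>UNIV. gi i j u * A i j k u) = t k" for k
    unfolding t_def trace3_def by (rule sum.swap[THEN trans]) (simp add: gi_sym[OF u])
  then have T: "tchebychev_coeff x y u $ m = T m" for m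
    unfolding tchebychev_coeff_def Let_def T_def tk[symmetric]
    by (simp add: darboux_eq[OF u] sum_2 algebra_simps)
  have lower: "(\<Sum>j\<in>UNIV. gm i j u * T j) = t i / 2" for i
  proof -
    have "(\<Sum>j\<in>UNIV. gm i j u * T j) = (1/2) * (\<Sum>k\<in>UNIV. (\<Sum>j\<in>UNIV. gm i j u * gi j k u) * t k)"
      by (simp add: T_def sum_2 algebra_simps)
    then show ?thesis unfolding gm_gi[OF u] by (simp add: if_distrib[of "\<lambda>z. z * _"] cong: if_cong)
  qed
  have "tchebychev_norm x y u = (\<Sum>i\<in>UNIV. T i * (\<Sum>j\<in>UNIV. gm i j u * T j))"
    unfolding tchebychev_norm_def T by (simp add: sum_distrib_left mult_ac)
  also have "\<dots> = trace_norm (\<lambda>i j. gi i j u) (\<lambda>i j k. A i j k u)"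
    unfolding lower trace_norm_def t_def[symmetric]
    unfolding T_def by (simp add: sum_2 algebra_simps)
  finally show ?thesis .
qed

text \<open>The trace of \<open>ricci_eq\<close>: in dimension two the shape operator contributes
  twice its trace minus its trace, the part linear in \<open>af\<close> vanishes, and the quadratic
  part is given by \<open>quadratic_terms\<close>.\<close>

theorem theorema_egregium:
  assumes u: "u \<in> U"
  shows "rel_scalar_curvature x y u - mean_curvature x y u = pick_invariant x y u - 2 * tchebychev_norm x y u"
proof -
  let ?g = "\<lambda>i j. gi i j u" and ?A = "\<lambda>i j k. A i j k u" and ?a = "\<lambda>k i j. af k i j u" and ?c = "\<lambda>k i j. Gam k i j u"
  have dgi': "gi i j differentiable (at u)" and dA: "A i j k differentiable (at u)" for i j k
    using Ck_on_differentiable[OF Cgi _ u] Ck_on_differentiable[OF CA _ u] by simp_all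
  have sdA: "symmetric3 (\<lambda>i j k. pd l (A i j k) u)" for l
    unfolding symmetric3_def
    by (intro conjI; rule pd_cong[OF U u]; use symmetric_A in \<open>auto simp: symmetric3_def\<close>)
  have 1: "(\<Sum>i\<in>UNIV. \<Sum>j\<in>UNIV. gi i j u * (\<Sum>k\<in>UNIV. pd k (af k i j) u - pd j (af k i k) u
      + (\<Sum>l\<in>UNIV. Gam k k l u * af l i j u + af k k l u * Gam l i j u - Gam k j l u * af l i k u - af k j l u * Gam l i k u))) = 0"
  proof (rule trace_connection_terms_cancel[where g = ?g and A = ?A and a = ?a and c = ?c
        and da = "\<lambda>l k i j. pd l (af k i j) u" and dg = "\<lambda>l k p. pd l (gi k p) u" and dA = "\<lambda>l i j k. pd l (A i j k) u"])
    show "pd l (af k i j) u = (\<Sum>p\<in>UNIV. pd l (gi k p) u * A p i j u + gi k p u * pd l (A p i j) u)" for l k i j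
      unfolding af_def[abs_def] sum_2 using dgi' dA
      by (simp add: pd_add pd_mult differentiable_mult add.commute)
  qed (use gi_sym[OF u] Gam_sym[OF u] symmetric_A[OF u] sdA dgi[OF u] in \<open>auto simp: af_def\<close>)
  have 2: "(\<Sum>i\<in>UNIV. \<Sum>j\<in>UNIV. gi i j u * (\<Sum>k\<in>UNIV. \<Sum>l\<in>UNIV. af k k l u * af l i j u - af k j l u * af l i k u))
    = 4 * tchebychev_norm x y u - 2 * pick_invariant x y u"
    unfolding tchebychev_eq[OF u] pick_eq[OF u]
    by (rule quadratic_terms) (use gi_sym[OF u] symmetric_A[OF u] in \<open>auto simp: af_def\<close>)
  define b where "b = B 1 1 u + B 2 2 u"
  have 3: "(\<Sum>i\<in>UNIV. \<Sum>j\<in>UNIV. gi i j u * (gm i j u * b - (\<Sum>k\<in>UNIV. gm i k u * B j k u))) = b"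
  proof -
    have "(\<Sum>i\<in>UNIV. \<Sum>j\<in>UNIV. gi i j u * (gm i j u * b - (\<Sum>k\<in>UNIV. gm i k u * B j k u)))
      = ((\<Sum>k\<in>UNIV. gi 1 k u * gm k 1 u) + (\<Sum>k\<in>UNIV. gi 2 k u * gm k 2 u)) * b
        - (\<Sum>j\<in>UNIV. \<Sum>k\<in>UNIV. (\<Sum>i\<in>UNIV. gi j i u * gm i k u) * B j k u)"
      unfolding sum_2 gi_sym[OF u, of 2 1] gm_sym[OF u, of 2 1] by (simp add: algebra_simps)
    also have "\<dots> = b"
      unfolding gi_gm[OF u] by (simp add: sum_2 b_def)
    finally show ?thesis .
  qed
  have sum3: "(\<Sum>i\<in>UNIV. \<Sum>j\<in>UNIV. gi i j u * (p i j - q i j - r i j)) = (\<Sum>i\<in>UNIV. \<Sum>j\<in>UNIV. gi i j u * p i j)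
      - (\<Sum>i\<in>UNIV. \<Sum>j\<in>UNIV. gi i j u * q i j) - (\<Sum>i\<in>UNIV. \<Sum>j\<in>UNIV. gi i j u * r i j)" for p q r
    by (simp add: right_diff_distrib sum_subtractf)
  have "2 * rel_scalar_curvature x y u = (\<Sum>i\<in>UNIV. \<Sum>j\<in>UNIV. gi i j u * ricci (rel_metric x y) i j u)"
    by (simp add: rel_scalar_curvature_def scalar_curvature_def)
  also have "\<dots> = b - 0 - (4 * tchebychev_norm x y u - 2 * pick_invariant x y u)"
    unfolding ricci_eq[OF u] sum3 b_def[symmetric] 1 2 3 ..
  finally show ?thesis
    using mean_curvature_eq[OF u] by (simp add: b_def)
qed

lemma property_a_iff_b:
  assumes u: "u \<in> U"
  shows "3 * (rel_scalar_curvature x y u - mean_curvature x y u) + pick_invariant x y u = 0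
      \<longleftrightarrow> 3 * tchebychev_norm x y u = 2 * pick_invariant x y u"
  using theorema_egregium[OF u] by argo

lemma property_b_iff_c:
  assumes u: "u \<in> U"
  shows "3 * tchebychev_norm x y u = 2 * pick_invariant x y u
      \<longleftrightarrow> tchebychev_norm x y u = 2 * (mean_curvature x y u - rel_scalar_curvature x y u)"
  using theorema_egregium[OF u] by argo

lemma property_b_iff:
  assumes u: "u \<in> U"
  shows "3 * tchebychev_norm x y u = 2 * pick_invariant x y u \<longleftrightarrow>
    (\<exists>w. w \<noteq> 0 \<and> form2 (\<lambda>i j. gm i j u) w w = 0 \<and> form3 (\<lambda>i j k. A i j k u) w = 0)"
  unfolding tchebychev_eq[OF u] pick_eq[OF u]
  by (rule norms_proportional_iff) (use gm_sym[OF u] gi_sym[OF u] det_gm[OF u] gi_gm[OF u] symmetric_A[OF u] in auto)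

end

section \<open>Graph representation\<close>

lemma pd_compose:
  fixes F :: "real^2 \<Rightarrow> real" and P1 P2 :: "real^2 \<Rightarrow> real"
  assumes F: "F differentiable (at (vector [P1 u, P2 u]))" and P: "P1 differentiable (at u)" "P2 differentiable (at u)"
  shows "pd i (\<lambda>u. F (vector [P1 u, P2 u])) u = pd i P1 u * pd 1 F (vector [P1 u, P2 u]) + pd i P2 u * pd 2 F (vector [P1 u, P2 u])"
    "(\<lambda>u. F (vector [P1 u, P2 u])) differentiable (at u)"
proof -
  have v: "vector [p, q] = p *\<^sub>R axis 1 1 + q *\<^sub>R (axis 2 1 :: real^2)" for p q
    by (simp add: vec_eq_iff forall_2 axis_def)
  have "((\<lambda>u. vector [P1 u, P2 u] :: real^2) has_derivative
      (\<lambda>h. frechet_derivative P1 (at u) h *\<^sub>R axis 1 1 + frechet_derivative P2 (at u) h *\<^sub>R axis 2 1)) (at u)"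
    unfolding v using P[unfolded frechet_derivative_works] by (intro has_derivative_add has_derivative_scaleR_left)
  from has_derivative_compose[OF this has_derivative_pd[OF F]]
  have *: "((\<lambda>u. F (vector [P1 u, P2 u])) has_derivative
      (\<lambda>h. frechet_derivative P1 (at u) h * pd 1 F (vector [P1 u, P2 u]) + frechet_derivative P2 (at u) h * pd 2 F (vector [P1 u, P2 u]))) (at u)"
    by (simp add: axis_def)
  from pd_eq[OF this, of i]
  show "pd i (\<lambda>u. F (vector [P1 u, P2 u])) u = pd i P1 u * pd 1 F (vector [P1 u, P2 u]) + pd i P2 u * pd 2 F (vector [P1 u, P2 u])"
    by (simp add: pd_def)
  show "(\<lambda>u. F (vector [P1 u, P2 u])) differentiable (at u)"
    using * by (auto simp: differentiable_def)
qed

text \<open>Of the inverse \<open>\<phi>\<close> only differentiability is assumed; its higher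
  smoothness is recovered in \<open>Ck_on_compose_\<phi>\<close>.\<close>

locale plane_diffeo =
  fixes U0 W :: "(real^2) set" and P1 P2 :: "real^2 \<Rightarrow> real" and \<phi> :: "real^2 \<Rightarrow> real^2" and K :: nat
  assumes open_U0: "open U0" and open_W: "open W"
    and CP: "Ck_on K P1 U0" "Ck_on K P2 U0"
    and jac: "\<And>u. u \<in> U0 \<Longrightarrow> pd 1 P1 u * pd 2 P2 u - pd 2 P1 u * pd 1 P2 u \<noteq> 0"
    and hom: "homeomorphism U0 W (\<lambda>u. vector [P1 u, P2 u]) \<phi>"
    and diff_\<phi>: "\<And>q. q \<in> W \<Longrightarrow> \<phi> differentiable (at q)"
begin

lemma \<phi>_in: "q \<in> W \<Longrightarrow> \<phi> q \<in> U0" and P_\<phi>: "q \<in> W \<Longrightarrow> vector [P1 (\<phi> q), P2 (\<phi> q)] = q"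
  and P_in: "u \<in> U0 \<Longrightarrow> vector [P1 u, P2 u] \<in> W" and \<phi>_P: "u \<in> U0 \<Longrightarrow> \<phi> (vector [P1 u, P2 u]) = u"
  using hom by (auto simp: homeomorphism_def)

definition J where "J u = pd 1 P1 u * pd 2 P2 u - pd 2 P1 u * pd 1 P2 u"

lemma compose_\<phi>:
  assumes q: "q \<in> W" and F: "F differentiable (at (\<phi> q))" and K: "0 < K"
  shows "(\<lambda>q. F (\<phi> q)) differentiable (at q)"
    "pd 1 (\<lambda>q. F (\<phi> q)) q = inverse (J (\<phi> q)) *\<^sub>R (pd 2 P2 (\<phi> q) *\<^sub>R pd 1 F (\<phi> q) - pd 1 P2 (\<phi> q) *\<^sub>R pd 2 F (\<phi> q))"
    "pd 2 (\<lambda>q. F (\<phi> q)) q = inverse (J (\<phi> q)) *\<^sub>R (pd 1 P1 (\<phi> q) *\<^sub>R pd 2 F (\<phi> q) - pd 2 P1 (\<phi> q) *\<^sub>R pd 1 F (\<phi> q))"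
proof -
  let ?u = "\<phi> q"
  define d where "d = frechet_derivative \<phi> (at q)"
  have d: "(\<phi> has_derivative d) (at q)"
    using diff_\<phi>[OF q] unfolding d_def frechet_derivative_works .
  have comp: "((\<lambda>q. G (\<phi> q)) has_derivative (\<lambda>h. d h $ 1 *\<^sub>R pd 1 G ?u + d h $ 2 *\<^sub>R pd 2 G ?u)) (at q)"
    if "G differentiable (at ?u)" for G :: "real^2 \<Rightarrow> 'z::real_normed_vector"
    by (rule has_derivative_compose[OF d has_derivative_pd[OF that]])
  show "(\<lambda>q. F (\<phi> q)) differentiable (at q)"
    using comp[OF F] by (auto simp: differentiable_def)
  have dP: "P1 differentiable (at ?u)" "P2 differentiable (at ?u)"
    using CP \<phi>_in[OF q] K Ck_on_differentiable by blast+
  have nth: "pd i (\<lambda>q. q $ j) q = (if i = j then 1 else 0)" for i j :: 2 and q :: "real^2"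
    using pd_eq[OF bounded_linear.has_derivative[OF bounded_linear_vec_nth has_derivative_ident], of i j q]
    by (simp add: axis_def)
  \<comment> \<open>Differentiating \<open>P_\<phi>\<close> gives a linear system for the derivative
    \<open>d\<close> of \<open>\<phi>\<close>, solved by Cramer's rule.\<close>
  have e: "d (axis i 1) $ 1 * pd 1 P1 ?u + d (axis i 1) $ 2 * pd 2 P1 ?u = (if i = 1 then 1 else 0)"
    "d (axis i 1) $ 1 * pd 1 P2 ?u + d (axis i 1) $ 2 * pd 2 P2 ?u = (if i = 2 then 1 else 0)" for i
  proof -
    have "pd i (\<lambda>q. P1 (\<phi> q)) q = pd i (\<lambda>q. q $ 1) q" "pd i (\<lambda>q. P2 (\<phi> q)) q = pd i (\<lambda>q. q $ 2) q"
      using P_\<phi> by (auto intro!: pd_cong[OF open_W q] simp: vec_eq_iff forall_2)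
    then show "d (axis i 1) $ 1 * pd 1 P1 ?u + d (axis i 1) $ 2 * pd 2 P1 ?u = (if i = 1 then 1 else 0)"
      "d (axis i 1) $ 1 * pd 1 P2 ?u + d (axis i 1) $ 2 * pd 2 P2 ?u = (if i = 2 then 1 else 0)"
      unfolding nth using pd_eq[OF comp[OF dP(1)], of i] pd_eq[OF comp[OF dP(2)], of i] by auto
  qed
  have J0: "J ?u \<noteq> 0" using jac[OF \<phi>_in[OF q]] by (simp add: J_def)
  have "d (axis 1 1) $ 1 * J ?u = pd 2 P2 ?u" "d (axis 1 1) $ 2 * J ?u = - pd 1 P2 ?u"
    "d (axis 2 1) $ 1 * J ?u = - pd 2 P1 ?u" "d (axis 2 1) $ 2 * J ?u = pd 1 P1 ?u"
    using e[of 1] e[of 2] unfolding J_def by (simp_all, algebra+)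
  then have s: "d (axis 1 1) $ 1 = inverse (J ?u) * pd 2 P2 ?u" "d (axis 1 1) $ 2 = inverse (J ?u) * - pd 1 P2 ?u"
    "d (axis 2 1) $ 1 = inverse (J ?u) * - pd 2 P1 ?u" "d (axis 2 1) $ 2 = inverse (J ?u) * pd 1 P1 ?u"
    using J0 by (simp_all add: field_simps)
  show "pd 1 (\<lambda>q. F (\<phi> q)) q = inverse (J (\<phi> q)) *\<^sub>R (pd 2 P2 (\<phi> q) *\<^sub>R pd 1 F (\<phi> q) - pd 1 P2 (\<phi> q) *\<^sub>R pd 2 F (\<phi> q))"
    "pd 2 (\<lambda>q. F (\<phi> q)) q = inverse (J (\<phi> q)) *\<^sub>R (pd 1 P1 (\<phi> q) *\<^sub>R pd 2 F (\<phi> q) - pd 2 P1 (\<phi> q) *\<^sub>R pd 1 F (\<phi> q))"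
    unfolding pd_eq[OF comp[OF F]] s by (simp_all add: scaleR_diff_right)
qed

text \<open>By \<open>compose_\<phi>\<close> the partial derivatives of \<open>F\<close> composed
  with \<open>\<phi>\<close> are again composites with \<open>\<phi>\<close>, of functions one class
  lower, so the induction closes.\<close>

lemma Ck_on_compose_\<phi>: "k \<le> K \<Longrightarrow> Ck_on k F U0 \<Longrightarrow> Ck_on k (\<lambda>q. F (\<phi> q)) W"
proof (induction k arbitrary: F)
  case 0
  have "continuous_on W \<phi>" using hom by (simp add: homeomorphism_def)
  with 0 show ?case
    by (auto simp: Ck_on.simps(1) intro!: continuous_on_compose2[of U0 F W \<phi>] \<phi>_in)
next
  case (Suc k)
  have F: "Ck_on k F U0" "Ck_on k (pd i F) U0" for i
    using Suc.prems(2) Ck_on_SucD Ck_on.simps(2) by blast+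
  have dF: "F differentiable (at (\<phi> q))" if "q \<in> W" for q
    using Suc.prems(2) \<phi>_in[OF that] Ck_on.simps(2) by blast
  have K: "0 < K" "Suc k \<le> K" using Suc.prems by auto
  have P: "Ck_on k (pd i P1) U0" "Ck_on k (pd i P2) U0" for i
    using Ck_on_pd[OF CP(1) K(2)] Ck_on_pd[OF CP(2) K(2)] .
  have CJ: "Ck_on k (\<lambda>u. inverse (J u)) U0"
    unfolding J_def using jac by (intro Ck_on_inverse Ck_on_diff Ck_on_mult open_U0 P)
  have "Ck_on k (pd 1 (\<lambda>q. F (\<phi> q))) W"
    by (rule Ck_on_cong[OF open_W _ Suc.IH[of "\<lambda>u. inverse (J u) *\<^sub>R (pd 2 P2 u *\<^sub>R pd 1 F u - pd 1 P2 u *\<^sub>R pd 2 F u)"]])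
       (use Suc.prems(1) in \<open>auto simp: compose_\<phi>[OF _ dF K(1)] intro!: Ck_on_scaleR Ck_on_diff open_U0 P CJ F\<close>)
  moreover have "Ck_on k (pd 2 (\<lambda>q. F (\<phi> q))) W"
    by (rule Ck_on_cong[OF open_W _ Suc.IH[of "\<lambda>u. inverse (J u) *\<^sub>R (pd 1 P1 u *\<^sub>R pd 2 F u - pd 2 P1 u *\<^sub>R pd 1 F u)"]])
       (use Suc.prems(1) in \<open>auto simp: compose_\<phi>[OF _ dF K(1)] intro!: Ck_on_scaleR Ck_on_diff open_U0 P CJ F\<close>)
  ultimately have "Ck_on k (pd i (\<lambda>q. F (\<phi> q))) W" for i
    using exhaust_2[of i] by auto
  then show ?case
    using compose_\<phi>(1)[OF _ dF K(1)] by (simp add: Ck_on.simps(2))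
qed

end

lemma plane_diffeo_exists:
  fixes P1 P2 :: "real^2 \<Rightarrow> real"
  assumes U: "open U" "u0 \<in> U" and CP: "Ck_on K P1 U" "Ck_on K P2 U" and K: "0 < K"
    and jac: "pd 1 P1 u0 * pd 2 P2 u0 - pd 2 P1 u0 * pd 1 P2 u0 \<noteq> 0"
  obtains U0 W \<phi> where "U0 \<subseteq> U" "u0 \<in> U0" "plane_diffeo U0 W P1 P2 \<phi> K"
proof -
  define J where "J u = pd 1 P1 u * pd 2 P2 u - pd 2 P1 u * pd 1 P2 u" for u
  have C0: "continuous_on U (pd i P1)" "continuous_on U (pd i P2)" for i
    using Ck_on_continuous[OF Ck_on_pd[OF CP(1), of 0]] Ck_on_continuous[OF Ck_on_pd[OF CP(2), of 0]] K by auto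
  have "continuous_on U J"
    unfolding J_def by (intro continuous_intros C0)
  then have "open (U \<inter> J -` (- {0}))"
    by (intro continuous_open_preimage[OF _ U(1)]) auto
  define U1 where "U1 = U \<inter> J -` (- {0})"
  have U1: "open U1" "u0 \<in> U1" "U1 \<subseteq> U"
    using \<open>open (U \<inter> J -` (- {0}))\<close> U(2) jac by (auto simp: U1_def J_def)
  define \<Phi> where "\<Phi> u = (vector [P1 u, P2 u] :: real^2)" for u
  define c where "c i u = (vector [pd i P1 u, pd i P2 u] :: real^2)" for i u
  have v: "vector [p, q] = p *\<^sub>R axis 1 1 + q *\<^sub>R (axis 2 1 :: real^2)" for p q
    by (simp add: vec_eq_iff forall_2 axis_def)
  \<comment> \<open>The inverse function theorem takes the derivative as a continuous family of
    bounded linear maps; rank-one maps reduce its continuity to that of the columns.\<close>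
  define rk1 where "rk1 w i = blinfun_scaleR_left w o\<^sub>L blinfun_inner_right (axis i 1 :: real^2)" for w :: "real^2" and i :: 2
  have rk1: "blinfun_apply (rk1 w i) h = h $ i *\<^sub>R w" for w h :: "real^2" and i
    by (simp add: rk1_def inner_axis')
  define f' where "f' u = rk1 (c 1 u) 1 + rk1 (c 2 u) 2" for u
  have f': "blinfun_apply (f' u) h = h $ 1 *\<^sub>R c 1 u + h $ 2 *\<^sub>R c 2 u" for u h
    by (simp add: f'_def blinfun.add_left rk1)
  have der: "(\<Phi> has_derivative blinfun_apply (f' u)) (at u)" if "u \<in> U1" for u
  proof -
    have "P1 differentiable (at u)" "P2 differentiable (at u)"
      using CP K that U1 Ck_on_differentiable by blast+
    from has_derivative_add[OF has_derivative_scaleR_left[OF has_derivative_pd[OF this(1)], of "axis 1 1"]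
        has_derivative_scaleR_left[OF has_derivative_pd[OF this(2)], of "axis 2 1"]]
    show ?thesis
      unfolding \<Phi>_def[abs_def] v
      by (rule has_derivative_eq_rhs) (auto simp: fun_eq_iff f' c_def v algebra_simps)
  qed
  have cont: "continuous_on U1 f'"
    unfolding f'_def rk1_def c_def v
    by (intro continuous_intros bounded_bilinear.continuous_on[OF bounded_bilinear_blinfun_compose]
        bounded_linear.continuous_on[OF bounded_linear_blinfun_scaleR_left] continuous_on_subset[OF C0(1) U1(3)] continuous_on_subset[OF C0(2) U1(3)])
  define invf where "invf = rk1 (inverse (J u0) *\<^sub>R vector [pd 2 P2 u0, - pd 1 P2 u0]) 1
    + rk1 (inverse (J u0) *\<^sub>R vector [- pd 2 P1 u0, pd 1 P1 u0]) 2"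
  have invf: "blinfun_apply invf h = h $ 1 *\<^sub>R (inverse (J u0) *\<^sub>R vector [pd 2 P2 u0, - pd 1 P2 u0]) + h $ 2 *\<^sub>R (inverse (J u0) *\<^sub>R vector [- pd 2 P1 u0, pd 1 P1 u0])" for h
    by (simp add: invf_def blinfun.add_left rk1)
  have J0: "J u0 \<noteq> 0" using jac by (simp add: J_def)
  have "invf o\<^sub>L f' u0 = id_blinfun"
  proof (rule blinfun_eqI)
    fix h :: "real^2"
    have "J u0 *\<^sub>R blinfun_apply (invf o\<^sub>L f' u0) h = J u0 *\<^sub>R h"
      using J0 by (simp add: invf f' c_def vec_eq_iff forall_2 field_simps) (simp add: J_def algebra_simps)
    then show "blinfun_apply (invf o\<^sub>L f' u0) h = blinfun_apply id_blinfun h"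
      using J0 by simp
  qed
  from inverse_function_theorem[OF U1(1) der cont U1(2) this]
  obtain U0 W \<phi> g' where U0: "open U0" "U0 \<subseteq> U1" "u0 \<in> U0" "open W" "homeomorphism U0 W \<Phi> \<phi>"
    "\<And>q. q \<in> W \<Longrightarrow> (\<phi> has_derivative (g' q)) (at q)"
    by metis
  have "plane_diffeo U0 W P1 P2 \<phi> K"
  proof
    show "homeomorphism U0 W (\<lambda>u. vector [P1 u, P2 u]) \<phi>" using U0(5) by (simp add: \<Phi>_def[abs_def])
    show "Ck_on K P1 U0" "Ck_on K P2 U0"
      using U0(2) U1(3) CP Ck_on_subset by (meson order_trans)+
    show "pd 1 P1 u * pd 2 P2 u - pd 2 P1 u * pd 1 P2 u \<noteq> 0" if "u \<in> U0" for u
      using that U0(2) by (auto simp: U1_def J_def)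
    show "\<phi> differentiable at q" if "q \<in> W" for q using U0(6)[OF that] by (auto simp: differentiable_def)
  qed (use U0 in auto)
  then show ?thesis using that U0 U1 by blast
qed

section \<open>Directional derivatives and the graph function\<close>

text \<open>The direction is constant, so iterates are pure second and third derivatives; they
  suffice to compare the forms \<open>form2\<close> and \<open>form3\<close> with
  \<open>hess\<close> and \<open>cub\<close>.\<close>

definition dd :: "real^2 \<Rightarrow> (real^2 \<Rightarrow> 'b::real_normed_vector) \<Rightarrow> real^2 \<Rightarrow> 'b" where
  "dd w F u = w $ 1 *\<^sub>R pd 1 F u + w $ 2 *\<^sub>R pd 2 F u"

lemma dd_cong: "open S \<Longrightarrow> u \<in> S \<Longrightarrow> (\<And>v. v \<in> S \<Longrightarrow> F v = G v) \<Longrightarrow> dd w F u = dd w G u"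
  by (simp add: dd_def pd_cong[of S u F G])

lemma dd_add:
  "F differentiable (at u) \<Longrightarrow> G differentiable (at u) \<Longrightarrow> dd w (\<lambda>v. F v + G v) u = dd w F u + dd w G u"
  by (simp add: dd_def pd_add algebra_simps)

lemma dd_mult:
  fixes F G :: "real^2 \<Rightarrow> real"
  shows "F differentiable (at u) \<Longrightarrow> G differentiable (at u) \<Longrightarrow> dd w (\<lambda>v. F v * G v) u = F u * dd w G u + dd w F u * G u"
  by (simp add: dd_def pd_mult algebra_simps)

lemma pd_inner_const: "F differentiable (at u) \<Longrightarrow> pd i (\<lambda>v. c \<bullet> F v) u = c \<bullet> pd i F u"
  by (rule pd_bounded_linear[OF bounded_linear_inner_right])

lemma dd_inner_const: "F differentiable (at u) \<Longrightarrow> dd w (\<lambda>v. c \<bullet> F v) u = c \<bullet> dd w F u"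
  by (simp add: dd_def pd_inner_const inner_add_right)

lemma Ck_on_dd: "open S \<Longrightarrow> Ck_on l F S \<Longrightarrow> Suc k \<le> l \<Longrightarrow> Ck_on k (dd w F) S"
  unfolding dd_def by (intro Ck_on_add Ck_on_scaleR Ck_on_const Ck_on_pd) auto

lemma dd_axis [simp]: "dd (axis i 1) F u = pd i F u"
  using exhaust_2[of i] by (auto simp: dd_def axis_def)

locale rel_graph = rel_chart U x y + D: plane_diffeo U0 W "\<lambda>u. a \<bullet> x u" "\<lambda>u. b \<bullet> x u" \<phi> 4
  for U U0 W :: "(real^2) set" and x y :: "real^2 \<Rightarrow> real^3" and a b n :: "real^3" and \<phi> :: "real^2 \<Rightarrow> real^2" +
  assumes U0_sub: "U0 \<subseteq> U" and orth: "n \<bullet> a = 0" "n \<bullet> b = 0" and n0: "n \<noteq> 0"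
begin

definition f where "f q = n \<bullet> x (\<phi> q)"

definition \<Phi> where "\<Phi> u = (vector [a \<bullet> x u, b \<bullet> x u] :: real^2)"

text \<open>The normal direction of the graph of \<open>f\<close>, in the coordinates given by \<open>a\<close>, \<open>b\<close>, \<open>n\<close>.\<close>

definition \<nu> where "\<nu> u = n - pd 1 f (\<Phi> u) *\<^sub>R a - pd 2 f (\<Phi> u) *\<^sub>R b"

definition \<kappa> where "\<kappa> u = \<nu> u \<bullet> y u"

lemma Cf: "Ck_on 4 f W"
  unfolding f_def
  by (rule D.Ck_on_compose_\<phi>) (intro order_refl Ck_on_inner Ck_on_const D.open_U0 Ck_on_subset[OF x4 U0_sub])+

lemma f_\<Phi>: "u \<in> U0 \<Longrightarrow> f (\<Phi> u) = n \<bullet> x u"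
  using D.\<phi>_P[of u] by (simp add: f_def \<Phi>_def)

lemma \<Phi>_in: "u \<in> U0 \<Longrightarrow> \<Phi> u \<in> W" and \<Phi>_\<phi>: "q \<in> W \<Longrightarrow> \<Phi> (\<phi> q) = q" and \<phi>_\<Phi>: "u \<in> U0 \<Longrightarrow> \<phi> (\<Phi> u) = u"
  using D.P_in D.P_\<phi> D.\<phi>_P by (simp_all add: \<Phi>_def)

lemma inU: "u \<in> U0 \<Longrightarrow> u \<in> U" using U0_sub by blast

lemma diff_x:
  assumes "u \<in> U"
  shows "x differentiable (at u)" "dd w x differentiable (at u)" "dd w (dd w x) differentiable (at u)"
proof -
  have 1: "Ck_on 3 (dd w x) U" by (rule Ck_on_dd[OF U x4]) simp
  have 2: "Ck_on 2 (dd w (dd w x)) U" by (rule Ck_on_dd[OF U 1]) simp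
  show "x differentiable (at u)" "dd w x differentiable (at u)" "dd w (dd w x) differentiable (at u)"
    using Ck_on_differentiable[OF x4 _ assms] Ck_on_differentiable[OF 1 _ assms] Ck_on_differentiable[OF 2 _ assms] by auto
qed

lemma diff_f:
  assumes "q \<in> W"
  shows "f differentiable (at q)" "pd i f differentiable (at q)" "pd j (pd i f) differentiable (at q)"
  using Ck_on_differentiable[OF Cf _ assms] Ck_on_differentiable[OF Ck_on_pd[OF Cf, of 3] _ assms]
    Ck_on_differentiable[OF Ck_on_pd[OF Ck_on_pd[OF Cf, of 3], of 2] _ assms] by auto

lemma diff_inner_const: "F differentiable (at u) \<Longrightarrow> (\<lambda>v. c \<bullet> F v) differentiable (at u)"
  by (rule bounded_linear_differentiable[OF bounded_linear_inner_right])

lemma dd_\<Phi>: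
  fixes F :: "real^2 \<Rightarrow> real"
  assumes u: "u \<in> U0" and F: "F differentiable (at (\<Phi> u))"
  shows "dd w (\<lambda>u. F (\<Phi> u)) u = (a \<bullet> dd w x u) * pd 1 F (\<Phi> u) + (b \<bullet> dd w x u) * pd 2 F (\<Phi> u)"
    "(\<lambda>u. F (\<Phi> u)) differentiable (at u)"
proof -
  note dx = diff_x(1)[OF inU[OF u]]
  note c = pd_compose[of F "\<lambda>u. a \<bullet> x u" u "\<lambda>u. b \<bullet> x u", folded \<Phi>_def, OF F diff_inner_const[OF dx] diff_inner_const[OF dx]]
  show "dd w (\<lambda>u. F (\<Phi> u)) u = (a \<bullet> dd w x u) * pd 1 F (\<Phi> u) + (b \<bullet> dd w x u) * pd 2 F (\<Phi> u)"
    using c(1)[of 1] c(1)[of 2] by (simp add: dd_def pd_inner_const[OF dx] inner_add_right algebra_simps)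
  show "(\<lambda>u. F (\<Phi> u)) differentiable (at u)" by (rule c(2))
qed

lemma first_derivative:
  assumes u: "u \<in> U0"
  shows "n \<bullet> dd w x u = (a \<bullet> dd w x u) * pd 1 f (\<Phi> u) + (b \<bullet> dd w x u) * pd 2 f (\<Phi> u)"
proof -
  have "n \<bullet> dd w x u = dd w (\<lambda>v. n \<bullet> x v) u"
    by (rule dd_inner_const[symmetric]) (rule diff_x(1)[OF inU[OF u]])
  also have "\<dots> = dd w (\<lambda>v. f (\<Phi> v)) u"
    by (rule dd_cong[OF D.open_U0 u]) (simp add: f_\<Phi>)
  also have "\<dots> = (a \<bullet> dd w x u) * pd 1 f (\<Phi> u) + (b \<bullet> dd w x u) * pd 2 f (\<Phi> u)"
    by (rule dd_\<Phi>(1)[OF u diff_f(1)[OF \<Phi>_in[OF u]]])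
  finally show ?thesis .
qed

text \<open>By \<open>first_derivative\<close>, \<open>\<nu>\<close> is orthogonal to the surface
  and hence a multiple of the conormal; pairing with \<open>y\<close> gives the factor. It is
  nonzero because \<open>orth\<close> makes the product of \<open>\<nu> u\<close> with
  \<open>n\<close> equal to that of \<open>n\<close> with itself.\<close>

lemma \<nu>_\<kappa>:
  assumes u: "u \<in> U0"
  shows "\<nu> u = \<kappa> u *\<^sub>R X u" "\<kappa> u \<noteq> 0"
proof -
  have t: "\<nu> u \<bullet> pd i x u = 0" for i
    using first_derivative[OF u, of "axis i 1"] by (simp add: \<nu>_def inner_diff_left)
  show *: "\<nu> u = \<kappa> u *\<^sub>R X u"
  proof (rule vector_eq_ldot[THEN iffD1, rule_format])
    fix z
    have "\<nu> u \<bullet> z = (X u \<bullet> z) * (\<nu> u \<bullet> y u)"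
      by (subst expansion[OF inU[OF u], of z]) (simp add: inner_add_right t)
    then show "z \<bullet> \<nu> u = z \<bullet> (\<kappa> u *\<^sub>R X u)"
      by (simp add: \<kappa>_def inner_commute)
  qed
  have "\<nu> u \<bullet> n = n \<bullet> n"
    using orth by (simp add: \<nu>_def inner_diff_left inner_commute[of a] inner_commute[of b])
  then have "\<nu> u \<noteq> 0" using n0 by auto
  then show "\<kappa> u \<noteq> 0" using * by auto
qed

lemma second_derivative:
  fixes w :: "real^2"
  assumes u: "u \<in> U0"
  defines "v \<equiv> vector [a \<bullet> dd w x u, b \<bullet> dd w x u] :: real^2"
  shows "n \<bullet> dd w (dd w x) u = (a \<bullet> dd w (dd w x) u) * pd 1 f (\<Phi> u) + (b \<bullet> dd w (dd w x) u) * pd 2 f (\<Phi> u) + hess f (\<Phi> u) v"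
    "\<nu> u \<bullet> dd w (dd w x) u = hess f (\<Phi> u) v"
proof -
  note dx = diff_x[OF inU[OF u]] and q = \<Phi>_in[OF u]
  note df = dd_\<Phi>[OF u diff_f(2)[OF q]]
  have "n \<bullet> dd w (dd w x) u = dd w (\<lambda>v. n \<bullet> dd w x v) u"
    by (rule dd_inner_const[symmetric]) (rule dx)
  also have "\<dots> = dd w (\<lambda>u. (a \<bullet> dd w x u) * pd 1 f (\<Phi> u) + (b \<bullet> dd w x u) * pd 2 f (\<Phi> u)) u"
    by (rule dd_cong[OF D.open_U0 u]) (rule first_derivative)
  also have "\<dots> = (a \<bullet> dd w (dd w x) u) * pd 1 f (\<Phi> u) + (b \<bullet> dd w (dd w x) u) * pd 2 f (\<Phi> u) + hess f (\<Phi> u) v"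
    using dx df third_pd_commute(5)[OF D.open_W Ck_on_le[OF Cf] q]
    by (simp add: dd_add dd_mult dd_inner_const diff_inner_const differentiable_mult v_def hess_def power2_eq_square algebra_simps)
  finally show 1: "n \<bullet> dd w (dd w x) u = (a \<bullet> dd w (dd w x) u) * pd 1 f (\<Phi> u) + (b \<bullet> dd w (dd w x) u) * pd 2 f (\<Phi> u) + hess f (\<Phi> u) v" .
  show "\<nu> u \<bullet> dd w (dd w x) u = hess f (\<Phi> u) v"
    using 1 by (simp add: \<nu>_def inner_diff_left)
qed

text \<open>The second derivatives of the coordinates enter through \<open>\<beta>\<close>: the
  first product is \<open>cub\<close> plus \<open>3 * \<beta>\<close>, the derivative of the second
  one is \<open>cub\<close> plus \<open>2 * \<beta>\<close>. The factors 2 and 3 eliminate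
  \<open>\<beta>\<close>; by \<open>form3_A\<close> this is also the combination that defines the
  Darboux form.\<close>

lemma third_derivative:
  fixes w :: "real^2"
  assumes u: "u \<in> U0"
  defines "v \<equiv> vector [a \<bullet> dd w x u, b \<bullet> dd w x u] :: real^2"
  shows "2 * (\<nu> u \<bullet> dd w (dd w (dd w x)) u) - 3 * dd w (\<lambda>u. \<nu> u \<bullet> dd w (dd w x) u) u = - cub f (\<Phi> u) v"
proof -
  define H where "H u = (a \<bullet> dd w x u) * (a \<bullet> dd w x u) * pd 1 (pd 1 f) (\<Phi> u)
    + (2 * ((a \<bullet> dd w x u) * (b \<bullet> dd w x u)) * pd 2 (pd 1 f) (\<Phi> u) + (b \<bullet> dd w x u) * (b \<bullet> dd w x u) * pd 2 (pd 2 f) (\<Phi> u))" for u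
  have H: "hess f (\<Phi> u) (vector [a \<bullet> dd w x u, b \<bullet> dd w x u]) = H u" for u
    by (simp add: H_def hess_def power2_eq_square)
  note dx = diff_x[OF inU[OF u]] and q = \<Phi>_in[OF u]
  note df = dd_\<Phi>[OF u diff_f(2)[OF q]] dd_\<Phi>[OF u diff_f(3)[OF q]]
  note c = third_pd_commute[OF D.open_W Ck_on_le[OF Cf, of 3, simplified] q]
  define \<beta> where "\<beta> = (a \<bullet> dd w (dd w x) u) * ((a \<bullet> dd w x u) * pd 1 (pd 1 f) (\<Phi> u) + (b \<bullet> dd w x u) * pd 2 (pd 1 f) (\<Phi> u))
    + (b \<bullet> dd w (dd w x) u) * ((a \<bullet> dd w x u) * pd 2 (pd 1 f) (\<Phi> u) + (b \<bullet> dd w x u) * pd 2 (pd 2 f) (\<Phi> u))"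
  have two: "dd w (\<lambda>v. 2) u = (0::real)" by (simp add: dd_def)
  have dH: "H differentiable (at u)"
    unfolding H_def using dx df by (intro differentiable_add differentiable_mult diff_inner_const differentiable_const)
  have ddH: "dd w H u = cub f (\<Phi> u) v + 2 * \<beta>"
    unfolding H_def \<beta>_def using dx df
    by (simp add: dd_add dd_mult dd_inner_const diff_inner_const differentiable_mult differentiable_add two c
        v_def cub_def power2_eq_square power3_eq_cube algebra_simps)
  have "n \<bullet> dd w (dd w (dd w x)) u = dd w (\<lambda>v. n \<bullet> dd w (dd w x) v) u"
    by (rule dd_inner_const[symmetric]) (rule dx)
  also have "\<dots> = dd w (\<lambda>u. (a \<bullet> dd w (dd w x) u) * pd 1 f (\<Phi> u) + (b \<bullet> dd w (dd w x) u) * pd 2 f (\<Phi> u) + H u) u"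
    by (rule dd_cong[OF D.open_U0 u]) (simp add: second_derivative(1) H)
  also have "\<dots> = (a \<bullet> dd w (dd w (dd w x)) u) * pd 1 f (\<Phi> u) + (b \<bullet> dd w (dd w (dd w x)) u) * pd 2 f (\<Phi> u) + \<beta> + dd w H u"
    using dx df dH c(5)
    by (simp add: dd_add dd_mult dd_inner_const diff_inner_const differentiable_mult differentiable_add \<beta>_def algebra_simps)
  finally have "\<nu> u \<bullet> dd w (dd w (dd w x)) u = cub f (\<Phi> u) v + 3 * \<beta>"
    by (simp add: \<nu>_def inner_diff_left ddH)
  moreover have "dd w (\<lambda>u. \<nu> u \<bullet> dd w (dd w x) u) u = dd w H u"
    by (rule dd_cong[OF D.open_U0 u]) (simp add: second_derivative(2) H)
  ultimately show ?thesis by (simp add: ddH)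
qed

lemma dd_dd_x: "u \<in> U \<Longrightarrow> dd w (dd w x) u = (\<Sum>i\<in>UNIV. \<Sum>j\<in>UNIV. (w $ i * w $ j) *\<^sub>R pd j (pd i x) u)"
  unfolding dd_def[of w "dd w x"] dd_def[abs_def] using diffs[of u]
  by (simp add: sum_2 pd_add pd_scaleR differentiable_scaleR scaleR_add_right algebra_simps)

lemma X_dd_dd_x: "u \<in> U \<Longrightarrow> X u \<bullet> dd w (dd w x) u = form2 (\<lambda>i j. gm i j u) w w"
  by (simp add: dd_dd_x form2_def gm_eq inner_sum_right mult_ac)

lemma form3_A:
  assumes u: "u \<in> U"
  shows "form3 (\<lambda>i j k. A i j k u) w = X u \<bullet> dd w (dd w (dd w x)) u - 3 / 2 * dd w (\<lambda>u. X u \<bullet> dd w (dd w x) u) u"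
proof -
  have "dd w (\<lambda>u. X u \<bullet> dd w (dd w x) u) u = dd w (\<lambda>u. form2 (\<lambda>i j. gm i j u) w w) u"
    by (rule dd_cong[OF U u]) (rule X_dd_dd_x)
  also have "\<dots> = (\<Sum>i\<in>UNIV. \<Sum>j\<in>UNIV. \<Sum>k\<in>UNIV. pd k (gm i j) u * w $ i * w $ j * w $ k)"
    unfolding form2_def sum_2 dd_def using diffs[OF u]
    by (simp add: pd_add pd_mult differentiable_mult differentiable_add algebra_simps)
  finally have 1: "dd w (\<lambda>u. X u \<bullet> dd w (dd w x) u) u = (\<Sum>i\<in>UNIV. \<Sum>j\<in>UNIV. \<Sum>k\<in>UNIV. pd k (gm i j) u * w $ i * w $ j * w $ k)" .
  have "dd w (dd w (dd w x)) u = dd w (\<lambda>u. \<Sum>i\<in>UNIV. \<Sum>j\<in>UNIV. (w $ i * w $ j) *\<^sub>R pd j (pd i x) u) u"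
    by (rule dd_cong[OF U u]) (rule dd_dd_x)
  also have "\<dots> = (\<Sum>i\<in>UNIV. \<Sum>j\<in>UNIV. \<Sum>k\<in>UNIV. (w $ i * w $ j * w $ k) *\<^sub>R pd k (pd j (pd i x)) u)"
    unfolding sum_2 dd_def using diffs[OF u]
    by (simp add: pd_add pd_scaleR differentiable_scaleR differentiable_add algebra_simps)
  finally have 2: "X u \<bullet> dd w (dd w (dd w x)) u = (\<Sum>i\<in>UNIV. \<Sum>j\<in>UNIV. \<Sum>k\<in>UNIV. (X u \<bullet> pd k (pd j (pd i x)) u) * w $ i * w $ j * w $ k)"
    by (simp add: inner_sum_right mult_ac)
  show ?thesis
    unfolding 1 2 form3_def A_def sum_2 dgm_sym[OF u, of _ 2 1] by (simp add: field_simps)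
qed

text \<open>Passing from \<open>X\<close> to \<open>\<nu>\<close> multiplies by
  \<open>\<kappa>\<close> and adds a derivative of \<open>\<kappa>\<close> times
  \<open>form2\<close> on \<open>w\<close>, which is zero for a null vector. This is why the
  condition does not depend on the normalization.\<close>

lemma form_transform:
  fixes w :: "real^2"
  assumes u: "u \<in> U0"
  defines "v \<equiv> vector [a \<bullet> dd w x u, b \<bullet> dd w x u] :: real^2"
  shows "\<kappa> u * form2 (\<lambda>i j. gm i j u) w w = hess f (\<Phi> u) v"
    "form2 (\<lambda>i j. gm i j u) w w = 0 \<Longrightarrow> 2 * (\<kappa> u * form3 (\<lambda>i j k. A i j k u) w) = - cub f (\<Phi> u) v"
proof -
  show "\<kappa> u * form2 (\<lambda>i j. gm i j u) w w = hess f (\<Phi> u) v"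
    using second_derivative(2)[OF u, of w] \<nu>_\<kappa>(1)[OF u] X_dd_dd_x[OF inU[OF u], of w] by (simp add: v_def)
  assume 0: "form2 (\<lambda>i j. gm i j u) w w = 0"
  have "\<nu> differentiable (at u)"
    unfolding \<nu>_def using dd_\<Phi>(2)[OF u diff_f(2)[OF \<Phi>_in[OF u]]]
    by (intro differentiable_diff differentiable_scaleR differentiable_const)
  then have d\<kappa>: "\<kappa> differentiable (at u)"
    unfolding \<kappa>_def by (rule differentiable_inner'[OF _ diffs(9)[OF inU[OF u]]])
  have "dd w (\<lambda>u. \<nu> u \<bullet> dd w (dd w x) u) u = dd w (\<lambda>u. \<kappa> u * (X u \<bullet> dd w (dd w x) u)) u"
    by (rule dd_cong[OF D.open_U0 u]) (simp add: \<nu>_\<kappa>(1))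
  also have "\<dots> = \<kappa> u * dd w (\<lambda>u. X u \<bullet> dd w (dd w x) u) u"
    using d\<kappa> differentiable_inner'[OF diffs(5)[OF inU[OF u]] diff_x(3)[OF inU[OF u]]] X_dd_dd_x[OF inU[OF u], of w] 0
    by (simp add: dd_mult)
  finally have 1: "dd w (\<lambda>u. \<nu> u \<bullet> dd w (dd w x) u) u = \<kappa> u * dd w (\<lambda>u. X u \<bullet> dd w (dd w x) u) u" .
  have "2 * (\<kappa> u * form3 (\<lambda>i j k. A i j k u) w) = 2 * (\<nu> u \<bullet> dd w (dd w (dd w x)) u) - 3 * dd w (\<lambda>u. \<nu> u \<bullet> dd w (dd w x) u) u"
    unfolding 1 form3_A[OF inU[OF u]] \<nu>_\<kappa>(1)[OF u] by (simp add: algebra_simps)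
  then show "2 * (\<kappa> u * form3 (\<lambda>i j k. A i j k u) w) = - cub f (\<Phi> u) v"
    using third_derivative[OF u, of w] by (simp add: v_def)
qed

lemma property_b_graph:
  assumes u: "u \<in> U0"
  shows "3 * tchebychev_norm x y u = 2 * pick_invariant x y u \<longleftrightarrow>
    (\<exists>v. v \<noteq> 0 \<and> hess f (\<Phi> u) v = 0 \<and> cub f (\<Phi> u) v = 0)"
proof -
  define d where "d w = (vector [a \<bullet> dd w x u, b \<bullet> dd w x u] :: real^2)" for w
  note dx = diff_x(1)[OF inU[OF u]]
  define J where "J = (a \<bullet> pd 1 x u) * (b \<bullet> pd 2 x u) - (a \<bullet> pd 2 x u) * (b \<bullet> pd 1 x u)"
  have J: "J \<noteq> 0"
    using D.jac[OF u] by (simp add: pd_inner_const[OF dx] J_def)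
  have s: "\<exists>w. d w = v" for v
  proof
    define c1 where "c1 = (b \<bullet> pd 2 x u) * v $ 1 - (a \<bullet> pd 2 x u) * v $ 2"
    define c2 where "c2 = (a \<bullet> pd 1 x u) * v $ 2 - (b \<bullet> pd 1 x u) * v $ 1"
    have "c1 * (a \<bullet> pd 1 x u) + c2 * (a \<bullet> pd 2 x u) = J * v $ 1" "c1 * (b \<bullet> pd 1 x u) + c2 * (b \<bullet> pd 2 x u) = J * v $ 2"
      by (simp_all add: c1_def c2_def J_def algebra_simps)
    then have "c1 / J * (a \<bullet> pd 1 x u) + c2 / J * (a \<bullet> pd 2 x u) = v $ 1" "c1 / J * (b \<bullet> pd 1 x u) + c2 / J * (b \<bullet> pd 2 x u) = v $ 2"
      using J by (simp_all add: add_divide_distrib[symmetric])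
    then show "d (vector [c1 / J, c2 / J]) = v"
      by (simp add: d_def dd_def inner_add_right vec_eq_iff forall_2)
  qed
  have i: "w = 0" if "d w = 0" for w
  proof -
    have "w $ 1 * (a \<bullet> pd 1 x u) + w $ 2 * (a \<bullet> pd 2 x u) = 0" "w $ 1 * (b \<bullet> pd 1 x u) + w $ 2 * (b \<bullet> pd 2 x u) = 0"
      using that by (simp_all add: d_def dd_def inner_add_right vec_eq_iff forall_2)
    then have "w $ 1 * J = 0" "w $ 2 * J = 0" unfolding J_def by algebra+
    then show ?thesis using J by (simp add: vec_eq_iff forall_2)
  qed
  have z: "d 0 = 0" by (simp add: d_def dd_def vec_eq_iff forall_2)
  have *: "form2 (\<lambda>i j. gm i j u) w w = 0 \<and> form3 (\<lambda>i j k. A i j k u) w = 0 \<longleftrightarrow> hess f (\<Phi> u) (d w) = 0 \<and> cub f (\<Phi> u) (d w) = 0" for w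
    using form_transform[OF u, of w] \<nu>_\<kappa>(2)[OF u] unfolding d_def by auto
  show ?thesis
    unfolding property_b_iff[OF inU[OF u]]
  proof
    assume "\<exists>w. w \<noteq> 0 \<and> form2 (\<lambda>i j. gm i j u) w w = 0 \<and> form3 (\<lambda>i j k. A i j k u) w = 0"
    then obtain w where "w \<noteq> 0" "form2 (\<lambda>i j. gm i j u) w w = 0 \<and> form3 (\<lambda>i j k. A i j k u) w = 0" by blast
    then show "\<exists>v. v \<noteq> 0 \<and> hess f (\<Phi> u) v = 0 \<and> cub f (\<Phi> u) v = 0"
      using *[of w] i[of w] by blast
  next
    assume "\<exists>v. v \<noteq> 0 \<and> hess f (\<Phi> u) v = 0 \<and> cub f (\<Phi> u) v = 0"
    then obtain v where v: "v \<noteq> 0" "hess f (\<Phi> u) v = 0 \<and> cub f (\<Phi> u) v = 0" by blast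
    obtain w where w: "d w = v" using s by blast
    then have "w \<noteq> 0" using v z by blast
    then show "\<exists>w. w \<noteq> 0 \<and> form2 (\<lambda>i j. gm i j u) w w = 0 \<and> form3 (\<lambda>i j k. A i j k u) w = 0"
      using *[of w] v w by blast
  qed
qed

end

section \<open>Adapted coordinates at a point\<close>

context rel_chart
begin

text \<open>Two null directions of the relative metric at \<open>u0\<close> are mapped to
  \<open>e1\<close> and \<open>e2\<close>, and the coordinate axes are made to correspond to these,
  so that both axes are asymptotic at the point. The third property says that the three coordinates
  determine a vector.\<close>

lemma graph_exists:
  assumes u0: "u0 \<in> U"
  obtains a b n U0 W \<phi> where "rel_graph U U0 W x y a b n \<phi>" "u0 \<in> U0"
    "\<forall>z. a \<bullet> z = 0 \<longrightarrow> b \<bullet> z = 0 \<longrightarrow> n \<bullet> z = 0 \<longrightarrow> z = 0"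
    "pd 1 (pd 1 (\<lambda>q. n \<bullet> x (\<phi> q))) (vector [a \<bullet> x u0, b \<bullet> x u0]) = 0"
    "0 < pd 2 (pd 1 (\<lambda>q. n \<bullet> x (\<phi> q))) (vector [a \<bullet> x u0, b \<bullet> x u0])"
proof -
  let ?G = "\<lambda>i j. gm i j u0"
  obtain w where w: "w \<noteq> 0" "form2 ?G w w = 0"
    using null_vector_exists[of ?G] det_gm(1)[OF u0] gm_sym[OF u0] by blast
  obtain v where v: "form2 ?G v v = 0" "form2 ?G w v \<noteq> 0"
    using null_vector_completion[of ?G w] det_gm(1)[OF u0] gm_sym[OF u0] w by auto
  define e1 e2 where "e1 = dd w x u0" "e2 = dd v x u0"
  note ed = e1_e2_def
  define \<delta> where "\<delta> = w $ 1 * v $ 2 - w $ 2 * v $ 1"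
  have "\<delta> \<noteq> 0"
  proof
    assume "\<delta> = 0"
    then have "w $ 1 * form2 ?G w v = v $ 1 * form2 ?G w w" "w $ 2 * form2 ?G w v = v $ 2 * form2 ?G w w"
      unfolding \<delta>_def form2_def sum_2 by algebra+
    then show False using w v by (simp add: vec_eq_iff forall_2)
  qed
  define m where "m = e1 \<times> e2"
  have m: "m = \<delta> *\<^sub>R N u0"
    unfolding m_def N_def ed dd_def \<delta>_def
    by (simp add: cross3_simps)
  have my: "m \<bullet> y u0 \<noteq> 0" using N_y_nonzero[OF u0] \<open>\<delta> \<noteq> 0\<close> by (simp add: m)
  then have m0: "m \<noteq> 0" by auto
  \<comment> \<open>The mixed second derivative could have either sign; scaling the height by this
    number makes \<open>d\<^sup>2\<close> times it equal to \<open>c\<^sup>2\<close>.\<close>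
  define c where "c = (m \<bullet> y u0) * form2 ?G w v"
  have c0: "c \<noteq> 0" using my v by (simp add: c_def)
  \<comment> \<open>Up to the factor \<open>d\<close>, the vectors \<open>a\<close> and
    \<open>b\<close> are dual to \<open>e1\<close> and \<open>e2\<close> and vanish on the normal
    \<open>m\<close>.\<close>
  define a b n where "a = e2 \<times> m" "b = m \<times> e1" "n = c *\<^sub>R m"
  note abn = a_b_n_def
  define d where "d = m \<bullet> m"
  have d0: "d > 0" using m0 by (simp add: d_def)
  have ae: "a \<bullet> e1 = d" "a \<bullet> e2 = 0" "b \<bullet> e1 = 0" "b \<bullet> e2 = d" "m \<bullet> e1 = 0" "m \<bullet> e2 = 0" "a \<bullet> m = 0" "b \<bullet> m = 0"
    unfolding abn d_def m_def by (simp_all add: cross3_simps)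
  have decomp: "d *\<^sub>R z = (a \<bullet> z) *\<^sub>R e1 + (b \<bullet> z) *\<^sub>R e2 + (m \<bullet> z) *\<^sub>R m" for z
    unfolding abn d_def m_def vec_eq_iff forall_3
    by (simp add: cross3_def inner_vec_def sum_3 algebra_simps)
  have full: "z = 0" if "a \<bullet> z = 0" "b \<bullet> z = 0" "n \<bullet> z = 0" for z
    using decomp[of z] that d0 c0 by (simp add: abn)
  note dx = diffs(1)[OF u0]
  have C: "Ck_on 4 (\<lambda>u. k \<bullet> x u) U" for k
    by (intro Ck_on_inner Ck_on_const U x4)
  have "(a \<bullet> pd 1 x u0) * (b \<bullet> pd 2 x u0) - (a \<bullet> pd 2 x u0) * (b \<bullet> pd 1 x u0) \<noteq> 0" (is "?J \<noteq> 0")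
  proof -
    have "\<delta> * ?J = (a \<bullet> e1) * (b \<bullet> e2) - (a \<bullet> e2) * (b \<bullet> e1)"
      unfolding ed dd_def \<delta>_def by (simp add: inner_add_right algebra_simps)
    then show ?thesis using ae d0 by auto
  qed
  then have jac: "pd 1 (\<lambda>u. a \<bullet> x u) u0 * pd 2 (\<lambda>u. b \<bullet> x u) u0 - pd 2 (\<lambda>u. a \<bullet> x u) u0 * pd 1 (\<lambda>u. b \<bullet> x u) u0 \<noteq> 0"
    by (simp add: pd_inner_const[OF dx])
  obtain U0 W \<phi> where U0: "U0 \<subseteq> U" "u0 \<in> U0" "plane_diffeo U0 W (\<lambda>u. a \<bullet> x u) (\<lambda>u. b \<bullet> x u) \<phi> 4"
    using plane_diffeo_exists[OF U u0 C C _ jac] by auto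
  interpret D: plane_diffeo U0 W "\<lambda>u. a \<bullet> x u" "\<lambda>u. b \<bullet> x u" \<phi> 4 by (rule U0(3))
  interpret R: rel_graph U U0 W x y a b n \<phi>
    by unfold_locales (use U0 ae c0 m0 in \<open>auto simp: abn(3) inner_commute\<close>)
  have f1: "pd 1 R.f (R.\<Phi> u0) = 0" "pd 2 R.f (R.\<Phi> u0) = 0"
    using R.first_derivative[OF U0(2), of w] R.first_derivative[OF U0(2), of v] ae d0
    unfolding ed[symmetric] by (auto simp: abn(3))
  then have \<kappa>: "R.\<kappa> u0 = c * (m \<bullet> y u0)"
    unfolding R.\<kappa>_def R.\<nu>_def f1 by (simp add: abn(3))
  have dd_add': "dd (w + v) x u0 = e1 + e2"
    by (simp add: ed dd_def algebra_simps)
  \<comment> \<open>Both quadratic forms vanish on \<open>w\<close> and on \<open>v\<close>, so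
    their values on \<open>w + v\<close> isolate the mixed coefficients.\<close>
  have g2: "form2 ?G (w + v) (w + v) = 2 * form2 ?G w v"
  proof -
    have "form2 ?G (w + v) (w + v) = form2 ?G w w + form2 ?G v v + 2 * form2 ?G w v"
      unfolding form2_def sum_2 gm_sym[OF u0, of 2 1] by (simp add: algebra_simps)
    then show ?thesis using w v by simp
  qed
  have h: "pd 1 (pd 1 R.f) (R.\<Phi> u0) = 0" "pd 2 (pd 2 R.f) (R.\<Phi> u0) = 0"
    using R.form_transform(1)[OF U0(2), of w] R.form_transform(1)[OF U0(2), of v] w v ae d0
    unfolding ed[symmetric] by (auto simp: hess_def)
  have "R.\<kappa> u0 * (2 * form2 ?G w v) = 2 * d\<^sup>2 * pd 2 (pd 1 R.f) (R.\<Phi> u0)"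
    using R.form_transform(1)[OF U0(2), of "w + v"] ae h unfolding dd_add' g2
    by (simp add: hess_def inner_add_right power2_eq_square)
  then have "d\<^sup>2 * pd 2 (pd 1 R.f) (R.\<Phi> u0) = c\<^sup>2"
    unfolding \<kappa> by (simp add: c_def power2_eq_square mult_ac)
  then have "0 < pd 2 (pd 1 R.f) (R.\<Phi> u0)"
    using d0 c0 by (metis zero_less_mult_pos zero_less_power2 less_irrefl)
  with h(1) show ?thesis
    using that[OF R.rel_graph_axioms U0(2)] full unfolding R.f_def[abs_def] R.\<Phi>_def by blast
qed

end

section \<open>Charts\<close>

lemma chart_facts:
  assumes c: "is_chart M c"
  defines "P \<equiv> inv_into (fst c) (snd c)"
  shows "fst c \<subseteq> topspace M" "inj_on (snd c) (fst c)"
    "\<And>u. u \<in> chart_image c \<Longrightarrow> P u \<in> fst c \<and> snd c (P u) = u"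
    "\<And>p. p \<in> fst c \<Longrightarrow> snd c p \<in> chart_image c \<and> P (snd c p) = p"
    "\<And>Q. openin M Q \<Longrightarrow> open (snd c ` (fst c \<inter> Q))"
    "\<And>V. open V \<Longrightarrow> openin M {p \<in> fst c. snd c p \<in> V}"
    "continuous_map (top_of_set (chart_image c)) M P"
proof -
  have o: "openin M (fst c)" "open (chart_image c)"
    and h: "homeomorphic_map (subtopology M (fst c)) (top_of_set (chart_image c)) (snd c)"
    using c by (auto simp: is_chart_def)
  show sub: "fst c \<subseteq> topspace M" using openin_subset[OF o(1)] .
  then have ts: "topspace (subtopology M (fst c)) = fst c" by auto
  show inj: "inj_on (snd c) (fst c)"
    using homeomorphic_imp_injective_map[OF h] ts by simp
  show P: "P u \<in> fst c \<and> snd c (P u) = u" if "u \<in> chart_image c" for u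
    using that by (auto simp: P_def chart_image_def intro: inv_into_into f_inv_into_f)
  show "snd c p \<in> chart_image c \<and> P (snd c p) = p" if "p \<in> fst c" for p
    using that inj by (simp add: P_def chart_image_def)
  show "open (snd c ` (fst c \<inter> Q))" if "openin M Q" for Q
  proof -
    have "openin (subtopology M (fst c)) (fst c \<inter> Q)"
      using that by (simp add: openin_subtopology_Int2)
    then have "openin (top_of_set (chart_image c)) (snd c ` (fst c \<inter> Q))"
      using homeomorphic_imp_open_map[OF h] by (simp add: open_map_def)
    then show ?thesis using o(2) by (rule openin_open_trans)
  qed
  show "openin M {p \<in> fst c. snd c p \<in> V}" if "open V" for V
  proof -
    have "openin (top_of_set (chart_image c)) (chart_image c \<inter> V)"
      using that by (simp add: openin_open_Int)
    from openin_continuous_map_preimage[OF homeomorphic_imp_continuous_map[OF h] this]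
    have "openin (subtopology M (fst c)) {p \<in> fst c. snd c p \<in> chart_image c \<inter> V}"
      unfolding ts .
    moreover have "{p \<in> fst c. snd c p \<in> chart_image c \<inter> V} = {p \<in> fst c. snd c p \<in> V}"
      by (auto simp: chart_image_def)
    ultimately show ?thesis using o(1) by (metis openin_trans_full)
  qed
  show "continuous_map (top_of_set (chart_image c)) M P"
  proof -
    obtain g where g: "homeomorphic_maps (subtopology M (fst c)) (top_of_set (chart_image c)) (snd c) g"
      using h homeomorphic_map_maps by blast
    have cg: "continuous_map (top_of_set (chart_image c)) (subtopology M (fst c)) g"
      using g by (simp add: homeomorphic_maps_def)
    have "g u = P u" if "u \<in> chart_image c" for u
    proof -
      have "g u \<in> fst c" using cg that ts by (auto simp: continuous_map_def Pi_iff)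
      moreover have "snd c (g u) = u" using g that by (simp add: homeomorphic_maps_def)
      ultimately show ?thesis using P[OF that] inj by (metis inj_onD)
    qed
    then show ?thesis
      using continuous_map_eq[of "top_of_set (chart_image c)" M g P] continuous_map_into_fulltopology[OF cg] by simp
  qed
qed

lemma in_chart_apply: "in_chart c f u = f (inv_into (fst c) (snd c) u)"
  by (simp add: in_chart_def)

context
  fixes M :: "'m topology" and \<A> :: "'m chart set" and x :: "'m \<Rightarrow> real^3" and r :: nat
  assumes r: "4 \<le> r" and surf: "surface r M \<A> x" and neg: "negatively_curved \<A> x"
begin

lemma chart: "c \<in> \<A> \<Longrightarrow> is_chart M c"
  and chart_cover: "p \<in> topspace M \<Longrightarrow> \<exists>c\<in>\<A>. p \<in> fst c"
  and Ck_x: "c \<in> \<A> \<Longrightarrow> Ck_on r (in_chart c x) (chart_image c)"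
  using surf unfolding surface_def oriented_manifold2_def Ck_map_def by auto

lemma chart_open: "c \<in> \<A> \<Longrightarrow> open (chart_image c)"
  using chart by (auto simp: is_chart_def)

text \<open>If the product were zero, so would be the determinant of the first form, and the
  curvature would take the default value 0 of a division by zero, which is not negative.\<close>

lemma normal_nonzero:
  assumes "c \<in> \<A>" "u \<in> chart_image c"
  shows "pd 1 (in_chart c x) u \<times> pd 2 (in_chart c x) u \<noteq> 0"
proof
  assume 0: "pd 1 (in_chart c x) u \<times> pd 2 (in_chart c x) u = 0"
  have "gauss_curvature (in_chart c x) u < 0"
    using neg assms by (simp add: negatively_curved_def)
  then show False using 0 by (simp add: gauss_curvature_def det_first_form)
qed

lemma rel_chart_of_normalization:
  assumes s: "1 \<le> s" and y: "relative_normalization s \<A> x y" and c: "c \<in> \<A>"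
  shows "rel_chart (chart_image c) (in_chart c x) (in_chart c y)"
proof
  show "open (chart_image c)" using chart_open[OF c] .
  show "Ck_on 4 (in_chart c x) (chart_image c)" using Ck_on_le[OF Ck_x[OF c] r] .
  have "Ck_on s (in_chart c y) (chart_image c)"
    using y c by (simp add: relative_normalization_def Ck_map_def)
  then show "Ck_on 1 (in_chart c y) (chart_image c)" by (rule Ck_on_le[OF _ s])
  fix u assume u: "u \<in> chart_image c"
  show "gauss_curvature (in_chart c x) u < 0"
    using neg c u by (simp add: negatively_curved_def)
  show "distinct [pd 1 (in_chart c x) u, pd 2 (in_chart c x) u, in_chart c y u]"
    "independent {pd 1 (in_chart c x) u, pd 2 (in_chart c x) u, in_chart c y u}"
    "\<And>i. pd i (in_chart c y) u \<in> span {pd 1 (in_chart c x) u, pd 2 (in_chart c x) u}"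
    using y c u unfolding relative_normalization_def Let_def by blast+
qed

section \<open>The Euclidean normalization\<close>

text \<open>A coordinate change multiplies the cross product of the partial derivatives by its
  Jacobian determinant; this is positive by orientation and disappears on normalizing.\<close>

lemma unit_normal_chart_change:
  assumes c: "c \<in> \<A>" "c' \<in> \<A>" and p: "p \<in> fst c" "p \<in> fst c'"
  shows "unit_normal (in_chart c x) (snd c p) = unit_normal (in_chart c' x) (snd c' p)"
proof -
  define \<tau> where "\<tau> = in_chart c (snd c')"
  define V where "V = snd c ` (fst c \<inter> fst c')"
  let ?u = "snd c p"
  note C = chart_facts[OF chart[OF c(1)]] and C' = chart_facts[OF chart[OF c(2)]]
  have V: "open V" "?u \<in> V"
    using C(5)[of "fst c'"] chart[OF c(2)] p by (auto simp: V_def is_chart_def)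
  have C\<tau>: "Ck_on r \<tau> V" and det: "det (jacobian \<tau> (at ?u)) > 0"
    using surf c V(2) unfolding surface_def oriented_manifold2_def \<tau>_def V_def by blast+
  then have d\<tau>: "\<tau> differentiable (at ?u)"
    using Ck_on_differentiable[OF C\<tau> _ V(2)] r by simp
  have \<tau>u: "\<tau> ?u = snd c' p" using C(4)[OF p(1)] by (simp add: \<tau>_def in_chart_apply)
  have eq: "in_chart c x v = in_chart c' x (\<tau> v)" if v: "v \<in> V" for v
  proof -
    obtain q where q: "q \<in> fst c" "q \<in> fst c'" "v = snd c q" using v by (auto simp: V_def)
    then show ?thesis using C(4)[OF q(1)] C'(4)[OF q(2)] by (simp add: in_chart_apply \<tau>_def)
  qed
  let ?x' = "in_chart c' x"
  have "?x' differentiable (at (\<tau> ?u))"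
    using Ck_on_differentiable[OF Ck_x[OF c(2)]] C'(4)[OF p(2)] r \<tau>u by auto
  from has_derivative_compose[OF d\<tau>[unfolded frechet_derivative_works] has_derivative_pd[OF this]]
  have "pd i (\<lambda>v. ?x' (\<tau> v)) ?u = pd i \<tau> ?u $ 1 *\<^sub>R pd 1 ?x' (snd c' p) + pd i \<tau> ?u $ 2 *\<^sub>R pd 2 ?x' (snd c' p)" for i
    unfolding \<tau>u using pd_eq[of "\<lambda>v. ?x' (\<tau> v)" _ ?u i] by (simp add: pd_def[of i \<tau>])
  moreover have "pd i (in_chart c x) ?u = pd i (\<lambda>v. ?x' (\<tau> v)) ?u" for i
    by (rule pd_cong[OF V eq])
  ultimately have pdx: "pd i (in_chart c x) ?u = pd i \<tau> ?u $ 1 *\<^sub>R pd 1 ?x' (snd c' p) + pd i \<tau> ?u $ 2 *\<^sub>R pd 2 ?x' (snd c' p)" for i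
    by simp
  define d where "d = pd 1 \<tau> ?u $ 1 * pd 2 \<tau> ?u $ 2 - pd 2 \<tau> ?u $ 1 * pd 1 \<tau> ?u $ 2"
  have "d > 0"
    using det by (simp add: jacobian_def matrix_def det_2 d_def pd_def mult_ac)
  have "pd 1 (in_chart c x) ?u \<times> pd 2 (in_chart c x) ?u = d *\<^sub>R (pd 1 ?x' (snd c' p) \<times> pd 2 ?x' (snd c' p))"
    unfolding pdx d_def by (simp add: cross3_simps)
  then show ?thesis
    using \<open>d > 0\<close> by (simp add: unit_normal_def Let_def)
qed

text \<open>A normalization lives on the manifold, hence the choice of a chart at each point; by
  \<open>unit_normal_chart_change\<close> the value does not depend on it.\<close>

definition euclidean_normal :: "'m \<Rightarrow> real^3" where
  "euclidean_normal p = (let c = SOME c. c \<in> \<A> \<and> p \<in> fst c in unit_normal (in_chart c x) (snd c p))"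

lemma euclidean_normal_in_chart:
  assumes c: "c \<in> \<A>" and u: "u \<in> chart_image c"
  shows "in_chart c euclidean_normal u = unit_normal (in_chart c x) u"
proof -
  let ?p = "inv_into (fst c) (snd c) u"
  have p: "?p \<in> fst c" "snd c ?p = u" using chart_facts(3)[OF chart[OF c] u] by auto
  define c' where "c' = (SOME c. c \<in> \<A> \<and> ?p \<in> fst c)"
  have "c' \<in> \<A> \<and> ?p \<in> fst c'"
    unfolding c'_def by (rule someI[of _ c]) (use c p in auto)
  then have "unit_normal (in_chart c x) u = unit_normal (in_chart c' x) (snd c' ?p)"
    using unit_normal_chart_change[OF c _ p(1), of c'] p(2) by simp
  then show ?thesis
    by (simp add: in_chart_apply euclidean_normal_def c'_def[symmetric] Let_def)
qed

text \<open>The normal is one class less smooth than \<open>x\<close>, which \<open>s < r\<close>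
  permits. Its derivatives are tangential because its length is constant.\<close>

lemma relative_normalization_euclidean_normal:
  assumes s: "s < r"
  shows "relative_normalization s \<A> x euclidean_normal"
proof -
  have "Ck_on s (in_chart c euclidean_normal) (chart_image c) \<and>
      (\<forall>u\<in>chart_image c. let x1 = pd 1 (in_chart c x) u; x2 = pd 2 (in_chart c x) u; y0 = in_chart c euclidean_normal u
        in distinct [x1, x2, y0] \<and> independent {x1, x2, y0} \<and>
           (\<forall>i. pd i (in_chart c euclidean_normal) u \<in> span {x1, x2}))" if c: "c \<in> \<A>" for c
  proof (intro conjI ballI)
    let ?x = "in_chart c x" and ?y = "in_chart c euclidean_normal" and ?U = "chart_image c"
    note U = chart_open[OF c]
    define N where "N u = pd 1 ?x u \<times> pd 2 ?x u" for u
    have N0: "N u \<noteq> 0" if "u \<in> ?U" for u using normal_nonzero[OF c that] by (simp add: N_def)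
    have y: "?y u = inverse (sqrt (N u \<bullet> N u)) *\<^sub>R N u" if "u \<in> ?U" for u
      unfolding euclidean_normal_in_chart[OF c that]
      by (simp add: unit_normal_def Let_def N_def norm_eq_sqrt_inner)
    have CN: "Ck_on (r - 1) N ?U"
      unfolding N_def by (intro Ck_on_cross3 U Ck_on_pd[OF Ck_x[OF c]]) (use r in auto)
    have Cy: "Ck_on (r - 1) ?y ?U"
    proof (rule Ck_on_cong[OF U y[symmetric]])
      show "Ck_on (r - 1) (\<lambda>u. inverse (sqrt (N u \<bullet> N u)) *\<^sub>R N u) ?U"
        by (intro Ck_on_scaleR Ck_on_inverse Ck_on_sqrt Ck_on_inner U CN) (use N0 in auto)
    qed
    then show "Ck_on s ?y ?U" by (rule Ck_on_le) (use s in simp)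
    fix u assume u: "u \<in> ?U"
    let ?a = "pd 1 ?x u" and ?b = "pd 2 ?x u"
    have ya: "?y u \<bullet> ?a = 0" "?y u \<bullet> ?b = 0"
      by (simp_all add: y[OF u] N_def dot_cross_self)
    have yy: "?y v \<bullet> ?y v = 1" if "v \<in> ?U" for v
      using N0[OF that] by (simp add: y[OF that] field_simps)
    have ab: "?a \<times> ?b \<noteq> 0" using N0[OF u] by (simp add: N_def)
    have b0: "?b \<noteq> 0" using ab by auto
    have a: "?a \<notin> span {?b}"
    proof
      assume "?a \<in> span {?b}"
      then obtain k where "?a = k *\<^sub>R ?b" by (auto simp: span_singleton)
      then show False using ab by (simp add: cross_mult_left)
    qed
    have nots: "?y u \<notin> span {?a, ?b}"
    proof
      assume "?y u \<in> span {?a, ?b}"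
      then have "orthogonal (?y u) (?y u)"
        by (rule orthogonal_to_span) (use ya in \<open>auto simp: orthogonal_def\<close>)
      then show False using yy[OF u] by (simp add: orthogonal_def)
    qed
    have dist: "distinct [?a, ?b, ?y u]"
      using a nots by (auto intro: span_base)
    have "independent {?b}" using b0 by simp
    then have "independent {?a, ?b}" using a by (simp add: independent_insert)
    then have "independent (insert (?y u) {?a, ?b})" using nots independent_insert by metis
    then have ind: "independent {?a, ?b, ?y u}" by (simp add: insert_commute)
    have tang: "pd i ?y u \<in> span {?a, ?b}" for i
    proof -
      have "?y differentiable (at u)" using Ck_on_differentiable[OF Cy _ u] r by simp
      then have "pd i (\<lambda>v. ?y v \<bullet> ?y v) u = 2 * (?y u \<bullet> pd i ?y u)"
        by (simp add: pd_inner inner_commute)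
      moreover have "pd i (\<lambda>v. ?y v \<bullet> ?y v) u = pd i (\<lambda>v. 1) u"
        by (rule pd_cong[OF U u]) (rule yy)
      ultimately have 0: "?y u \<bullet> pd i ?y u = 0" by simp
      have "card {?a, ?b, ?y u} = 3" using dist by simp
      then have "span {?y u, ?a, ?b} = UNIV"
        using card_eq_dim[of "{?a, ?b, ?y u}" UNIV] ind by (auto simp: insert_commute)
      then have "pd i ?y u \<in> span {?y u, ?a, ?b}" by simp
      then obtain k where k: "pd i ?y u - k *\<^sub>R ?y u \<in> span {?a, ?b}"
        unfolding span_insert[of "?y u"] by auto
      then have "orthogonal (?y u) (pd i ?y u - k *\<^sub>R ?y u)"
        by (rule orthogonal_to_span) (use ya in \<open>auto simp: orthogonal_def\<close>)
      then have "k = 0" using 0 yy[OF u] by (simp add: orthogonal_def inner_diff_right)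
      then show ?thesis using k by simp
    qed
    show "let x1 = ?a; x2 = ?b; y0 = ?y u in distinct [x1, x2, y0] \<and> independent {x1, x2, y0} \<and>
        (\<forall>i. pd i ?y u \<in> span {x1, x2})"
      unfolding Let_def using dist ind tang by blast
  qed
  then show ?thesis by (simp add: relative_normalization_def Ck_map_def)
qed

section \<open>Ruled surfaces\<close>

lemma property_b_imp_ruled:
  assumes s: "1 \<le> s" and y: "relative_normalization s \<A> x y" and b: "property_b \<A> x y"
  shows "ruled M x"
  unfolding ruled_def
proof
  fix p assume "p \<in> topspace M"
  then obtain c where c: "c \<in> \<A>" "p \<in> fst c" using chart_cover by blast
  note C = chart_facts[OF chart[OF c(1)]]
  let ?U = "chart_image c" and ?x = "in_chart c x" and ?y = "in_chart c y"
  let ?P = "inv_into (fst c) (snd c)" and ?u = "snd c p"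
  interpret rel_chart ?U ?x ?y by (rule rel_chart_of_normalization[OF s y c(1)])
  have u: "?u \<in> ?U" "?P ?u = p" using C(4)[OF c(2)] by auto
  obtain a b n U0 W \<phi> where g: "rel_graph ?U U0 W ?x ?y a b n \<phi>" "?u \<in> U0"
    "\<forall>z. a \<bullet> z = 0 \<longrightarrow> b \<bullet> z = 0 \<longrightarrow> n \<bullet> z = 0 \<longrightarrow> z = 0"
    "pd 1 (pd 1 (\<lambda>q. n \<bullet> ?x (\<phi> q))) (vector [a \<bullet> ?x ?u, b \<bullet> ?x ?u]) = 0"
    "0 < pd 2 (pd 1 (\<lambda>q. n \<bullet> ?x (\<phi> q))) (vector [a \<bullet> ?x ?u, b \<bullet> ?x ?u])"
    by (rule graph_exists[OF u(1)])
  interpret rel_graph ?U U0 W ?x ?y a b n \<phi> by (rule g(1))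
  have "\<exists>v. v \<noteq> 0 \<and> hess f q v = 0 \<and> cub f q v = 0" if "q \<in> W" for q
  proof -
    have "\<phi> q \<in> U0" using D.\<phi>_in[OF that] .
    moreover from inU[OF this] have "3 * tchebychev_norm ?x ?y (\<phi> q) = 2 * pick_invariant ?x ?y (\<phi> q)"
      using b c(1) unfolding property_b_def Let_def by blast
    ultimately show ?thesis using property_b_graph[of "\<phi> q"] \<Phi>_\<phi>[OF that] by simp
  qed
  moreover have "pd 1 (pd 1 f) (\<Phi> ?u) = 0" "0 < pd 2 (pd 1 f) (\<Phi> ?u)"
    using g(4,5) unfolding f_def[abs_def] \<Phi>_def .
  ultimately have "\<exists>v \<delta> k. v \<noteq> 0 \<and> 0 < \<delta> \<and> (\<forall>t\<in>{0..\<delta>}. \<Phi> ?u + t *\<^sub>R v \<in> W \<and> f (\<Phi> ?u + t *\<^sub>R v) = f (\<Phi> ?u) + t * k)"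
    by (intro graph_contains_segment[OF D.open_W \<Phi>_in[OF g(2)] Cf])
  then obtain v \<delta> k where v: "v \<noteq> 0" "0 < \<delta>"
    "\<And>t. t \<in> {0..\<delta>} \<Longrightarrow> \<Phi> ?u + t *\<^sub>R v \<in> W \<and> f (\<Phi> ?u + t *\<^sub>R v) = f (\<Phi> ?u) + t * k"
    by blast
  define L where "L t = \<Phi> ?u + (t * \<delta>) *\<^sub>R v" for t
  define \<gamma> where "\<gamma> t = ?P (\<phi> (L t))" for t
  have in01: "t * \<delta> \<in> {0..\<delta>}" if "t \<in> {0..1}" for t
    using that v(2) by (auto simp: mult_left_le_one_le)
  have LW: "L t \<in> W" "f (L t) = f (\<Phi> ?u) + (t * \<delta>) * k" if "t \<in> {0..1}" for t
    using v(3)[OF in01[OF that]] by (auto simp: L_def)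
  have \<phi>L: "\<phi> (L t) \<in> U0" "\<phi> (L t) \<in> ?U" if "t \<in> {0..1}" for t
    using D.\<phi>_in[OF LW(1)[OF that]] U0_sub by auto
  have x\<gamma>: "x (\<gamma> t) = ?x (\<phi> (L t))" for t by (simp add: \<gamma>_def in_chart_apply)
  have co: "a \<bullet> x (\<gamma> t) = L t $ 1" "b \<bullet> x (\<gamma> t) = L t $ 2" "n \<bullet> x (\<gamma> t) = f (L t)" if "t \<in> {0..1}" for t
  proof -
    have "\<Phi> (\<phi> (L t)) = L t" by (rule \<Phi>_\<phi>[OF LW(1)[OF that]])
    then show "a \<bullet> x (\<gamma> t) = L t $ 1" "b \<bullet> x (\<gamma> t) = L t $ 2"
      unfolding x\<gamma> by (simp_all add: \<Phi>_def vec_eq_iff forall_2)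
    show "n \<bullet> x (\<gamma> t) = f (L t)" unfolding x\<gamma> by (simp add: f_def)
  qed
  have L0: "L 0 = \<Phi> ?u" by (simp add: L_def)
  have \<gamma>0: "\<gamma> 0 = p" using \<phi>_\<Phi>[OF g(2)] u(2) by (simp add: \<gamma>_def L0)
  have "x (\<gamma> t) = linepath (x (\<gamma> 0)) (x (\<gamma> 1)) t" if t: "t \<in> {0..1}" for t
  proof -
    \<comment> \<open>By \<open>g(3)\<close> it suffices to compare the \<open>a\<close>,
      \<open>b\<close> and \<open>n\<close> components, all of which are affine in \<open>t\<close>
      on the lifted segment.\<close>
    have "x (\<gamma> t) - ((1 - t) *\<^sub>R x (\<gamma> 0) + t *\<^sub>R x (\<gamma> 1)) = 0"
      by (rule g(3)[rule_format]; simp add: inner_diff_right inner_add_right co[OF t] co[of 0] co[of 1] LW(2)[OF t] LW(2)[of 0] LW(2)[of 1])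
         (simp_all add: L_def algebra_simps)
    then show ?thesis by (simp add: linepath_def)
  qed
  moreover have "x (\<gamma> 0) \<noteq> x (\<gamma> 1)"
  proof
    assume "x (\<gamma> 0) = x (\<gamma> 1)"
    then have "L 0 $ 1 = L 1 $ 1" "L 0 $ 2 = L 1 $ 2"
      using co(1)[of 0] co(1)[of 1] co(2)[of 0] co(2)[of 1] by auto
    then have "L 0 = L 1" by (simp add: vec_eq_iff forall_2)
    then show False using v by (simp add: L_def)
  qed
  moreover have "pathin M \<gamma>"
  proof -
    have "continuous_on {0..1} L" unfolding L_def by (intro continuous_intros)
    moreover have "continuous_on W \<phi>" using D.hom by (simp add: homeomorphism_def)
    ultimately have "continuous_on {0..1} (\<lambda>t. \<phi> (L t))"
      using LW(1) by (intro continuous_on_compose2[of W \<phi> "{0..1}" L]) auto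
    then have "continuous_map (top_of_set {0..1}) (top_of_set ?U) (\<lambda>t. \<phi> (L t))"
      using \<phi>L(2) by auto
    from continuous_map_compose[OF this C(7)] show ?thesis
      by (simp add: pathin_def \<gamma>_def[abs_def] o_def)
  qed
  moreover have "p \<in> \<gamma> ` {0..1}" using \<gamma>0 by (auto intro!: image_eqI[of _ _ 0])
  ultimately show "\<exists>a b \<gamma>. a \<noteq> b \<and> pathin M \<gamma> \<and> p \<in> \<gamma> ` {0..1} \<and> (\<forall>t\<in>{0..1}. x (\<gamma> t) = linepath a b t)"
    by blast
qed

lemma ruled_imp_property_b:
  assumes s: "1 \<le> s" and y: "relative_normalization s \<A> x y" and ruled: "ruled M x"
  shows "property_b \<A> x y"
  unfolding property_b_def Let_def
proof (intro ballI)
  fix c u assume c: "c \<in> \<A>" and u: "u \<in> chart_image c"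
  note C = chart_facts[OF chart[OF c]]
  let ?U = "chart_image c" and ?x = "in_chart c x" and ?y = "in_chart c y"
  let ?P = "inv_into (fst c) (snd c)"
  interpret rel_chart ?U ?x ?y by (rule rel_chart_of_normalization[OF s y c])
  obtain a b n U0 W \<phi> where g: "rel_graph ?U U0 W ?x ?y a b n \<phi>" "u \<in> U0"
    "\<forall>z. a \<bullet> z = 0 \<longrightarrow> b \<bullet> z = 0 \<longrightarrow> n \<bullet> z = 0 \<longrightarrow> z = 0"
    "pd 1 (pd 1 (\<lambda>q. n \<bullet> ?x (\<phi> q))) (vector [a \<bullet> ?x u, b \<bullet> ?x u]) = 0"
    "0 < pd 2 (pd 1 (\<lambda>q. n \<bullet> ?x (\<phi> q))) (vector [a \<bullet> ?x u, b \<bullet> ?x u])"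
    by (rule graph_exists[OF u])
  interpret rel_graph ?U U0 W ?x ?y a b n \<phi> by (rule g(1))
  define p where "p = ?P u"
  have p: "p \<in> fst c" "snd c p = u" using C(3)[OF u] by (auto simp: p_def)
  then obtain a' b' \<gamma> where \<gamma>: "a' \<noteq> b'" "pathin M \<gamma>" "p \<in> \<gamma> ` {0..1}" "\<And>t. t \<in> {0..1} \<Longrightarrow> x (\<gamma> t) = linepath a' b' t"
    using ruled C(1) unfolding ruled_def by (meson subsetD)
  then obtain t0 where t0: "t0 \<in> {0..1}" "\<gamma> t0 = p" by auto
  define Q where "Q = {p \<in> fst c. snd c p \<in> U0}"
  have "openin M Q" unfolding Q_def by (rule C(6)[OF D.open_U0])
  from openin_continuous_map_preimage[OF \<gamma>(2)[unfolded pathin_def] this]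
  have "openin (top_of_set {0..1}) {t \<in> {0..1}. \<gamma> t \<in> Q}" by simp
  moreover have "t0 \<in> {t \<in> {0..1}. \<gamma> t \<in> Q}" using t0 p g(2) by (simp add: Q_def)
  ultimately obtain e where e: "0 < e" "\<And>t. t \<in> {0..1} \<Longrightarrow> dist t t0 < e \<Longrightarrow> \<gamma> t \<in> Q"
    unfolding openin_euclidean_subtopology_iff by blast
  \<comment> \<open>The parameter \<open>t0\<close> may be an end of the unit interval;
    \<open>\<sigma>\<close> is a direction in which a half-open piece of the segment
    remains.\<close>
  obtain \<sigma> e' where \<sigma>: "\<sigma> = 1 \<or> \<sigma> = (-1::real)" "0 < e'" "e' \<le> e" "\<And>t. t \<in> {0..<e'} \<Longrightarrow> t0 + \<sigma> * t \<in> {0..1}"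
  proof (cases "t0 < 1")
    case True
    then show ?thesis using that[of 1 "min e (1 - t0)"] e t0 by auto
  next
    case False
    then show ?thesis using that[of "-1" "min e 1"] e t0 by auto
  qed
  define h where "h = \<sigma> *\<^sub>R (b' - a')"
  define v where "v = (vector [a \<bullet> h, b \<bullet> h] :: real^2)"
  define w where "w t = snd c (\<gamma> (t0 + \<sigma> * t))" for t
  have h0: "h \<noteq> 0" using \<sigma>(1) \<gamma>(1) by (auto simp: h_def)
  have w: "w t \<in> U0" "?x (w t) = ?x u + t *\<^sub>R h" if t: "t \<in> {0..<e'}" for t
  proof -
    have "dist (t0 + \<sigma> * t) t0 < e" using \<sigma>(1,3) t by (auto simp: dist_real_def)
    then have q: "\<gamma> (t0 + \<sigma> * t) \<in> Q" using e(2) \<sigma>(4)[OF t] by blast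
    then show "w t \<in> U0" by (simp add: w_def Q_def)
    have "?x (w t) = x (\<gamma> (t0 + \<sigma> * t))" using q C(4) by (simp add: w_def in_chart_apply Q_def)
    also have "\<dots> = linepath a' b' (t0 + \<sigma> * t)" by (rule \<gamma>(4)[OF \<sigma>(4)[OF t]])
    also have "\<dots> = linepath a' b' t0 + t *\<^sub>R h" using \<sigma>(1) by (auto simp: linepath_def h_def algebra_simps)
    also have "linepath a' b' t0 = ?x u" using \<gamma>(4)[OF t0(1)] t0 by (simp add: in_chart_apply p_def)
    finally show "?x (w t) = ?x u + t *\<^sub>R h" .
  qed
  have \<Phi>w: "\<Phi> (w t) = \<Phi> u + t *\<^sub>R v" if "t \<in> {0..<e'}" for t
    by (simp add: \<Phi>_def v_def w(2)[OF that] vec_eq_iff forall_2 inner_add_right)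
  have "\<Phi> u + t *\<^sub>R v \<in> W \<and> f (\<Phi> u + t *\<^sub>R v) = f (\<Phi> u) + t * (n \<bullet> h)" if t: "t \<in> {0..<e'}" for t
    unfolding \<Phi>w[OF t, symmetric] using \<Phi>_in[OF w(1)[OF t]] f_\<Phi>[OF w(1)[OF t]] f_\<Phi>[OF g(2)] w(2)[OF t]
    by (simp add: inner_add_right)
  from straight_segment_asymptotic[OF D.open_W Cf \<sigma>(2) this]
  have "hess f (\<Phi> u) v = 0" "cub f (\<Phi> u) v = 0" by auto
  \<comment> \<open>\<open>v\<close> is only the projection of the segment direction to the
    coordinate plane. Were it zero, injectivity of the coordinates would keep the curve at
    \<open>u\<close>, although its image moves along \<open>h\<close>.\<close>
  moreover have "v \<noteq> 0"
  proof
    assume "v = 0"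
    have t: "e' / 2 \<in> {0..<e'}" using \<sigma>(2) by simp
    have "\<Phi> (w (e' / 2)) = \<Phi> u" using \<Phi>w[OF t] \<open>v = 0\<close> by simp
    then have "w (e' / 2) = u" using \<phi>_\<Phi>[OF w(1)[OF t]] \<phi>_\<Phi>[OF g(2)] by metis
    then have "(e' / 2) *\<^sub>R h = 0" using w(2)[OF t] by simp
    then show False using h0 \<sigma>(2) by simp
  qed
  ultimately show "3 * tchebychev_norm ?x ?y u = 2 * pick_invariant ?x ?y u"
    using property_b_graph[OF g(2)] by blast
qed

lemma properties_equivalent:
  assumes s: "1 \<le> s" and y: "relative_normalization s \<A> x y"
  shows "property_a \<A> x y \<longleftrightarrow> property_b \<A> x y" "property_b \<A> x y \<longleftrightarrow> property_c \<A> x y"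
proof -
  have e: "3 * (rel_scalar_curvature (in_chart c x) (in_chart c y) u - mean_curvature (in_chart c x) (in_chart c y) u)
        + pick_invariant (in_chart c x) (in_chart c y) u = 0
      \<longleftrightarrow> 3 * tchebychev_norm (in_chart c x) (in_chart c y) u = 2 * pick_invariant (in_chart c x) (in_chart c y) u"
    "3 * tchebychev_norm (in_chart c x) (in_chart c y) u = 2 * pick_invariant (in_chart c x) (in_chart c y) u
      \<longleftrightarrow> tchebychev_norm (in_chart c x) (in_chart c y) u
        = 2 * (mean_curvature (in_chart c x) (in_chart c y) u - rel_scalar_curvature (in_chart c x) (in_chart c y) u)"
    if "c \<in> \<A>" "u \<in> chart_image c" for c u
  proof -
    interpret rel_chart "chart_image c" "in_chart c x" "in_chart c y"
      by (rule rel_chart_of_normalization[OF s y that(1)])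
    show "3 * (rel_scalar_curvature (in_chart c x) (in_chart c y) u - mean_curvature (in_chart c x) (in_chart c y) u)
        + pick_invariant (in_chart c x) (in_chart c y) u = 0
      \<longleftrightarrow> 3 * tchebychev_norm (in_chart c x) (in_chart c y) u = 2 * pick_invariant (in_chart c x) (in_chart c y) u"
      "3 * tchebychev_norm (in_chart c x) (in_chart c y) u = 2 * pick_invariant (in_chart c x) (in_chart c y) u
      \<longleftrightarrow> tchebychev_norm (in_chart c x) (in_chart c y) u
        = 2 * (mean_curvature (in_chart c x) (in_chart c y) u - rel_scalar_curvature (in_chart c x) (in_chart c y) u)"
      using property_a_iff_b[OF that(2)] property_b_iff_c[OF that(2)] by blast+
  qed
  show "property_a \<A> x y \<longleftrightarrow> property_b \<A> x y" "property_b \<A> x y \<longleftrightarrow> property_c \<A> x y"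
    unfolding property_a_def property_b_def property_c_def Let_def using e by blast+
qed

end

theorem proposition3p2:
  fixes M :: "'m topology" and \<A> :: "'m chart set" and x :: "'m \<Rightarrow> real^3" and r s :: nat
  assumes "4 \<le> r" and "1 \<le> s" and "s < r"
    and "surface r M \<A> x"
    and "negatively_curved \<A> x"
  shows "(\<forall>y. relative_normalization s \<A> x y \<longrightarrow>
            (property_a \<A> x y \<longleftrightarrow> property_b \<A> x y) \<and>
            (property_b \<A> x y \<longleftrightarrow> property_c \<A> x y)) \<and>
         (ruled M x \<longleftrightarrow> (\<exists>y. relative_normalization s \<A> x y \<and> property_a \<A> x y)) \<and>
         (ruled M x \<longleftrightarrow> (\<exists>y. relative_normalization s \<A> x y \<and> property_b \<A> x y)) \<and>
         (ruled M x \<longleftrightarrow> (\<exists>y. relative_normalization s \<A> x y \<and> property_c \<A> x y))"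
proof -
  note h = assms(1,4,5)
  have eq: "property_a \<A> x y \<longleftrightarrow> property_b \<A> x y" "property_b \<A> x y \<longleftrightarrow> property_c \<A> x y"
    if "relative_normalization s \<A> x y" for y
    using properties_equivalent[OF h assms(2) that] .
  have "relative_normalization s \<A> x (euclidean_normal \<A> x)"
    by (rule relative_normalization_euclidean_normal[OF h assms(3)])
  then have "ruled M x \<longleftrightarrow> (\<exists>y. relative_normalization s \<A> x y \<and> property_b \<A> x y)"
    using ruled_imp_property_b[OF h assms(2)] property_b_imp_ruled[OF h assms(2)] by blast
  with eq show ?thesis by blast
qed

end
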